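(* Up to isomorphism (of Lie $\mathfrak{so}_3(\mathbf{R})$-algebras), the minimal solvable Lie $\mathfrak{so}_3(\mathbf{R})$-algebras are $\mathfrak{d}_{2n+1}^{\mathbf{R}}$ ($n\ge1$) and $\mathfrak{hu}_{4n}^i$ ($n\ge1$, $i=0,1,2,3$).
   Context: All Lie algebras are finite-dimensional over $\mathbf{R}$; let $\mathfrak{s}=\mathfrak{so}_3=\mathfrak{so}_3(\mathbf{R})$. A Lie $\mathfrak{s}$-algebra is a Lie algebra $\mathfrak{n}$ with a Lie algebra morphism $\mathfrak{s}\to\mathrm{Der}(\mathfrak{n})$ defining a completely reducible action $(s,n)\mapsto[s,n]$. $[\mathfrak{s},\mathfrak{n}]$ is the Lie subalgebra generated by the brackets $[s,n]$. It is minimal if $[\mathfrak{s},\mathfrak{n}]\ne0$ and every $\mathfrak{s}$-stable Lie subalgebra $\mathfrak{n}'$ satisfies $\mathfrak{n}'=\mathfrak{n}$ or $[\mathfrak{s},\mathfrak{n}']=0$. For $n\ge1$ let $\mathfrak{d}_n^{\mathbf{C}}$ be the irreducible complex $\mathfrak{so}_3$-module of complex dimension $n$ (a symmetric power of the natural action of $\mathfrak{su}_2\simeq\mathfrak{so}_3$ on $\mathbf{C}^2$). $\mathfrak{d}_{2m+1}^{\mathbf{R}}$ is the real $\mathfrak{so}_3$-module of real dimension $2m+1$ whose complexification is $\mathfrak{d}_{2m+1}^{\mathbf{C}}$, viewed as an abelian Lie $\mathfrak{s}$-algebra. For $n\ge 1$, $\mathfrak{u}_{4n}$ is $\mathfrak{d}_{2n}^{\mathbf{C}}$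 viewed as a (irreducible) $4n$-dimensional real $\mathfrak{so}_3$-module. For an $\mathfrak{s}$-module $\mathfrak{v}$, $\mathrm{Alt}_{\mathfrak{s}}(\mathfrak{v})$ is the space of $\mathfrak{s}$-invariant alternating bilinear forms on $\mathfrak{v}$, and $\mathfrak{h}(\mathfrak{v})=\mathfrak{v}\oplus\mathrm{Alt}_{\mathfrak{s}}(\mathfrak{v})^*$ with bracket $[(x,z),(x',z')]=(0,e_{x,x'})$, $e_{x,x'}(\varphi)=\varphi(x,x')$, and $\mathfrak{s}$-action $[s,(x,z)]=([s,x],0)$. The space $\mathrm{Alt}_{\mathfrak{so}_3}(\mathfrak{u}_{4n})$ is three-dimensional; for $i=0,1,2,3$ let $Z_i$ be a fixed $(3-i)$-dimensional linear subspace of $\mathrm{Alt}_{\mathfrak{so}_3}(\mathfrak{u}_{4n})^*$ and set $\mathfrak{hu}_{4n}^i=\mathfrak{h}(\mathfrak{u}_{4n})/Z_i$ (so $\mathfrak{hu}_{4n}^0=\mathfrak{u}_{4n}$ and $\mathfrak{hu}_{4n}^3=\mathfrak{h}(\mathfrak{u}_{4n})$). *)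

theory Defs
  imports "HOL-Analysis.Determinants" "HOL-Algebra.QuotRing" "HOL-Algebra.Module"
    "HOL-Computational_Algebra.Polynomial"
begin

hide_const (open) Polynomial.smult

section \<open>Real vector spaces, Lie algebras and Lie \<open>so\<^sub>3\<close>-algebras\<close>

text \<open>Real vector spaces are HOL-Algebra modules over the ring of reals. In such a record the
  \<open>mult\<close> field \<open>\<otimes>\<close> holds the Lie bracket; the \<open>one\<close> field is never used.\<close>

definition real_ring :: "real ring" where
  "real_ring = \<lparr>carrier = UNIV, mult = (*), one = 1, zero = 0, add = (+)\<rparr>"

abbreviation vsubspace :: "'a set \<Rightarrow> (real, 'a, 'm) module_scheme \<Rightarrow> bool" where
  "vsubspace H V \<equiv> submodule H real_ring V"

definition lin_span :: "(real, 'a, 'm) module_scheme \<Rightarrow> 'a set \<Rightarrow> 'a set" where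
  "lin_span V S = \<Inter>{H. vsubspace H V \<and> S \<subseteq> H}"

definition lin_indep :: "(real, 'a, 'm) module_scheme \<Rightarrow> 'a set \<Rightarrow> bool" where
  "lin_indep V B \<longleftrightarrow> (\<forall>b\<in>B. b \<notin> lin_span V (B - {b}))"

definition has_dim :: "(real, 'a, 'm) module_scheme \<Rightarrow> 'a set \<Rightarrow> nat \<Rightarrow> bool" where
  "has_dim V W d \<longleftrightarrow>
     vsubspace W V \<and> (\<exists>B\<subseteq>W. finite B \<and> card B = d \<and> lin_indep V B \<and> lin_span V B = W)"

locale lie_algebra = module real_ring L for L :: "(real, 'a, 'm) module_scheme" (structure) +
  assumes finite_dim: "\<exists>d. has_dim L (carrier L) d"
    and bracket_closed: "\<lbrakk>x \<in> carrier L; y \<in> carrier L\<rbrakk> \<Longrightarrow> x \<otimes> y \<in> carrier L"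
    and bracket_add_left: "\<lbrakk>x \<in> carrier L; y \<in> carrier L; z \<in> carrier L\<rbrakk> \<Longrightarrow>
      (x \<oplus> y) \<otimes> z = (x \<otimes> z) \<oplus> (y \<otimes> z)"
    and bracket_add_right: "\<lbrakk>x \<in> carrier L; y \<in> carrier L; z \<in> carrier L\<rbrakk> \<Longrightarrow>
      x \<otimes> (y \<oplus> z) = (x \<otimes> y) \<oplus> (x \<otimes> z)"
    and bracket_smult_left: "\<lbrakk>x \<in> carrier L; y \<in> carrier L\<rbrakk> \<Longrightarrow>
      (r \<odot> x) \<otimes> y = r \<odot> (x \<otimes> y)"
    and bracket_smult_right: "\<lbrakk>x \<in> carrier L; y \<in> carrier L\<rbrakk> \<Longrightarrow>
      x \<otimes> (r \<odot> y) = r \<odot> (x \<otimes> y)"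
    and bracket_self: "x \<in> carrier L \<Longrightarrow> x \<otimes> x = \<zero>"
    and jacobi: "\<lbrakk>x \<in> carrier L; y \<in> carrier L; z \<in> carrier L\<rbrakk> \<Longrightarrow>
      (x \<otimes> (y \<otimes> z)) \<oplus> (y \<otimes> (z \<otimes> x)) \<oplus> (z \<otimes> (x \<otimes> y)) = \<zero>"

definition so3 :: "(real^3^3) set" where
  "so3 = {A. transpose A = - A}"

record 'a so3_alg = "(real, 'a) module" +
  sact :: "real^3^3 \<Rightarrow> 'a \<Rightarrow> 'a"

definition s_stable :: "'a so3_alg \<Rightarrow> 'a set \<Rightarrow> bool" where
  "s_stable L H \<longleftrightarrow> (\<forall>A\<in>so3. \<forall>x\<in>H. sact L A x \<in> H)"

locale lie_so3_algebra = lie_algebra L for L :: "'a so3_alg" (structure) +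
  assumes sact_closed: "\<lbrakk>A \<in> so3; x \<in> carrier L\<rbrakk> \<Longrightarrow> sact L A x \<in> carrier L"
    and sact_add: "\<lbrakk>A \<in> so3; x \<in> carrier L; y \<in> carrier L\<rbrakk> \<Longrightarrow>
      sact L A (x \<oplus> y) = sact L A x \<oplus> sact L A y"
    and sact_smult: "\<lbrakk>A \<in> so3; x \<in> carrier L\<rbrakk> \<Longrightarrow> sact L A (r \<odot> x) = r \<odot> sact L A x"
    and sact_derivation: "\<lbrakk>A \<in> so3; x \<in> carrier L; y \<in> carrier L\<rbrakk> \<Longrightarrow>
      sact L A (x \<otimes> y) = (sact L A x \<otimes> y) \<oplus> (x \<otimes> sact L A y)"
    and sact_plus: "\<lbrakk>A \<in> so3; B \<in> so3; x \<in> carrier L\<rbrakk> \<Longrightarrow>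
      sact L (A + B) x = sact L A x \<oplus> sact L B x"
    and sact_scaleR: "\<lbrakk>A \<in> so3; x \<in> carrier L\<rbrakk> \<Longrightarrow> sact L (r *\<^sub>R A) x = r \<odot> sact L A x"
    and sact_commutator: "\<lbrakk>A \<in> so3; B \<in> so3; x \<in> carrier L\<rbrakk> \<Longrightarrow>
      sact L (A ** B - B ** A) x = sact L A (sact L B x) \<ominus> sact L B (sact L A x)"
    and completely_reducible: "\<lbrakk>vsubspace H L; s_stable L H\<rbrakk> \<Longrightarrow>
      \<exists>K. vsubspace K L \<and> s_stable L K \<and> H \<inter> K = {\<zero>} \<and> H <+> K = carrier L"

definition lie_subalgebra :: "'a set \<Rightarrow> (real, 'a, 'm) module_scheme \<Rightarrow> bool" where
  "lie_subalgebra H L \<longleftrightarrow> vsubspace H L \<and> (\<forall>x\<in>H. \<forall>y\<in>H. x \<otimes>\<^bsub>L\<^esub> y \<in> H)"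

definition lie_generated :: "(real, 'a, 'm) module_scheme \<Rightarrow> 'a set \<Rightarrow> 'a set" where
  "lie_generated L S = \<Inter>{K. lie_subalgebra K L \<and> S \<subseteq> K}"

definition s_bracket :: "'a so3_alg \<Rightarrow> 'a set \<Rightarrow> 'a set" where
  "s_bracket L H = lie_generated L {sact L A x | A x. A \<in> so3 \<and> x \<in> H}"

definition minimal_so3 :: "'a so3_alg \<Rightarrow> bool" where
  "minimal_so3 L \<longleftrightarrow>
     s_bracket L (carrier L) \<noteq> {\<zero>\<^bsub>L\<^esub>} \<and>
     (\<forall>H. lie_subalgebra H L \<and> s_stable L H \<longrightarrow> H = carrier L \<or> s_bracket L H = {\<zero>\<^bsub>L\<^esub>})"

primrec derived_lie :: "(real, 'a, 'm) module_scheme \<Rightarrow> nat \<Rightarrow> 'a set" where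
  "derived_lie L 0 = carrier L"
| "derived_lie L (Suc k) =
     lin_span L {x \<otimes>\<^bsub>L\<^esub> y | x y. x \<in> derived_lie L k \<and> y \<in> derived_lie L k}"

definition solvable_lie :: "(real, 'a, 'm) module_scheme \<Rightarrow> bool" where
  "solvable_lie L \<longleftrightarrow> (\<exists>k. derived_lie L k = {\<zero>\<^bsub>L\<^esub>})"

definition minimal_solvable_lie_so3 :: "'a so3_alg \<Rightarrow> bool" where
  "minimal_solvable_lie_so3 L \<longleftrightarrow> lie_so3_algebra L \<and> solvable_lie L \<and> minimal_so3 L"

definition so3_isomorphic :: "'a so3_alg \<Rightarrow> 'b so3_alg \<Rightarrow> bool" where
  "so3_isomorphic L M \<longleftrightarrow> (\<exists>f. bij_betw f (carrier L) (carrier M) \<and>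
     (\<forall>x\<in>carrier L. \<forall>y\<in>carrier L. f (x \<oplus>\<^bsub>L\<^esub> y) = f x \<oplus>\<^bsub>M\<^esub> f y) \<and>
     (\<forall>r. \<forall>x\<in>carrier L. f (r \<odot>\<^bsub>L\<^esub> x) = r \<odot>\<^bsub>M\<^esub> f x) \<and>
     (\<forall>x\<in>carrier L. \<forall>y\<in>carrier L. f (x \<otimes>\<^bsub>L\<^esub> y) = f x \<otimes>\<^bsub>M\<^esub> f y) \<and>
     (\<forall>A\<in>so3. \<forall>x\<in>carrier L. f (sact L A x) = sact M A (f x)))"

text \<open>The quotient by an \<open>so\<^sub>3\<close>-stable ideal, with the operations of \<^const>\<open>FactRing\<close>
  on cosets.\<close>

definition so3_quot :: "'a so3_alg \<Rightarrow> 'a set \<Rightarrow> 'a set so3_alg" where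
  "so3_quot L I =
    \<lparr>carrier = a_rcosets\<^bsub>L\<^esub> I, mult = rcoset_mult L I, one = I +>\<^bsub>L\<^esub> \<one>\<^bsub>L\<^esub>, zero = I,
     add = set_add L,
     smult = (\<lambda>r C. \<Union>x\<in>C. I +>\<^bsub>L\<^esub> (r \<odot>\<^bsub>L\<^esub> x)),
     sact = (\<lambda>A C. \<Union>x\<in>C. I +>\<^bsub>L\<^esub> sact L A x)\<rparr>"


section \<open>The modules \<open>d\<^sub>n\<^sup>C\<close>, \<open>d\<^sub>2\<^sub>m\<^sub>+\<^sub>1\<^sup>R\<close> and \<open>u\<^sub>4\<^sub>n\<close>\<close>

definition su2 :: "(complex^2^2) set" where
  "su2 = {X. (\<chi> i j. cnj (X $ j $ i)) = - X \<and> trace X = 0}"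

text \<open>The isomorphism of \<open>so\<^sub>3\<close> with \<open>su\<^sub>2\<close>: the matrix of the cross product with
  \<open>w\<close>, where \<open>w = (A\<^sub>3\<^sub>2, A\<^sub>1\<^sub>3, A\<^sub>2\<^sub>1)\<close>, goes to \<open>-(i/2) (w\<^sub>1 \<sigma>\<^sub>1 + w\<^sub>2 \<sigma>\<^sub>2 + w\<^sub>3 \<sigma>\<^sub>3)\<close> with the
  Pauli matrices \<open>\<sigma>\<^sub>k\<close>.\<close>

definition spin :: "real^3^3 \<Rightarrow> complex^2^2" where
  "spin A = vector
    [vector [Complex 0 (- (A$2$1) / 2), Complex (- (A$1$3) / 2) (- (A$3$2) / 2)],
     vector [Complex (A$1$3 / 2) (- (A$3$2) / 2), Complex 0 (A$2$1 / 2)]]"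

lemma so3_entries:
  assumes "A \<in> so3"
  shows "A$1$1 = 0" "A$2$2 = 0" "A$3$3 = 0"
    "A$1$2 = - A$2$1" "A$2$3 = - A$3$2" "A$3$1 = - A$1$3"
proof -
  have *: "A $ i $ j = - A $ j $ i" for i j
  proof -
    have "transpose A $ j $ i = (- A) $ j $ i"
      using assms by (simp add: so3_def)
    then show ?thesis by (simp add: transpose_def)
  qed
  have "A $ i $ i = 0" for i
    using *[of i i] by (simp only: equal_neg_zero)
  then show "A$1$1 = 0" "A$2$2 = 0" "A$3$3 = 0"
    by blast+
  show "A$1$2 = - A$2$1" "A$2$3 = - A$3$2" "A$3$1 = - A$1$3"
    by (fact *)+
qed

lemma spin_bij: "bij_betw spin so3 su2"
proof -
  define g :: "complex^2^2 \<Rightarrow> real^3^3" where "g = (\<lambda>X. vector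
    [vector [0, 2 * Im (X$1$1), - 2 * Re (X$1$2)],
     vector [- 2 * Im (X$1$1), 0, 2 * Im (X$1$2)],
     vector [2 * Re (X$1$2), - 2 * Im (X$1$2), 0]])"
  have "g (spin A) = A" if "A \<in> so3" for A
    using so3_entries[OF that] by (simp add: g_def spin_def vec_eq_iff forall_3)
  moreover have "spin (g X) = X" if "X \<in> su2" for X
  proof -
    have X: "cnj (X $ j $ i) = - X $ i $ j" for i j
      using that by (auto simp: su2_def vec_eq_iff)
    have "X$2$2 = - X$1$1"
      using that by (simp add: su2_def trace_def sum_2 add_eq_0_iff)
    then show ?thesis
      using X[of 1 1] X[of 2 1]
      by (simp add: g_def spin_def vec_eq_iff forall_2 complex_eq_iff)
  qed
  moreover have "spin A \<in> su2" for A
    by (simp add: su2_def spin_def vec_eq_iff forall_2 trace_def sum_2 complex_eq_iff)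
  moreover have "g X \<in> so3" for X
    by (simp add: so3_def g_def transpose_def vec_eq_iff forall_3)
  ultimately show ?thesis
    by (intro bij_betw_byWitness[where f' = g]) auto
qed

lemma spin_linear: "linear spin"
  by (rule linearI) (auto simp: spin_def vec_eq_iff forall_2 complex_eq_iff field_simps)

lemma spin_commutator:
  assumes "A \<in> so3" "B \<in> so3"
  shows "spin (A ** B - B ** A) = spin A ** spin B - spin B ** spin A"
  using so3_entries[OF assms(1)] so3_entries[OF assms(2)]
  by (simp add: spin_def vec_eq_iff forall_2 matrix_matrix_mult_def sum_2 sum_3 complex_eq_iff
    field_simps)

text \<open>The symmetric power \<open>Sym\<^sup>m C\<^sup>2\<close> is the space of homogeneous polynomials of degree \<open>m\<close> in the
  basis vectors \<open>e\<^sub>1, e\<^sub>2\<close> of \<open>C\<^sup>2\<close>. It is encoded by the univariate polynomials of degree at most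
  \<open>m\<close> through \<open>e\<^sub>1 = t\<close>, \<open>e\<^sub>2 = 1\<close>. Then \<open>p'\<close> and \<open>m p - t p'\<close> are the two partial derivatives,
  and \<open>X\<close> acts by the derivation that extends \<open>e\<^sub>j \<mapsto> X e\<^sub>j\<close>.\<close>

definition sym_act :: "nat \<Rightarrow> complex^2^2 \<Rightarrow> complex poly \<Rightarrow> complex poly" where
  "sym_act m X p =
     [:X$2$1, X$1$1:] * pderiv p +
     [:X$2$2, X$1$2:] * (Polynomial.smult (of_nat m) p - [:0, 1:] * pderiv p)"

lemma sym_act_natural:
  "sym_act 1 X [:v$2, v$1:] = [:(X *v v)$2, (X *v v)$1:]"
  by (simp add: sym_act_def matrix_vector_mult_def sum_2 pderiv_pCons algebra_simps)

lemma sym_act_leibniz: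
  "sym_act (m + k) X (p * q) = sym_act m X p * q + p * sym_act k X q"
proof -
  have *: "a * (p * q' + q * p') + b * ((u * q + p * v) - t * (p * q' + q * p')) =
      (a * p' + b * (u - t * p')) * q + p * (a * q' + b * (v - t * q'))"
    for a b t u v p q p' q' :: "complex poly"
    by (simp only: algebra_simps)
  have "Polynomial.smult (of_nat (m + k)) (p * q) =
      Polynomial.smult (of_nat m) p * q + p * Polynomial.smult (of_nat k) q"
    by (simp add: smult_add_left)
  then show ?thesis
    unfolding sym_act_def pderiv_mult by (simp only: *)
qed

text \<open>\<open>d\<^sub>n\<^sup>C = Sym\<^sup>n\<^sup>-\<^sup>1 C\<^sup>2\<close> for \<open>n \<ge> 1\<close>, viewed as a real module and an abelian Lie algebra.\<close>

definition d_complex :: "nat \<Rightarrow> complex poly so3_alg" where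
  "d_complex n =
    \<lparr>carrier = {p. degree p < n}, mult = (\<lambda>_ _. 0), one = 0, zero = 0, add = (+),
     smult = (\<lambda>r. Polynomial.smult (complex_of_real r)),
     sact = (\<lambda>A. sym_act (n - 1) (spin A))\<rparr>"

abbreviation u_module :: "nat \<Rightarrow> complex poly so3_alg" where
  "u_module n \<equiv> d_complex (2 * n)"

text \<open>The antilinear map \<open>e\<^sub>1 \<mapsto> e\<^sub>2\<close>, \<open>e\<^sub>2 \<mapsto> -e\<^sub>1\<close> of \<open>C\<^sup>2\<close> commutes with \<open>su\<^sub>2\<close> and induces on
  \<open>Sym\<^sup>2\<^sup>m C\<^sup>2\<close> an antilinear involution, which sends \<open>c t\<^sup>k\<close> to \<open>(-1)\<^sup>k cnj c t\<^sup>2\<^sup>m\<^sup>-\<^sup>k\<close>. The module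
  \<open>d\<^sub>2\<^sub>m\<^sub>+\<^sub>1\<^sup>R\<close> is the set of its fixed points; the lemmas \<open>d_real_stable\<close> and
  \<open>d_real_complexification\<close> say that its complexification is \<open>d\<^sub>2\<^sub>m\<^sub>+\<^sub>1\<^sup>C\<close>.\<close>

definition d_real :: "nat \<Rightarrow> complex poly so3_alg" where
  "d_real m = (d_complex (2 * m + 1))
    \<lparr>carrier := {p. degree p \<le> 2 * m \<and>
       (\<forall>k\<le>2 * m. coeff p (2 * m - k) = (-1) ^ k * cnj (coeff p k))}\<rparr>"

lemma d_real_stable:
  "s_stable (d_real m) (carrier (d_real m))"
  unfolding s_stable_def
proof (intro ballI)
  fix A :: "real^3^3" and p
  assume "A \<in> so3" and p: "p \<in> carrier (d_real m)"
  let ?X = "spin A" and ?N = "2 * m"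
  define q where "q = sym_act ?N ?X p"
  have d: "degree p \<le> ?N" and c: "\<And>k. k \<le> ?N \<Longrightarrow> coeff p (?N - k) = (-1) ^ k * cnj (coeff p k)"
    using p by (auto simp: d_real_def)
  have X: "?X$2$2 = - ?X$1$1" "?X$2$1 = - cnj (?X$1$2)" "cnj (?X$1$1) = - ?X$1$1"
    by (simp_all add: spin_def complex_eq_iff)
  have q: "coeff q k = ?X$1$1 * (2 * of_nat k - of_nat ?N) * coeff p k
      - cnj (?X$1$2) * of_nat (Suc k) * coeff p (Suc k)
      + (if k = 0 then 0 else ?X$1$2 * (of_nat ?N - of_nat (k - 1)) * coeff p (k - 1))" for k
    by (cases k; cases "k - 1")
      (simp_all add: q_def sym_act_def X coeff_pderiv coeff_pCons algebra_simps)
  have dq: "degree q \<le> ?N"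
  proof (rule degree_le, intro allI impI)
    fix k assume k: "k > ?N"
    then have "coeff p k = 0" "coeff p (Suc k) = 0"
      using d by (simp_all add: coeff_eq_0)
    moreover have "(of_nat ?N - of_nat (k - 1)) * coeff p (k - 1) = 0"
    proof (cases "k - 1 = ?N")
      case False
      then have "coeff p (k - 1) = 0" using k d by (intro coeff_eq_0) auto
      then show ?thesis by simp
    qed simp
    ultimately show "coeff q k = 0" using k by (cases k) (simp_all add: q mult.assoc)
  qed
  have "coeff q (?N - k) = (-1) ^ k * cnj (coeff q k)" if k: "k \<le> ?N" for k
  proof -
    have c1: "of_nat (Suc (?N - k)) * coeff p (Suc (?N - k)) =
        (if k = 0 then 0 else (of_nat ?N - of_nat (k - 1)) * (-1) ^ (k - 1) * cnj (coeff p (k - 1)))"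
    proof (cases k)
      case 0
      then show ?thesis using d by (simp add: coeff_eq_0)
    next
      case (Suc j)
      then have "Suc (?N - k) = ?N - j" using k by simp
      then show ?thesis using c[of j] k Suc by (simp add: of_nat_diff)
    qed
    have c2: "(if ?N - k = 0 then 0 else
          (of_nat ?N - of_nat (?N - k - 1)) * coeff p (?N - k - 1)) =
        of_nat (Suc k) * ((-1) ^ Suc k * cnj (coeff p (Suc k)))"
    proof (cases "k = ?N")
      case True
      then show ?thesis using d by (simp add: coeff_eq_0)
    next
      case False
      then have "?N - k - 1 = ?N - Suc k" "Suc k \<le> ?N" using k by auto
      then show ?thesis using c[of "Suc k"] False k by (simp add: of_nat_diff)
    qed
    have "coeff q (?N - k) = ?X$1$1 * (2 * of_nat (?N - k) - of_nat ?N) * coeff p (?N - k)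
      - cnj (?X$1$2) * (of_nat (Suc (?N - k)) * coeff p (Suc (?N - k)))
      + ?X$1$2 * (if ?N - k = 0 then 0 else
          (of_nat ?N - of_nat (?N - k - 1)) * coeff p (?N - k - 1))"
      by (simp add: q mult.assoc)
    also have "\<dots> = (-1) ^ k * cnj (coeff q k)"
      unfolding c1 c2 c[OF k] q
      using k by (cases k) (simp_all add: X of_nat_diff algebra_simps)
    finally show ?thesis .
  qed
  then show "sact (d_real m) A p \<in> carrier (d_real m)"
    using dq by (simp add: d_real_def d_complex_def q_def)
qed

lemma d_real_complexification:
  assumes "p \<in> carrier (d_complex (2 * m + 1))"
  shows "\<exists>!(q, r). q \<in> carrier (d_real m) \<and> r \<in> carrier (d_real m) \<and>
    p = q + Polynomial.smult \<i> r"
proof -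
  let ?N = "2 * m"
  have d: "degree p \<le> ?N"
    using assms by (simp add: d_complex_def)
  define J where "J p = (\<Sum>k\<le>?N. monom ((-1) ^ k * cnj (coeff p (?N - k))) k)" for p
  have J: "coeff (J p) k = (if k \<le> ?N then (-1) ^ k * cnj (coeff p (?N - k)) else 0)" for p k
    by (simp add: J_def coeff_sum if_distrib cong: if_cong)
  have degJ: "degree (J p) \<le> ?N" for p
    by (rule degree_le) (simp add: J)
  have even: "(-1) ^ (?N - k) = ((-1) ^ k :: complex)" if "k \<le> ?N" for k
    using that by (simp add: minus_one_power_iff)
  have JJ: "J (J p) = p" if "degree p \<le> ?N" for p
    using that
    by (intro poly_eqI) (auto simp: J even coeff_eq_0 simp flip: power_mult_distrib mult.assoc)
  have Jadd: "J (p + q) = J p + J q" for p q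
    by (rule poly_eqI) (simp add: J algebra_simps)
  have Jsm: "J (Polynomial.smult c p) = Polynomial.smult (cnj c) (J p)" for c p
    by (rule poly_eqI) (simp add: J)
  have R: "q \<in> carrier (d_real m) \<longleftrightarrow> degree q \<le> ?N \<and> J q = q" for q
  proof -
    have "J q = q" if "degree q \<le> ?N"
      "\<And>k. k \<le> ?N \<Longrightarrow> coeff q (?N - k) = (-1) ^ k * cnj (coeff q k)"
      using that by (intro poly_eqI) (auto simp: J coeff_eq_0 simp flip: power_mult_distrib mult.assoc)
    moreover have "coeff q (?N - k) = (-1) ^ k * cnj (coeff q k)" if "J q = q" "k \<le> ?N" for k
      using J[of q "?N - k"] that even by simp
    ultimately show ?thesis by (auto simp: d_real_def)
  qed
  let ?q = "Polynomial.smult (1/2) (p + J p)" and ?r = "Polynomial.smult (- \<i>/2) (p - J p)"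
  have Jm: "J (p - q) = J p - J q" for p q
    by (rule poly_eqI) (simp add: J algebra_simps)
  have q: "?q \<in> carrier (d_real m)" and r: "?r \<in> carrier (d_real m)"
    unfolding R Jsm Jadd Jm JJ[OF d]
    using d degJ[of p]
    by (auto intro!: poly_eqI simp: algebra_simps degree_add_le degree_diff_le)
  have p: "p = ?q + Polynomial.smult \<i> ?r"
    by (rule poly_eqI) (simp add: field_simps)
  have "q = ?q \<and> r = ?r" if "q \<in> carrier (d_real m)" "r \<in> carrier (d_real m)"
    and *: "p = q + Polynomial.smult \<i> r" for q r
  proof -
    have "J q = q" "J r = r" using that R by auto
    then have Jp: "J p = q - Polynomial.smult \<i> r"
      by (simp add: * Jadd Jsm)
    have sumdiff: "x + y + (x - y) = 2 * x" "x + y - (x - y) = 2 * y" for x y :: complex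
      by simp_all
    have "p + J p = Polynomial.smult 2 q"
      unfolding Jp unfolding *
      by (rule poly_eqI) (simp only: coeff_add coeff_diff coeff_smult sumdiff mult.assoc)
    moreover have "p - J p = Polynomial.smult (2 * \<i>) r"
      unfolding Jp unfolding *
      by (rule poly_eqI) (simp only: coeff_add coeff_diff coeff_smult sumdiff mult.assoc)
    ultimately show ?thesis by simp
  qed
  note uniq = this
  show ?thesis
  proof (rule ex1I[of _ "(?q, ?r)"])
    show "case (?q, ?r) of (q, r) \<Rightarrow> q \<in> carrier (d_real m) \<and> r \<in> carrier (d_real m) \<and>
        p = q + Polynomial.smult \<i> r"
      by (intro case_prodI conjI q r p)
  next
    fix s
    assume s: "case s of (q, r) \<Rightarrow> q \<in> carrier (d_real m) \<and> r \<in> carrier (d_real m) \<and>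
        p = q + Polynomial.smult \<i> r"
    obtain a b where ab: "s = (a, b)" by fastforce
    then have "a = ?q \<and> b = ?r"
      using s by (intro uniq) simp_all
    then show "s = (?q, ?r)"
      unfolding ab prod.inject .
  qed
qed


section \<open>The algebras \<open>h(v)\<close> and \<open>hu\<^sub>4\<^sub>n\<^sup>i\<close>\<close>

text \<open>A form or functional on a carrier is encoded as a function that is zero elsewhere.\<close>

definition alt_forms :: "'a so3_alg \<Rightarrow> (real, 'a \<Rightarrow> 'a \<Rightarrow> real) module" where
  "alt_forms V =
    \<lparr>carrier = {\<phi>.
       (\<forall>x\<in>carrier V. \<forall>y\<in>carrier V. \<forall>z\<in>carrier V.
          \<phi> (x \<oplus>\<^bsub>V\<^esub> y) z = \<phi> x z + \<phi> y z \<and> \<phi> z (x \<oplus>\<^bsub>V\<^esub> y) = \<phi> z x + \<phi> z y) \<and>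
       (\<forall>r. \<forall>x\<in>carrier V. \<forall>y\<in>carrier V.
          \<phi> (r \<odot>\<^bsub>V\<^esub> x) y = r * \<phi> x y \<and> \<phi> x (r \<odot>\<^bsub>V\<^esub> y) = r * \<phi> x y) \<and>
       (\<forall>x\<in>carrier V. \<phi> x x = 0) \<and>
       (\<forall>A\<in>so3. \<forall>x\<in>carrier V. \<forall>y\<in>carrier V. \<phi> (sact V A x) y + \<phi> x (sact V A y) = 0) \<and>
       (\<forall>x y. x \<notin> carrier V \<or> y \<notin> carrier V \<longrightarrow> \<phi> x y = 0)},
     mult = (\<lambda>_ _ _ _. 0), one = (\<lambda>_ _. 0), zero = (\<lambda>_ _. 0),
     add = (\<lambda>\<phi> \<psi> x y. \<phi> x y + \<psi> x y),
     smult = (\<lambda>r \<phi> x y. r * \<phi> x y)\<rparr>"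

definition dual_space :: "(real, 'a, 'm) module_scheme \<Rightarrow> (real, 'a \<Rightarrow> real) module" where
  "dual_space V =
    \<lparr>carrier = {f.
       (\<forall>x\<in>carrier V. \<forall>y\<in>carrier V. f (x \<oplus>\<^bsub>V\<^esub> y) = f x + f y) \<and>
       (\<forall>r. \<forall>x\<in>carrier V. f (r \<odot>\<^bsub>V\<^esub> x) = r * f x) \<and>
       (\<forall>x. x \<notin> carrier V \<longrightarrow> f x = 0)},
     mult = (\<lambda>_ _ _. 0), one = (\<lambda>_. 0), zero = (\<lambda>_. 0),
     add = (\<lambda>f g x. f x + g x),
     smult = (\<lambda>r f x. r * f x)\<rparr>"

abbreviation alt_dual :: "'a so3_alg \<Rightarrow> (real, ('a \<Rightarrow> 'a \<Rightarrow> real) \<Rightarrow> real) module" where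
  "alt_dual V \<equiv> dual_space (alt_forms V)"

definition alt_eval :: "'a so3_alg \<Rightarrow> 'a \<Rightarrow> 'a \<Rightarrow> ('a \<Rightarrow> 'a \<Rightarrow> real) \<Rightarrow> real" where
  "alt_eval V x y = (\<lambda>\<phi>. if \<phi> \<in> carrier (alt_forms V) then \<phi> x y else 0)"

definition heis :: "'a so3_alg \<Rightarrow> ('a \<times> (('a \<Rightarrow> 'a \<Rightarrow> real) \<Rightarrow> real)) so3_alg" where
  "heis V =
    \<lparr>carrier = carrier V \<times> carrier (alt_dual V),
     mult = (\<lambda>(x, z) (x', z'). (\<zero>\<^bsub>V\<^esub>, alt_eval V x x')),
     one = (\<zero>\<^bsub>V\<^esub>, \<zero>\<^bsub>alt_dual V\<^esub>),
     zero = (\<zero>\<^bsub>V\<^esub>, \<zero>\<^bsub>alt_dual V\<^esub>),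
     add = (\<lambda>(x, z) (x', z'). (x \<oplus>\<^bsub>V\<^esub> x', z \<oplus>\<^bsub>alt_dual V\<^esub> z')),
     smult = (\<lambda>r (x, z). (r \<odot>\<^bsub>V\<^esub> x, r \<odot>\<^bsub>alt_dual V\<^esub> z)),
     sact = (\<lambda>A (x, z). (sact V A x, \<zero>\<^bsub>alt_dual V\<^esub>))\<rparr>"

text \<open>\<open>hu\<^sub>4\<^sub>n\<^sup>i\<close> is \<open>hu n Z\<close> for a subspace \<open>Z\<close> of dimension \<open>3 - i\<close>.\<close>

definition hu :: "nat \<Rightarrow> ((complex poly \<Rightarrow> complex poly \<Rightarrow> real) \<Rightarrow> real) set \<Rightarrow>
    (complex poly \<times> ((complex poly \<Rightarrow> complex poly \<Rightarrow> real) \<Rightarrow> real)) set so3_alg" where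
  "hu n Z = so3_quot (heis (u_module n)) ({\<zero>\<^bsub>u_module n\<^esub>} \<times> Z)"

end

theory Submission
  imports Defs "HOL-Computational_Algebra.Fundamental_Theorem_Algebra"
begin

text \<open>Let \<open>L\<close> be minimal and solvable. Its derived algebra \<open>D\<close> is stable and proper, so \<open>so\<^sub>3\<close> acts
  trivially on \<open>D\<close> by minimality. A stable complement \<open>K\<close> of \<open>D\<close> is irreducible, because a
  submodule \<open>W\<close> of \<open>K\<close> with nontrivial action makes \<open>W + D\<close> a stable subalgebra with nontrivial
  action, which is then all of \<open>L\<close>. For \<open>d\<close> in \<open>D\<close> the map \<open>x \<mapsto> [x, d]\<close> is an invariant map from \<open>K\<close>
  to a trivial module, hence zero; it follows that \<open>D\<close> is central and spanned by \<open>[K, K]\<close>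
  (\<open>minimal_solvable_decomposition\<close>). So \<open>L\<close> is given by an irreducible module \<open>K\<close> and an
  invariant alternating map \<open>K \<times> K \<rightarrow> D\<close> whose values span \<open>D\<close>.

  A lowest weight vector in the complexification of \<open>K\<close> gives a homomorphism from \<open>Sym\<^sup>m C\<^sup>2\<close> to the
  complexification, and its real part is a nonzero real homomorphism \<open>Sym\<^sup>m C\<^sup>2 \<rightarrow> K\<close>
  (\<open>homomorphism_from_Sym\<close>). Let \<open>J\<close> be the antilinear map on \<open>Sym\<^sup>m C\<^sup>2\<close> that is induced by the
  quaternionic structure of \<open>C\<^sup>2\<close>; it commutes with \<open>so\<^sub>3\<close> and \<open>J\<^sup>2 = (-1)\<^sup>m\<close>. Every nonzero real
  submodule contains the image of some \<open>p \<mapsto> a p + b J p\<close> with \<open>(a, b) \<noteq> 0\<close>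
  (\<open>stable_contains_quaternion_image\<close>).

  \<^item> For \<open>m = 2 n\<close> this shows that the fixed points of \<open>J\<close> form an irreducible real module, so
    \<open>K\<close> is isomorphic to \<open>d\<^sub>2\<^sub>n\<^sub>+\<^sub>1\<^sup>R\<close>. Its vector of weight zero lies in the radical of every invariant
    alternating map (\<open>d_real_no_alt_form\<close>), so \<open>D = 0\<close>.
  \<^item> For odd \<open>m\<close> the maps \<open>a + b J\<close> are quaternions, hence invertible, so \<open>Sym\<^sup>m C\<^sup>2\<close> is irreducible
    over the reals and isomorphic to \<open>K\<close>. Every invariant alternating map on it is a linear function
    of a universal one with values in \<open>R \<times> C\<close>, made of an invariant Hermitian and an invariant
    bilinear form (\<open>alt_inv_form_classification\<close>). So \<open>L\<close> is the quotient of the universal algebra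
    \<open>Sym\<^sup>m C\<^sup>2 \<times> (R \<times> C)\<close> by a subspace of the three-dimensional centre \<open>R \<times> C\<close>.

  Only the dimension of that subspace matters: the unit quaternions act on the universal algebra by
  automorphisms that rotate the centre, and they permute the subspaces of each dimension
  transitively (\<open>symmetry_to_canonical\<close>). This is also why the choice of \<open>Z\<close> is immaterial.
  Conversely, irreducibility of \<open>d\<^sub>2\<^sub>n\<^sub>+\<^sub>1\<^sup>R\<close> and \<open>u\<^sub>4\<^sub>n\<close> makes the listed algebras minimal.

  Two changes of representation let the linear algebra take place in the type class of real vector
  spaces: an abstract algebra is carried to a space of real polynomials by a choice of a basis
  (\<open>concrete_copy_exists\<close>), and the cosets in \<open>hu\<^sub>4\<^sub>n\<^sup>i\<close> are replaced by the range of an idempotent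
  whose kernel is the subspace factored out (\<open>heis_model\<close>). Minimality and solvability are
  transported along isomorphisms.\<close>

hide_const (open) Polynomial.smult

section \<open>Polynomials as real vectors\<close>

instantiation poly :: (real_vector) real_vector
begin

definition "scaleR r p = map_poly (scaleR r) p"

instance
  by standard
    (auto intro!: poly_eqI simp: scaleR_poly_def coeff_map_poly scaleR_right_distrib
      scaleR_left_distrib)

end

lemma coeff_scaleR [simp]: "coeff (r *\<^sub>R p) k = r *\<^sub>R coeff p k"
  by (simp add: scaleR_poly_def coeff_map_poly)

lemma smult_of_real: "Polynomial.smult (of_real r) p = r *\<^sub>R p"
  for p :: "'a :: {real_algebra_1, comm_semiring_0} poly"
  by (rule poly_eqI) (simp add: scaleR_conv_of_real)

section \<open>The modules \<open>Sym\<^sup>m C\<^sup>2\<close>\<close>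

definition Sym :: "nat \<Rightarrow> complex poly set" where
  "Sym m = {p. degree p \<le> m}"

lemma Sym_iff: "p \<in> Sym m \<longleftrightarrow> (\<forall>k>m. coeff p k = 0)"
  unfolding Sym_def by (auto simp: coeff_eq_0 degree_le)

lemma subspace_Sym: "subspace (Sym m)"
  by (rule subspaceI) (auto simp: Sym_iff)

lemma smult_in_Sym: "p \<in> Sym m \<Longrightarrow> Polynomial.smult c p \<in> Sym m"
  by (auto simp: Sym_iff)

lemma monom_in_Sym: "k \<le> m \<Longrightarrow> monom c k \<in> Sym m"
  by (auto simp: Sym_iff)

lemma Sym_expand: "p \<in> Sym m \<Longrightarrow> p = (\<Sum>k\<le>m. monom (coeff p k) k)"
  unfolding Sym_def by (simp add: poly_as_sum_of_monoms')

text \<open>The coefficient formula turns every identity about \<open>sym_act\<close> below into a comparison of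
  coefficients. The last two summands vanish beyond degree \<open>m\<close>, which is why \<open>Sym m\<close> is stable.\<close>

lemma coeff_sym_act:
  "coeff (sym_act m X p) k = X$2$1 * of_nat (Suc k) * coeff p (Suc k)
     + (X$1$1 * of_nat k + X$2$2 * (of_nat m - of_nat k)) * coeff p k
     + (if k = 0 then 0 else X$1$2 * (of_nat m - of_nat (k - 1)) * coeff p (k - 1))"
  by (cases k; cases "k - 1")
    (simp_all add: sym_act_def coeff_pderiv coeff_pCons algebra_simps)

lemma sym_act_in_Sym:
  assumes "p \<in> Sym m" shows "sym_act m X p \<in> Sym m"
  unfolding Sym_iff
proof (intro allI impI)
  fix k assume "k > m"
  then have "coeff p k = 0" "coeff p (Suc k) = 0"
    using assms by (auto simp: Sym_iff)
  moreover have "(of_nat m - of_nat (k - 1)) * coeff p (k - 1) = 0"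
    using assms \<open>k > m\<close> by (cases "k - 1 = m") (auto simp: Sym_iff)
  ultimately show "coeff (sym_act m X p) k = 0"
    unfolding coeff_sym_act by (auto simp add: mult.assoc simp del: of_nat_diff)
qed

lemma sym_act_add: "sym_act m X (p + q) = sym_act m X p + sym_act m X q"
  by (rule poly_eqI) (simp add: coeff_sym_act algebra_simps)

lemma sym_act_smult: "sym_act m X (Polynomial.smult c p) = Polynomial.smult c (sym_act m X p)"
  by (rule poly_eqI) (simp add: coeff_sym_act algebra_simps)

lemma sym_act_scaleR: "sym_act m X (r *\<^sub>R p) = r *\<^sub>R sym_act m X p"
  by (simp add: smult_of_real[symmetric] sym_act_smult)

lemma linear_sym_act: "linear (sym_act m X)"
  by (rule linearI) (simp_all add: sym_act_add sym_act_scaleR)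

lemma sym_act_plus: "sym_act m (X + Y) p = sym_act m X p + sym_act m Y p"
  by (rule poly_eqI) (simp add: coeff_sym_act algebra_simps)

lemma sym_act_scaleR_left: "sym_act m (r *\<^sub>R X) p = r *\<^sub>R sym_act m X p"
  unfolding smult_of_real[symmetric]
  by (rule poly_eqI) (simp add: coeff_sym_act scaleR_conv_of_real[where 'a = complex] algebra_simps)

text \<open>In this form the action is a vector field plus \<open>m\<close> times the multiplication by a linear
  polynomial, so that commutators can be computed as for first order differential operators.\<close>

lemma sym_act_eq: "sym_act m X p =
    [:X$2$1, X$1$1 - X$2$2, - X$1$2:] * pderiv p + Polynomial.smult (of_nat m) ([:X$2$2, X$1$2:] * p)"
proof -
  have Q: "[:X$2$1, X$1$1 - X$2$2, - X$1$2:] = [:X$2$1, X$1$1:] - [:0, 1:] * [:X$2$2, X$1$2:]"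
    by simp
  show ?thesis
    unfolding sym_act_def Q by (simp only: algebra_simps mult_smult_left mult_smult_right)
qed

lemma sym_act_commutator:
  "sym_act m (X ** Y - Y ** X) p = sym_act m X (sym_act m Y p) - sym_act m Y (sym_act m X p)"
proof -
  define Q where "Q X = [:X$2$1, X$1$1 - X$2$2, - X$1$2:]" for X :: "complex^2^2"
  define l where "l X = [:X$2$2, X$1$2:]" for X :: "complex^2^2"
  have act: "sym_act m X p = Q X * pderiv p + of_nat m * (l X * p)" for X p
    unfolding sym_act_eq Q_def l_def by (simp only: of_nat_poly mult_smult_left smult_one mult_pCons_left mult_zero_left pCons_0_0 add_0_right)
  have Q: "Q (X ** Y - Y ** X) = Q X * pderiv (Q Y) - Q Y * pderiv (Q X)"
    by (simp add: Q_def matrix_matrix_mult_def sum_2 pderiv_pCons algebra_simps)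
  have l: "l (X ** Y - Y ** X) = Q X * pderiv (l Y) - Q Y * pderiv (l X)"
    by (simp add: Q_def l_def matrix_matrix_mult_def sum_2 pderiv_pCons algebra_simps)
  have pd: "pderiv (of_nat m * r) = of_nat m * pderiv r" for r :: "complex poly"
    by (simp add: pderiv_mult)
  show ?thesis
    unfolding act Q l pderiv_add pderiv_mult pd by (simp add: algebra_simps)
qed

text \<open>The matrix of the cross product with \<open>(a, b, c)\<close>; the unit vectors give the standard basis
  \<open>R\<^sub>1, R\<^sub>2, R\<^sub>3\<close> of \<open>so\<^sub>3\<close> with \<open>[R\<^sub>1, R\<^sub>2] = R\<^sub>3\<close> and its cyclic permutations.\<close>

definition so3_mat :: "real \<Rightarrow> real \<Rightarrow> real \<Rightarrow> real^3^3" where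
  "so3_mat a b c = vector [vector [0, - c, b], vector [c, 0, - a], vector [- b, a, 0]]"

lemma so3_mat_in_so3: "so3_mat a b c \<in> so3"
  by (simp add: so3_def so3_mat_def transpose_def vec_eq_iff forall_3)

lemma so3_matE:
  assumes "A \<in> so3" obtains a b c where "A = so3_mat a b c"
proof
  show "A = so3_mat (A$3$2) (A$1$3) (A$2$1)"
    using so3_entries[OF assms] by (simp add: so3_mat_def vec_eq_iff forall_3)
qed

lemma spin_so3_mat: "spin (so3_mat a b c) = vector
    [vector [Complex 0 (- c / 2), Complex (- b / 2) (- a / 2)],
     vector [Complex (b / 2) (- a / 2), Complex 0 (c / 2)]]"
  by (simp add: spin_def so3_mat_def)

lemma so3_mat_decomp:
  "so3_mat a b c = a *\<^sub>R so3_mat 1 0 0 + b *\<^sub>R so3_mat 0 1 0 + c *\<^sub>R so3_mat 0 0 1"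
  by (simp add: so3_mat_def vec_eq_iff forall_3)

lemma subspace_so3: "subspace so3"
proof -
  have "transpose 0 = (0 :: real^3^3)" "transpose (A + B) = transpose A + transpose B"
    "transpose (r *\<^sub>R A) = r *\<^sub>R transpose A" for A B :: "real^3^3" and r
    by (simp_all add: transpose_def vec_eq_iff)
  then show ?thesis
    by (intro subspaceI) (simp_all add: so3_def)
qed

lemma so3_commutator:
  assumes "A \<in> so3" "B \<in> so3" shows "A ** B - B ** A \<in> so3"
proof -
  have "transpose (A ** B - B ** A) = transpose (A ** B) - transpose (B ** A)"
    by (simp add: transpose_def vec_eq_iff)
  also have "\<dots> = (- B) ** (- A) - (- A) ** (- B)"
    using assms by (simp add: so3_def matrix_transpose_mul)
  also have "\<dots> = - (A ** B - B ** A)"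
    by (simp add: matrix_matrix_mult_def vec_eq_iff)
  finally show ?thesis
    unfolding so3_def by (rule CollectI)
qed

lemma so3_brackets:
  "so3_mat 1 0 0 ** so3_mat 0 1 0 - so3_mat 0 1 0 ** so3_mat 1 0 0 = so3_mat 0 0 1"
  "so3_mat 0 1 0 ** so3_mat 0 0 1 - so3_mat 0 0 1 ** so3_mat 0 1 0 = so3_mat 1 0 0"
  "so3_mat 0 0 1 ** so3_mat 1 0 0 - so3_mat 1 0 0 ** so3_mat 0 0 1 = so3_mat 0 1 0"
  by (simp_all add: so3_mat_def vec_eq_iff forall_3 matrix_matrix_mult_def sum_3)

definition rep :: "nat \<Rightarrow> real^3^3 \<Rightarrow> complex poly \<Rightarrow> complex poly" where
  "rep m A = sym_act m (spin A)"

text \<open>\<open>R\<^sub>3\<close> acts on \<open>t\<^sup>k\<close> as \<open>\<i>\<close> times this number.\<close>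

definition weight :: "nat \<Rightarrow> nat \<Rightarrow> real" where
  "weight m k = real m / 2 - real k"

lemma coeff_rep3: "coeff (rep m (so3_mat 0 0 1) p) k = \<i> * of_real (weight m k) * coeff p k"
  by (simp add: rep_def coeff_sym_act spin_so3_mat weight_def Complex_eq field_simps)

lemma rep3_monom: "rep m (so3_mat 0 0 1) (monom c k) = monom (\<i> * of_real (weight m k) * c) k"
  by (rule poly_eqI) (simp add: coeff_rep3)

text \<open>With the raising and lowering operators \<open>E t\<^sup>k = (m - k) t\<^sup>k\<^sup>+\<^sup>1\<close> and \<open>F t\<^sup>k = k t\<^sup>k\<^sup>-\<^sup>1\<close> one has
  \<open>R\<^sub>1 = -(\<i>/2) (E + F)\<close> and \<open>R\<^sub>2 = -(1/2) (E - F)\<close>.\<close>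

lemma rep1_monom: "rep m (so3_mat 1 0 0) (monom c k) =
   monom (- (\<i>/2) * (of_nat m - of_nat k) * c) (Suc k) + monom (- (\<i>/2) * of_nat k * c) (k - 1)"
  by (rule poly_eqI) (auto simp: rep_def coeff_sym_act spin_so3_mat Complex_eq field_simps)

lemma rep2_monom: "rep m (so3_mat 0 1 0) (monom c k) =
   monom (- (1/2) * (of_nat m - of_nat k) * c) (Suc k) + monom ((1/2) * of_nat k * c) (k - 1)"
  by (rule poly_eqI) (auto simp: rep_def coeff_sym_act spin_so3_mat Complex_eq field_simps)

definition stable :: "nat \<Rightarrow> complex poly set \<Rightarrow> bool" where
  "stable m W \<longleftrightarrow> subspace W \<and> (\<forall>A\<in>so3. \<forall>p\<in>W. rep m A p \<in> W)"

lemma linear_rep: "linear (rep m A)"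
  by (simp add: rep_def linear_sym_act)

lemma rep_in_Sym: "p \<in> Sym m \<Longrightarrow> rep m A p \<in> Sym m"
  by (simp add: rep_def sym_act_in_Sym)

lemma stable_Sym: "stable m (Sym m)"
  by (simp add: stable_def subspace_Sym rep_in_Sym)

lemma rep_smult: "rep m A (Polynomial.smult c p) = Polynomial.smult c (rep m A p)"
  by (simp add: rep_def sym_act_smult)

text \<open>The vector \<open>t\<^sup>m\<close> generates the whole module already over the reals: \<open>R\<^sub>3 t\<^sup>m\<close> is an imaginary
  multiple of \<open>t\<^sup>m\<close>, so \<open>W\<close> contains the complex line through \<open>t\<^sup>m\<close>, and \<open>R\<^sub>1\<close> leads from the lines
  through \<open>t\<^sup>m, \<dots>, t\<^sup>k\<close> to the line through \<open>t\<^sup>k\<^sup>-\<^sup>1\<close>.\<close>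

lemma stable_top_imp_Sym:
  assumes W: "stable m W" and top: "monom 1 m \<in> W" and m: "m \<ge> 1"
  shows "Sym m \<subseteq> W"
proof -
  have sub: "subspace W" and act: "\<And>A p. A \<in> so3 \<Longrightarrow> p \<in> W \<Longrightarrow> rep m A p \<in> W"
    using W by (auto simp: stable_def)
  have "j \<le> m \<Longrightarrow> monom c (m - j) \<in> W" for j c
  proof (induction j arbitrary: c rule: less_induct)
    case (less j)
    show ?case
    proof (cases j)
      case 0
      have "rep m (so3_mat 0 0 1) (monom 1 m) \<in> W"
        by (intro act so3_mat_in_so3 top)
      then have i: "monom (\<i> * of_real (weight m m)) m \<in> W"
        by (simp add: rep3_monom)
      have "Re c *\<^sub>R monom 1 m + (Im c / weight m m) *\<^sub>R monom (\<i> * of_real (weight m m)) m \<in> W"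
        by (intro subspace_add[OF sub] subspace_scale[OF sub] top i)
      also have "Re c *\<^sub>R monom 1 m + (Im c / weight m m) *\<^sub>R monom (\<i> * of_real (weight m m)) m = monom c m"
        using m by (intro poly_eqI) (auto simp: weight_def complex_eq_iff)
      finally show ?thesis using 0 by simp
    next
      case (Suc i)
      define k where "k = m - i"
      have k: "k \<ge> 1" "m - j = k - 1" using less.prems Suc by (auto simp: k_def)
      define d where "d = c / (- (\<i>/2) * of_nat k)"
      have "monom d k \<in> W" using less Suc by (auto simp: k_def)
      then have 1: "rep m (so3_mat 1 0 0) (monom d k) \<in> W"
        by (intro act so3_mat_in_so3)
      have 2: "monom (- (\<i>/2) * (of_nat m - of_nat k) * d) (Suc k) \<in> W"
      proof (cases i)
        case 0
        then show ?thesis by (simp add: k_def subspace_0[OF sub])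
      next
        case (Suc l)
        then have "Suc k = m - l" using less.prems \<open>j = Suc i\<close> by (auto simp: k_def)
        then show ?thesis using less.IH[of l] less.prems Suc \<open>j = Suc i\<close> by auto
      qed
      have "monom (- (\<i>/2) * of_nat k * d) (k - 1) \<in> W"
        using subspace_diff[OF sub 1 2] by (simp add: rep1_monom)
      then show ?thesis using k by (simp add: d_def)
    qed
  qed
  then have mon: "monom c k \<in> W" if "k \<le> m" for c k
    using that by (metis diff_diff_cancel diff_le_self)
  show ?thesis
  proof
    fix p assume "p \<in> Sym m"
    have "(\<Sum>k\<le>m. monom (coeff p k) k) \<in> W"
      by (intro subspace_sum[OF sub] mon) simp
    then show "p \<in> W" using Sym_expand[OF \<open>p \<in> Sym m\<close>] by simp
  qed
qed

section \<open>Quaternionic structure and invariant forms\<close>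

lemma coeff_rep:
  "coeff (rep m A p) k = spin A$1$1 * (2 * of_nat k - of_nat m) * coeff p k
     - cnj (spin A$1$2) * of_nat (Suc k) * coeff p (Suc k)
     + (if k = 0 then 0 else spin A$1$2 * (of_nat m - of_nat (k - 1)) * coeff p (k - 1))"
proof -
  have X: "spin A$2$2 = - spin A$1$1" "spin A$2$1 = - cnj (spin A$1$2)"
    by (simp_all add: spin_def complex_eq_iff)
  show ?thesis
    unfolding rep_def coeff_sym_act X by (simp add: algebra_simps)
qed

text \<open>The antilinear map \<open>J\<close> induced by \<open>e\<^sub>1 \<mapsto> e\<^sub>2\<close>, \<open>e\<^sub>2 \<mapsto> -e\<^sub>1\<close>. Its fixed points for even \<open>m\<close> are the
  carrier of \<open>d_real\<close>; for odd \<open>m\<close> it makes \<open>Sym\<^sup>m C\<^sup>2\<close> a quaternionic vector space.\<close>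

definition conjJ :: "nat \<Rightarrow> complex poly \<Rightarrow> complex poly" where
  "conjJ m p = (\<Sum>k\<le>m. monom ((-1) ^ k * cnj (coeff p (m - k))) k)"

lemma coeff_conjJ:
  "coeff (conjJ m p) k = (if k \<le> m then (-1) ^ k * cnj (coeff p (m - k)) else 0)"
  by (simp add: conjJ_def coeff_sum if_distrib cong: if_cong)

lemma conjJ_in_Sym: "conjJ m p \<in> Sym m"
  by (simp add: Sym_iff coeff_conjJ)

lemma conjJ_add: "conjJ m (p + q) = conjJ m p + conjJ m q"
  by (rule poly_eqI) (simp add: coeff_conjJ algebra_simps)

lemma conjJ_diff: "conjJ m (p - q) = conjJ m p - conjJ m q"
  by (rule poly_eqI) (simp add: coeff_conjJ algebra_simps)

lemma conjJ_smult: "conjJ m (Polynomial.smult c p) = Polynomial.smult (cnj c) (conjJ m p)"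
  by (rule poly_eqI) (simp add: coeff_conjJ)

lemma conjJ_scaleR: "conjJ m (r *\<^sub>R p) = r *\<^sub>R conjJ m p"
  by (rule poly_eqI) (simp add: coeff_conjJ)

lemma conjJ_conjJ:
  assumes "p \<in> Sym m" shows "conjJ m (conjJ m p) = Polynomial.smult ((-1) ^ m) p"
proof (rule poly_eqI)
  fix k
  have "(-1) ^ k * (-1) ^ (m - k) = ((-1) ^ m :: complex)" if "k \<le> m"
    using that by (simp flip: power_add)
  then show "coeff (conjJ m (conjJ m p)) k = coeff (Polynomial.smult ((-1) ^ m) p) k"
    using assms by (auto simp: coeff_conjJ Sym_iff not_le simp flip: mult.assoc)
qed

lemma conjJ_rep:
  assumes "p \<in> Sym m" shows "conjJ m (rep m A p) = rep m A (conjJ m p)"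
proof (rule poly_eqI)
  fix k
  have a: "cnj (spin A$1$1) = - spin A$1$1"
    by (simp add: spin_def complex_eq_iff)
  show "coeff (conjJ m (rep m A p)) k = coeff (rep m A (conjJ m p)) k"
  proof (cases "k \<le> m")
    case False
    then show ?thesis
      using rep_in_Sym[OF conjJ_in_Sym[of m p], of A] by (simp add: coeff_conjJ Sym_iff)
  next
    case True
    then obtain j where m: "m = k + j" by (metis le_iff_add)
    have "coeff p (Suc m) = 0" using assms by (simp add: Sym_iff)
    then show ?thesis
      by (cases k; cases j) (simp_all add: m coeff_conjJ coeff_rep a algebra_simps)
  qed
qed

text \<open>The invariant complex bilinear form. Up to the factor \<open>m!\<close>, the weights \<open>k! (m - k)!\<close> are the
  squared norms of the monomials in the symmetric power of the standard inner product.\<close>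

definition bilin :: "nat \<Rightarrow> complex poly \<Rightarrow> complex poly \<Rightarrow> complex" where
  "bilin m p q = (\<Sum>k\<le>m. (-1) ^ k * fact k * fact (m - k) * coeff p k * coeff q (m - k))"

definition herm :: "nat \<Rightarrow> complex poly \<Rightarrow> complex poly \<Rightarrow> complex" where
  "herm m p q = (\<Sum>k\<le>m. fact k * fact (m - k) * coeff p k * cnj (coeff q k))"

text \<open>The diagonal part of the action cancels within each summand, and the raising and lowering parts
  telescope.\<close>

lemma bilin_invariant:
  assumes p: "p \<in> Sym m" and q: "q \<in> Sym m"
  shows "bilin m (rep m A p) q + bilin m p (rep m A q) = 0"
proof -
  let ?b = "spin A$1$2"
  \<comment> \<open>summand \<open>k\<close> of the left-hand side is \<open>G (k + 1) - G k\<close>\<close>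
  define G where "G k = (if k = 0 \<or> k > m then 0 else (-1) ^ k * fact k * fact (Suc m - k) *
    (cnj ?b * coeff p k * coeff q (Suc m - k) - ?b * coeff p (k - 1) * coeff q (m - k)))" for k
  have p0: "coeff p (Suc m) = 0" and q0: "coeff q (Suc m) = 0"
    using p q by (simp_all add: Sym_iff)
  have "(-1) ^ k * fact k * fact (m - k) * coeff (rep m A p) k * coeff q (m - k) +
     (-1) ^ k * fact k * fact (m - k) * coeff p k * coeff (rep m A q) (m - k) = - (G k - G (Suc k))"
    if k: "k \<le> m" for k
  proof -
    obtain j where m: "m = k + j" using k by (metis le_iff_add)
    show ?thesis
    proof (cases k)
      case 0
      then show ?thesis using p0 q0
        by (cases j) (simp_all add: m coeff_rep G_def algebra_simps)
    next
      case (Suc k')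
      then show ?thesis using p0 q0
        by (cases j) (simp_all add: m coeff_rep G_def algebra_simps)
    qed
  qed
  then have "bilin m (rep m A p) q + bilin m p (rep m A q) = - (\<Sum>k\<le>m. G k - G (Suc k))"
    unfolding bilin_def sum.distrib[symmetric] sum_negf[symmetric] by (intro sum.cong) auto
  also have "\<dots> = 0"
    unfolding sum_telescope by (simp add: G_def)
  finally show ?thesis .
qed

text \<open>This transfers invariance from the bilinear to the Hermitian form, since \<open>J\<close> commutes with the
  action.\<close>

lemma bilin_conjJ: "bilin m p (conjJ m q) = (-1) ^ m * herm m p q"
  unfolding bilin_def herm_def sum_distrib_left
proof (rule sum.cong)
  fix k assume "k \<in> {..m}"
  then have "(-1) ^ k * (-1) ^ (m - k) = ((-1) ^ m :: complex)" "m - (m - k) = k"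
    by (simp_all flip: power_add)
  then show "(- 1) ^ k * fact k * fact (m - k) * coeff p k * coeff (conjJ m q) (m - k) =
      (- 1) ^ m * (fact k * fact (m - k) * coeff p k * cnj (coeff q k))"
    by (simp add: coeff_conjJ mult_ac flip: \<open>(-1) ^ k * (-1) ^ (m - k) = ((-1) ^ m :: complex)\<close>)
qed simp

lemma herm_invariant:
  assumes "p \<in> Sym m" "q \<in> Sym m"
  shows "herm m (rep m A p) q + herm m p (rep m A q) = 0"
proof -
  have "(-1) ^ m * (herm m (rep m A p) q + herm m p (rep m A q)) = 0"
    using bilin_invariant[OF assms(1) conjJ_in_Sym, of A q] assms
    by (simp add: bilin_conjJ distrib_left flip: conjJ_rep)
  then show ?thesis by simp
qed

lemma bilin_add_left: "bilin m (p + p') q = bilin m p q + bilin m p' q"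
  and bilin_add_right: "bilin m q (p + p') = bilin m q p + bilin m q p'"
  and bilin_smult_left: "bilin m (Polynomial.smult c p) q = c * bilin m p q"
  and bilin_smult_right: "bilin m p (Polynomial.smult c q) = c * bilin m p q"
  by (simp_all add: bilin_def algebra_simps sum.distrib sum_distrib_left)

lemma herm_add_left: "herm m (p + p') q = herm m p q + herm m p' q"
  and herm_add_right: "herm m q (p + p') = herm m q p + herm m q p'"
  and herm_smult_left: "herm m (Polynomial.smult c p) q = c * herm m p q"
  and herm_smult_right: "herm m p (Polynomial.smult c q) = cnj c * herm m p q"
  by (simp_all add: herm_def algebra_simps sum.distrib sum_distrib_left)

lemma herm_commute: "herm m q p = cnj (herm m p q)"
  by (simp add: herm_def mult_ac)

lemma bilin_commute: "bilin m q p = (-1) ^ m * bilin m p q"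
proof -
  have "bilin m q p = (\<Sum>k\<le>m. (-1) ^ (m - k) * fact (m - k) * fact (m - (m - k)) *
      coeff q (m - k) * coeff p (m - (m - k)))"
    unfolding bilin_def by (rule sum.reindex_bij_witness[of _ "\<lambda>k. m - k" "\<lambda>k. m - k"]) auto
  also have "\<dots> = (-1) ^ m * bilin m p q"
    unfolding bilin_def sum_distrib_left
  proof (rule sum.cong)
    fix k assume k: "k \<in> {..m}"
    then obtain j where m: "m = k + j" by (metis atMost_iff le_iff_add)
    have "(-1) ^ j = (-1) ^ m * ((-1) ^ k :: complex)"
      by (simp add: m power_add flip: power_mult_distrib)
    then show "(- 1) ^ (m - k) * fact (m - k) * fact (m - (m - k)) * coeff q (m - k) * coeff p (m - (m - k)) =
        (- 1) ^ m * ((- 1) ^ k * fact k * fact (m - k) * coeff p k * coeff q (m - k))"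
      by (simp add: m)
  qed simp
  finally show ?thesis .
qed

lemma herm_self_eq_0:
  assumes "p \<in> Sym m" "Re (herm m p p) = 0" shows "p = 0"
proof -
  have "Re (herm m p p) = (\<Sum>k\<le>m. fact k * fact (m - k) * (cmod (coeff p k))\<^sup>2)"
    unfolding herm_def Re_sum
  proof (rule sum.cong)
    fix k
    have "fact k * fact (m - k) * coeff p k * cnj (coeff p k) =
      of_real (fact k * fact (m - k) * (cmod (coeff p k))\<^sup>2)"
      by (simp only: mult.assoc complex_norm_square[symmetric] of_real_mult of_real_fact of_real_power)
    then show "Re (fact k * fact (m - k) * coeff p k * cnj (coeff p k)) =
        fact k * fact (m - k) * (cmod (coeff p k))\<^sup>2"
      by (simp only: Re_complex_of_real)
  qed simp
  then have "\<forall>k\<in>{..m}. fact k * fact (m - k) * (cmod (coeff p k))\<^sup>2 = 0"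
    using assms(2) by (subst (asm) eq_commute) (subst sum_nonneg_eq_0_iff[symmetric], auto)
  then show ?thesis
    using assms(1) by (intro poly_eqI) (auto simp: Sym_iff not_le[symmetric])
qed

lemma herm_monom_left: "j \<le> m \<Longrightarrow> herm m (monom c j) q = fact j * fact (m - j) * c * cnj (coeff q j)"
  by (simp add: herm_def if_distrib if_distribR cong: if_cong)

lemma bilin_monom_left: "j \<le> m \<Longrightarrow> bilin m (monom c j) q = (-1) ^ j * fact j * fact (m - j) * c * coeff q (m - j)"
  by (simp add: bilin_def if_distrib if_distribR cong: if_cong)

section \<open>Irreducibility over the reals\<close>

lemma rep_add: "rep m A (p + q) = rep m A p + rep m A q"
  and rep_scaleR: "rep m A (r *\<^sub>R p) = r *\<^sub>R rep m A p"
  and rep_0 [simp]: "rep m A 0 = 0"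
  using linear_rep[of m A] by (simp_all add: linear_add linear_scale linear_0)

text \<open>If no element of \<open>W\<close> had a coefficient at \<open>t\<^sup>0\<close> or \<open>t\<^sup>m\<close>, then the orthogonal complement of \<open>W\<close> for
  the invariant inner product \<open>Re \<circ> herm\<close> would contain \<open>t\<^sup>m\<close>, which generates everything.\<close>

lemma stable_extremal:
  assumes W: "stable m W" "W \<subseteq> Sym m" "W \<noteq> {0}" and m: "m \<ge> 1"
  shows "\<exists>w\<in>W. coeff w 0 \<noteq> 0 \<or> coeff w m \<noteq> 0"
proof (rule ccontr)
  assume no: "\<not> ?thesis"
  define P where "P = {p \<in> Sym m. \<forall>w\<in>W. Re (herm m p w) = 0}"
  have act: "rep m A w \<in> W" if "A \<in> so3" "w \<in> W" for A w
    using W(1) that by (simp add: stable_def)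
  have h0: "herm m 0 w = 0" for w by (simp add: herm_def)
  have "subspace P"
    by (rule subspaceI)
      (auto simp: P_def h0 subspace_0[OF subspace_Sym] subspace_add[OF subspace_Sym] herm_add_left
        smult_in_Sym herm_smult_left simp flip: smult_of_real)
  moreover have "rep m A p \<in> P" if A: "A \<in> so3" and p: "p \<in> P" for A p
  proof -
    have "Re (herm m (rep m A p) w) = 0" if w: "w \<in> W" for w
    proof -
      have "herm m (rep m A p) w + herm m p (rep m A w) = 0"
        using p w W(2) by (intro herm_invariant) (auto simp: P_def)
      moreover have "Re (herm m p (rep m A w)) = 0"
        using p act[OF A w] by (simp add: P_def)
      ultimately show ?thesis by (simp add: complex_eq_iff)
    qed
    then show ?thesis using p by (simp add: P_def rep_in_Sym)
  qed
  ultimately have "stable m P" by (simp add: stable_def)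
  moreover have "monom 1 m \<in> P"
    using no by (auto simp: P_def monom_in_Sym herm_monom_left)
  ultimately have "Sym m \<subseteq> P"
    using m by (rule stable_top_imp_Sym)
  then have "w = 0" if "w \<in> W" for w
    using that W(2) by (intro herm_self_eq_0[of w m]) (auto simp: P_def)
  moreover have "0 \<in> W" using W(1) by (simp add: stable_def subspace_0)
  ultimately show False using W(3) by blast
qed

lemma rep3_twice: "coeff (rep m (so3_mat 0 0 1) (rep m (so3_mat 0 0 1) p)) k = - ((weight m k)\<^sup>2 *\<^sub>R coeff p k)"
  by (simp add: coeff_rep3 complex_eq_iff power2_eq_square)

text \<open>The real operators \<open>R\<^sub>3\<^sup>2 + (weight m k)\<^sup>2\<close> with \<open>0 < k < m\<close> kill all middle coefficients and
  multiply the two extremal ones by the same nonzero number, because \<open>R\<^sub>3\<^sup>2\<close> is a real scalar on the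
  pair \<open>t\<^sup>k, t\<^sup>m\<^sup>-\<^sup>k\<close>.\<close>

lemma stable_extremal_pair:
  assumes W: "stable m W" "W \<subseteq> Sym m" "W \<noteq> {0}" and m: "m \<ge> 1"
  shows "\<exists>a b. (a \<noteq> 0 \<or> b \<noteq> 0) \<and> monom a m + monom b 0 \<in> W"
proof -
  obtain w where w: "w \<in> W" "coeff w 0 \<noteq> 0 \<or> coeff w m \<noteq> 0"
    using stable_extremal[OF assms] by blast
  have sub: "subspace W" and act: "\<And>A p. A \<in> so3 \<Longrightarrow> p \<in> W \<Longrightarrow> rep m A p \<in> W"
    using W(1) by (auto simp: stable_def)
  \<comment> \<open>the effect on coefficient \<open>j\<close> of the operators belonging to the indices in \<open>S\<close>\<close>
  let ?c = "\<lambda>S j. \<Prod>k\<in>S. (weight m k)\<^sup>2 - (weight m j)\<^sup>2"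
  have "\<exists>q\<in>W. \<forall>j. coeff q j = ?c S j *\<^sub>R coeff w j" if "finite S" for S
    using that
  proof induction
    case empty
    then show ?case using w(1) by auto
  next
    case (insert k S)
    then obtain q where q: "q \<in> W" "\<And>j. coeff q j = ?c S j *\<^sub>R coeff w j" by blast
    let ?R = "rep m (so3_mat 0 0 1)"
    have "?R (?R q) + (weight m k)\<^sup>2 *\<^sub>R q \<in> W"
      by (intro subspace_add[OF sub] subspace_scale[OF sub] act so3_mat_in_so3 q(1))
    moreover have "coeff (?R (?R q) + (weight m k)\<^sup>2 *\<^sub>R q) j = ?c (insert k S) j *\<^sub>R coeff w j" for j
      using insert.hyps by (simp add: rep3_twice q(2) algebra_simps)
    ultimately show ?case by blast
  qed
  from this[of "{1..<m}"] obtain q where q: "q \<in> W" "\<And>j. coeff q j = ?c {1..<m} j *\<^sub>R coeff w j"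
    by auto
  have mid: "coeff q j = 0" if "0 < j" "j < m" for j
    using that by (simp add: q(2)) (auto intro!: prod_zero)
  have ne: "?c {1..<m} j \<noteq> 0" if "j = 0 \<or> j = m" for j
  proof -
    have "(weight m k)\<^sup>2 \<noteq> (weight m j)\<^sup>2" if k: "k \<in> {1..<m}" for k
    proof -
      have "\<bar>weight m k\<bar> < \<bar>weight m j\<bar>"
        using k \<open>j = 0 \<or> j = m\<close> by (auto simp: weight_def abs_if)
      then show ?thesis by (metis less_irrefl power2_abs abs_square_eq_1 abs_ge_zero power_strict_mono zero_less_numeral)
    qed
    then show ?thesis by simp
  qed
  have "q = monom (coeff q m) m + monom (coeff q 0) 0"
  proof (rule poly_eqI)
    fix k
    have "k > m \<Longrightarrow> coeff q k = 0" using q(1) W(2) by (auto simp: Sym_iff)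
    then show "coeff q k = coeff (monom (coeff q m) m + monom (coeff q 0) 0) k"
      using mid[of k] m by (cases "k < m") (auto simp: not_less)
  qed
  moreover have "coeff q m \<noteq> 0 \<or> coeff q 0 \<noteq> 0"
    using w(2) ne by (auto simp: q(2))
  ultimately show ?thesis
    using q(1) by metis
qed

lemma conjJ_monom: "k \<le> m \<Longrightarrow> conjJ m (monom c k) = monom ((-1) ^ (m - k) * cnj c) (m - k)"
  by (rule poly_eqI) (auto simp: coeff_conjJ)

text \<open>The map \<open>p \<mapsto> a p + b J p\<close> commutes with \<open>so\<^sub>3\<close> and sends \<open>t\<^sup>m\<close> to \<open>a t\<^sup>m + b\<close>. Hence the
  preimage of \<open>W\<close> is a stable subspace that contains the generator \<open>t\<^sup>m\<close>.\<close>

lemma stable_contains_quaternion_image: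
  assumes W: "stable m W" "W \<subseteq> Sym m" "W \<noteq> {0}" and m: "m \<ge> 1"
  obtains a b where "a \<noteq> 0 \<or> b \<noteq> 0" "monom a m + monom b 0 \<in> W"
    "\<And>p. p \<in> Sym m \<Longrightarrow> Polynomial.smult a p + Polynomial.smult b (conjJ m p) \<in> W"
proof -
  obtain a b where ab: "a \<noteq> 0 \<or> b \<noteq> 0" "monom a m + monom b 0 \<in> W"
    using stable_extremal_pair[OF assms] by blast
  let ?g = "\<lambda>p. Polynomial.smult a p + Polynomial.smult b (conjJ m p)"
  have sub: "subspace W" and act: "\<And>A p. A \<in> so3 \<Longrightarrow> p \<in> W \<Longrightarrow> rep m A p \<in> W"
    using W(1) by (auto simp: stable_def)
  define P where "P = {p \<in> Sym m. ?g p \<in> W}"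
  have g: "?g 0 = 0" "?g (p + q) = ?g p + ?g q" "?g (r *\<^sub>R p) = r *\<^sub>R ?g p" for p q r
    by (auto intro: poly_eqI simp: coeff_conjJ conjJ_add conjJ_scaleR smult_add_right scaleR_add_right)
  have "subspace P"
    unfolding P_def
    by (rule subspaceI; simp only: mem_Collect_eq g)
      (auto simp: subspace_0 subspace_add subspace_scale sub subspace_Sym)
  moreover have "?g (rep m A p) = rep m A (?g p)" if "p \<in> Sym m" for A p
    using that by (simp add: rep_add rep_smult conjJ_rep)
  ultimately have "stable m P"
    by (auto simp: stable_def P_def rep_in_Sym act)
  moreover have "?g (monom 1 m) = monom a m + monom b 0"
    by (simp add: conjJ_monom smult_monom monom_0)
  then have "monom 1 m \<in> P"
    using ab(2) by (simp add: P_def monom_in_Sym)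
  ultimately have "Sym m \<subseteq> P"
    using m by (rule stable_top_imp_Sym)
  then show ?thesis
    using that[OF ab] by (auto simp: P_def)
qed

text \<open>For odd \<open>m\<close> one has \<open>J\<^sup>2 = -1\<close>, so \<open>a + b J\<close> is a nonzero quaternion with inverse
  \<open>(cnj a - b J) / (\<bar>a\<bar>\<^sup>2 + \<bar>b\<bar>\<^sup>2)\<close>, and its image is everything.\<close>

lemma Sym_odd_irreducible:
  assumes W: "stable m W" "W \<subseteq> Sym m" "W \<noteq> {0}" and m: "odd m"
  shows "W = Sym m"
proof (rule antisym[OF W(2)])
  obtain a b where ab: "a \<noteq> 0 \<or> b \<noteq> 0"
    "\<And>p. p \<in> Sym m \<Longrightarrow> Polynomial.smult a p + Polynomial.smult b (conjJ m p) \<in> W"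
    using stable_contains_quaternion_image[OF W] m by (metis odd_pos Suc_leI One_nat_def)
  define N where "N = (cmod a)\<^sup>2 + (cmod b)\<^sup>2"
  have N: "N > 0" using ab(1) by (auto simp: N_def add_pos_nonneg add_nonneg_pos)
  show "Sym m \<subseteq> W"
  proof
    fix p assume p: "p \<in> Sym m"
    define q where "q = Polynomial.smult (cnj a) p - Polynomial.smult b (conjJ m p)"
    have q: "q \<in> Sym m"
      unfolding q_def by (intro subspace_diff[OF subspace_Sym] smult_in_Sym p conjJ_in_Sym)
    have Jq: "conjJ m q = Polynomial.smult a (conjJ m p) + Polynomial.smult (cnj b) p"
      unfolding q_def using p m by (simp add: conjJ_diff conjJ_smult conjJ_conjJ)
    have "Polynomial.smult a q + Polynomial.smult b (conjJ m q) = N *\<^sub>R p"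
      unfolding Jq unfolding q_def
      by (rule poly_eqI)
        (simp add: N_def scaleR_conv_of_real complex_norm_square algebra_simps del: of_real_power)
    then have "N *\<^sub>R p \<in> W" using ab(2)[OF q] by simp
    moreover have "subspace W" using W(1) by (simp add: stable_def)
    ultimately show "p \<in> W" using subspace_scale[of W "N *\<^sub>R p" "1 / N"] N by simp
  qed
qed

lemma d_real_carrier: "p \<in> carrier (d_real n) \<longleftrightarrow> p \<in> Sym (2 * n) \<and> conjJ (2 * n) p = p"
proof -
  have "(\<forall>k\<le>2 * n. coeff p (2 * n - k) = (- 1) ^ k * cnj (coeff p k)) \<longleftrightarrow> conjJ (2 * n) p = p"
    if "p \<in> Sym (2 * n)"
  proof
    assume *: "\<forall>k\<le>2 * n. coeff p (2 * n - k) = (- 1) ^ k * cnj (coeff p k)"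
    show "conjJ (2 * n) p = p"
      using * that by (intro poly_eqI) (auto simp: coeff_conjJ Sym_iff simp flip: power_mult_distrib mult.assoc)
  next
    assume J: "conjJ (2 * n) p = p"
    show "\<forall>k\<le>2 * n. coeff p (2 * n - k) = (- 1) ^ k * cnj (coeff p k)"
    proof (intro allI impI)
      fix k assume k: "k \<le> 2 * n"
      then have "(-1) ^ (2 * n - k) = ((-1) ^ k :: complex)"
        by (simp add: minus_one_power_iff)
      then show "coeff p (2 * n - k) = (- 1) ^ k * cnj (coeff p k)"
        using arg_cong[OF J, of "\<lambda>q. coeff q (2 * n - k)"] k by (simp add: coeff_conjJ)
    qed
  qed
  then show ?thesis by (auto simp: d_real_def Sym_def)
qed

text \<open>If the image of \<open>a + b J\<close> consists of fixed points of \<open>J\<close>, then \<open>b = cnj a\<close>, and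
  \<open>a p + cnj a J p = q\<close> for a fixed point \<open>q\<close> and \<open>p = q / (2 a)\<close>.\<close>

lemma d_real_irreducible:
  assumes W: "stable (2 * n) W" "W \<subseteq> carrier (d_real n)" "W \<noteq> {0}" and n: "n \<ge> 1"
  shows "W = carrier (d_real n)"
proof (rule antisym[OF W(2)])
  have "W \<subseteq> Sym (2 * n)" using W(2) by (auto simp: d_real_carrier)
  then obtain a b where ab: "a \<noteq> 0 \<or> b \<noteq> 0" "monom a (2 * n) + monom b 0 \<in> W"
    "\<And>p. p \<in> Sym (2 * n) \<Longrightarrow> Polynomial.smult a p + Polynomial.smult b (conjJ (2 * n) p) \<in> W"
    using stable_contains_quaternion_image[OF W(1) _ W(3)] n by (metis One_nat_def Suc_leI le_trans mult_2 le_add1)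
  have "conjJ (2 * n) (monom a (2 * n) + monom b 0) = monom a (2 * n) + monom b 0"
    using ab(2) W(2) by (auto simp: d_real_carrier)
  from arg_cong[OF this, of "\<lambda>p. coeff p 0"] have b: "b = cnj a"
    using n by (simp add: coeff_conjJ)
  with ab(1) have a: "a \<noteq> 0" by auto
  show "carrier (d_real n) \<subseteq> W"
  proof
    fix q assume q: "q \<in> carrier (d_real n)"
    define p where "p = Polynomial.smult (1 / (2 * a)) q"
    have "p \<in> Sym (2 * n)" using q by (auto simp: p_def d_real_carrier intro: smult_in_Sym)
    from ab(3)[OF this]
    have "Polynomial.smult a p + Polynomial.smult b (conjJ (2 * n) p) \<in> W" .
    also have "Polynomial.smult a p + Polynomial.smult b (conjJ (2 * n) p) = q"
    proof -
      have "conjJ (2 * n) q = q" using q by (simp add: d_real_carrier)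
      moreover have "a * (1 / (2 * a)) = 1 / 2" "cnj a * cnj (1 / (2 * a)) = 1 / 2"
        using a by simp_all
      ultimately show ?thesis
        unfolding p_def conjJ_smult b smult_smult by (simp only: flip: smult_add_left) simp
    qed
    finally show "q \<in> W" .
  qed
qed

section \<open>Invariant alternating maps\<close>

text \<open>The three independent invariant alternating real forms on \<open>Sym\<^sup>m C\<^sup>2\<close> for odd \<open>m\<close>, collected into one
  map. The product type carries the inner product that is used to rotate the values.\<close>

definition form :: "nat \<Rightarrow> complex poly \<Rightarrow> complex poly \<Rightarrow> real \<times> complex" where
  "form m p q = (Im (herm m p q), bilin m p q)"

definition alt_inv_form ::
    "nat \<Rightarrow> complex poly set \<Rightarrow> (complex poly \<Rightarrow> complex poly \<Rightarrow> 'd::real_vector) \<Rightarrow> bool" where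
  "alt_inv_form m U \<omega> \<longleftrightarrow>
     (\<forall>x\<in>U. \<forall>y\<in>U. \<forall>z\<in>U. \<omega> (x + y) z = \<omega> x z + \<omega> y z \<and> \<omega> z (x + y) = \<omega> z x + \<omega> z y) \<and>
     (\<forall>r. \<forall>x\<in>U. \<forall>y\<in>U. \<omega> (r *\<^sub>R x) y = r *\<^sub>R \<omega> x y \<and> \<omega> x (r *\<^sub>R y) = r *\<^sub>R \<omega> x y) \<and>
     (\<forall>x\<in>U. \<omega> x x = 0) \<and>
     (\<forall>A\<in>so3. \<forall>x\<in>U. \<forall>y\<in>U. \<omega> (rep m A x) y + \<omega> x (rep m A y) = 0)"

lemma alt_inv_formD:
  assumes "alt_inv_form m U \<omega>"
  shows "\<And>x y z. x \<in> U \<Longrightarrow> y \<in> U \<Longrightarrow> z \<in> U \<Longrightarrow> \<omega> (x + y) z = \<omega> x z + \<omega> y z"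
    "\<And>x y z. x \<in> U \<Longrightarrow> y \<in> U \<Longrightarrow> z \<in> U \<Longrightarrow> \<omega> z (x + y) = \<omega> z x + \<omega> z y"
    "\<And>r x y. x \<in> U \<Longrightarrow> y \<in> U \<Longrightarrow> \<omega> (r *\<^sub>R x) y = r *\<^sub>R \<omega> x y"
    "\<And>r x y. x \<in> U \<Longrightarrow> y \<in> U \<Longrightarrow> \<omega> x (r *\<^sub>R y) = r *\<^sub>R \<omega> x y"
    "\<And>x. x \<in> U \<Longrightarrow> \<omega> x x = 0"
    "\<And>A x y. A \<in> so3 \<Longrightarrow> x \<in> U \<Longrightarrow> y \<in> U \<Longrightarrow> \<omega> (rep m A x) y = - \<omega> x (rep m A y)"
  using assms unfolding alt_inv_form_def by (auto simp: eq_neg_iff_add_eq_0)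

lemma alt_inv_form_zero:
  assumes \<omega>: "alt_inv_form m U \<omega>" and U: "subspace U" and y: "y \<in> U"
  shows "\<omega> 0 y = 0" "\<omega> y 0 = 0"
  using alt_inv_formD(3,4)[OF \<omega> y y, of 0] alt_inv_formD(3)[OF \<omega> subspace_0[OF U] y, of 0]
    alt_inv_formD(4)[OF \<omega> y subspace_0[OF U], of 0] by simp_all

text \<open>Invariance moves the action from one argument to the other. Together with irreducibility or with
  the generator \<open>t\<^sup>m\<close> this is how invariant forms are shown to vanish.\<close>

lemma radical_stable:
  assumes \<omega>: "alt_inv_form m U \<omega>" and U: "stable m U"
  shows "stable m {x \<in> U. \<forall>y\<in>U. \<omega> x y = 0}"
proof -
  have sub: "subspace U" and act: "\<And>A p. A \<in> so3 \<Longrightarrow> p \<in> U \<Longrightarrow> rep m A p \<in> U"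
    using U by (auto simp: stable_def)
  show ?thesis
    unfolding stable_def
    by (auto intro!: subspaceI
        simp: subspace_0 subspace_add subspace_scale sub act alt_inv_formD[OF \<omega>] alt_inv_form_zero[OF \<omega> sub])
qed

lemma form_alt_inv:
  assumes "odd m" shows "alt_inv_form m (Sym m) (form m)"
proof -
  have "bilin m x x = 0" for x
    using bilin_commute[of m x x] assms by simp
  moreover have "Im (herm m x x) = 0" for x
    using herm_commute[of m x x] by (simp add: complex_eq_iff)
  moreover have "Im (herm m (rep m A x) y) + Im (herm m x (rep m A y)) = 0"
    if "x \<in> Sym m" "y \<in> Sym m" for A x y
    using herm_invariant[OF that, of A] by (simp add: complex_eq_iff)
  ultimately show ?thesis
    unfolding alt_inv_form_def form_def smult_of_real[symmetric]
    by (auto simp: bilin_invariant bilin_add_left bilin_add_right bilin_smult_left bilin_smult_right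
        herm_add_left herm_add_right herm_smult_left herm_smult_right scaleR_conv_of_real zero_prod_def
        simp del: smult_of_real)
qed

text \<open>A linear right inverse of \<open>form m t\<^sup>m\<close>.\<close>

definition dual_vec :: "nat \<Rightarrow> real \<times> complex \<Rightarrow> complex poly" where
  "dual_vec m z = monom (Complex 0 (- fst z / fact m)) m + monom (- (1 / fact m) *\<^sub>R snd z) 0"

lemma dual_vec_in_Sym: "dual_vec m z \<in> Sym m"
  unfolding dual_vec_def by (intro subspace_add[OF subspace_Sym] monom_in_Sym) auto

lemma linear_dual_vec: "linear (dual_vec m)"
  by (rule linearI; rule poly_eqI)
    (auto simp: dual_vec_def complex_eq_iff add_divide_distrib diff_divide_distrib algebra_simps)

lemma form_top:
  assumes "odd m"
  shows "form m (monom 1 m) y = (- fact m * Im (coeff y m), - fact m * coeff y 0)"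
  using assms by (simp add: form_def herm_monom_left bilin_monom_left)

lemma form_dual_vec:
  assumes "odd m" shows "form m (monom 1 m) (dual_vec m z) = z"
proof -
  have "m \<noteq> 0" using assms by (intro notI) simp
  then have "coeff (dual_vec m z) m = Complex 0 (- fst z / fact m)" "coeff (dual_vec m z) 0 = - (1 / fact m) *\<^sub>R snd z"
    by (simp_all add: dual_vec_def)
  then show ?thesis
    unfolding form_top[OF assms] by (simp add: prod_eq_iff complex_eq_iff)
qed

text \<open>\<open>R\<^sub>3\<^sup>2\<close> is self-adjoint for an invariant form and has different eigenvalues on the two arguments.\<close>

lemma alt_inv_form_top_middle:
  assumes \<omega>: "alt_inv_form m (Sym m) \<omega>" and k: "0 < k" "k < m"
  shows "\<omega> (monom 1 m) (monom c k) = 0"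
proof -
  let ?R = "rep m (so3_mat 0 0 1)"
  have in_S: "monom 1 m \<in> Sym m" "monom c k \<in> Sym m"
    using k by (auto intro: monom_in_Sym)
  have RR: "?R (?R (monom d j)) = (- (weight m j)\<^sup>2) *\<^sub>R monom d j" for d j
    by (rule poly_eqI) (simp add: rep3_twice)
  have "\<omega> (?R (?R (monom 1 m))) (monom c k) = \<omega> (monom 1 m) (?R (?R (monom c k)))"
    using in_S by (simp add: alt_inv_formD(6)[OF \<omega>] rep_in_Sym so3_mat_in_so3)
  then have "(- (weight m m)\<^sup>2) *\<^sub>R \<omega> (monom 1 m) (monom c k) =
      (- (weight m k)\<^sup>2) *\<^sub>R \<omega> (monom 1 m) (monom c k)"
    unfolding RR using in_S by (simp only: alt_inv_formD(3,4)[OF \<omega>])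
  moreover have "(weight m k)\<^sup>2 < (weight m m)\<^sup>2"
  proof -
    have "\<bar>weight m k\<bar> < \<bar>weight m m\<bar>"
      using k by (auto simp: weight_def abs_if)
    then show ?thesis by (metis abs_ge_zero power2_abs power_strict_mono zero_less_numeral)
  qed
  ultimately show ?thesis
    by simp
qed

lemma alt_inv_form_sum_right:
  assumes \<omega>: "alt_inv_form m U \<omega>" and U: "subspace U" and x: "x \<in> U"
    and "finite S" "\<And>s. s \<in> S \<Longrightarrow> f s \<in> U"
  shows "\<omega> x (\<Sum>s\<in>S. f s) = (\<Sum>s\<in>S. \<omega> x (f s))"
  using assms(4,5)
  by induction (simp_all add: alt_inv_form_zero[OF \<omega> U x] alt_inv_formD(2)[OF \<omega>] x subspace_sum[OF U])

text \<open>An invariant alternating map is determined by its values \<open>\<omega> t\<^sup>m y\<close>. These vanish on the middle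
  monomials and on \<open>y = t\<^sup>m\<close>, so they depend on \<open>\<i> t\<^sup>m\<close> and on the complex line of \<open>t\<^sup>0\<close> only, which
  \<open>dual_vec m\<close> parametrizes. Subtracting the map on the right, which has the same values there,
  gives a map with \<open>t\<^sup>m\<close> in its radical.\<close>

lemma alt_inv_form_classification:
  assumes \<omega>: "alt_inv_form m (Sym m) \<omega>" and m: "odd m" and xy: "x \<in> Sym m" "y \<in> Sym m"
  shows "\<omega> x y = \<omega> (monom 1 m) (dual_vec m (form m x y))"
proof -
  let ?v = "monom 1 m :: complex poly"
  have v: "?v \<in> Sym m" by (rule monom_in_Sym) simp
  note D = alt_inv_formD[OF form_alt_inv[OF m]]
  note D' = alt_inv_formD[OF \<omega>]
  note S = dual_vec_in_Sym rep_in_Sym subspace_add[OF subspace_Sym] subspace_scale[OF subspace_Sym] v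
  define \<eta> where "\<eta> x y = \<omega> x y - \<omega> ?v (dual_vec m (form m x y))" for x y
  have \<eta>: "alt_inv_form m (Sym m) \<eta>"
  proof -
    have "\<omega> ?v (dual_vec m (- z)) = - \<omega> ?v (dual_vec m z)" for z
      using linear_dual_vec[of m] D'(4)[OF v dual_vec_in_Sym, of "-1"]
      by (simp add: linear_neg)
    then show ?thesis
      unfolding alt_inv_form_def \<eta>_def
      by (auto simp: D D' S linear_add[OF linear_dual_vec] linear_scale[OF linear_dual_vec]
          linear_0[OF linear_dual_vec] alt_inv_form_zero(2)[OF \<omega> subspace_Sym v] algebra_simps)
  qed
  have "\<eta> ?v y = 0" if y: "y \<in> Sym m" for y
  proof -
    define z where "z = form m ?v y"
    have m0: "m \<noteq> 0" using m by (intro notI) simp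
    have "(\<Sum>k\<le>m. monom (coeff y k) k) =
        (monom (coeff y 0) 0 + monom (coeff y m) m) + (\<Sum>k\<in>{1..<m}. monom (coeff y k) k)"
    proof -
      have "{..m} = insert 0 (insert m {1..<m})" using m0 by auto
      then show ?thesis using m0 by (simp add: algebra_simps)
    qed
    moreover have "monom (coeff y 0) 0 + monom (coeff y m) m = Re (coeff y m) *\<^sub>R ?v + dual_vec m z"
      using m0 by (intro poly_eqI) (auto simp: dual_vec_def z_def form_top[OF m] complex_eq_iff)
    ultimately have y_eq: "y = (Re (coeff y m) *\<^sub>R ?v + dual_vec m z) + (\<Sum>k\<in>{1..<m}. monom (coeff y k) k)"
      using Sym_expand[OF y] by simp
    have "\<eta> ?v (dual_vec m z) = 0"
      by (simp add: \<eta>_def form_dual_vec[OF m])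
    moreover have "\<eta> ?v (\<Sum>k\<in>{1..<m}. monom (coeff y k) k) = 0"
      by (subst alt_inv_form_sum_right[OF \<eta> subspace_Sym v])
        (auto intro!: sum.neutral monom_in_Sym simp: alt_inv_form_top_middle[OF \<eta>])
    moreover have "(\<Sum>k\<in>{1..<m}. monom (coeff y k) k) \<in> Sym m"
      by (intro subspace_sum[OF subspace_Sym] monom_in_Sym) simp
    ultimately show "\<eta> ?v y = 0"
      by (subst y_eq) (simp add: alt_inv_formD[OF \<eta>] S)
  qed
  then have "?v \<in> {x \<in> Sym m. \<forall>y\<in>Sym m. \<eta> x y = 0}"
    using v by simp
  then have "Sym m \<subseteq> {x \<in> Sym m. \<forall>y\<in>Sym m. \<eta> x y = 0}"
    using m by (intro stable_top_imp_Sym radical_stable[OF \<eta> stable_Sym]) (auto elim: oddE)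
  then show ?thesis
    using xy by (auto simp: \<eta>_def)
qed

lemma stable_d_real: "stable (2 * n) (carrier (d_real n))"
  unfolding stable_def
proof (intro conjI ballI)
  show "subspace (carrier (d_real n))"
    by (rule subspaceI)
      (auto simp: d_real_carrier subspace_0 subspace_add subspace_scale subspace_Sym conjJ_add
        conjJ_scaleR intro!: poly_eqI simp: coeff_conjJ)
qed (simp add: d_real_carrier rep_in_Sym conjJ_rep)

text \<open>The vector \<open>z\<close> of weight zero spans a complement of the image of \<open>R\<^sub>3\<close>. As \<open>R\<^sub>3 z = 0\<close>, it is
  orthogonal to that image, and it is orthogonal to itself because the map is alternating. So \<open>z\<close>
  lies in the radical. The factor \<open>\<i>\<^sup>n\<close> makes \<open>z\<close> a fixed point of \<open>J\<close>.\<close>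

lemma d_real_no_alt_form:
  assumes \<omega>: "alt_inv_form (2 * n) (carrier (d_real n)) \<omega>" and n: "n \<ge> 1"
    and xy: "x \<in> carrier (d_real n)" "y \<in> carrier (d_real n)"
  shows "\<omega> x y = 0"
proof -
  let ?U = "carrier (d_real n)" and ?R = "rep (2 * n) (so3_mat 0 0 1)"
  define z where "z = monom (\<i> ^ n) n"
  have cnj_i: "cnj (\<i> ^ n) = (-1) ^ n * \<i> ^ n"
    by (simp flip: power_mult_distrib)
  have z: "z \<in> ?U"
    by (simp add: z_def d_real_carrier monom_in_Sym conjJ_monom mult_2 flip: power_mult_distrib)
  have Rz: "?R z = 0"
    by (rule poly_eqI) (simp add: z_def coeff_rep3 weight_def)
  have U: "subspace ?U"
    using stable_d_real[of n] by (simp add: stable_def)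
  have "\<omega> z y = 0" if y: "y \<in> ?U" for y
  proof -
    \<comment> \<open>a preimage under \<open>R\<^sub>3\<close> of the part of \<open>y\<close> with nonzero weight\<close>
    define q where "q = (\<Sum>k\<in>{..2 * n} - {n}. monom (coeff y k / (\<i> * of_real (weight (2 * n) k))) k)"
    have cq: "coeff q k = (if k \<le> 2 * n \<and> k \<noteq> n then coeff y k / (\<i> * of_real (weight (2 * n) k)) else 0)" for k
      by (auto simp: q_def coeff_sum if_distrib cong: if_cong)
    have J: "conjJ (2 * n) y = y" and yS: "y \<in> Sym (2 * n)" using y by (auto simp: d_real_carrier)
    have Jc: "(-1) ^ k * cnj (coeff y (2 * n - k)) = coeff y k" if "k \<le> 2 * n" for k
      using arg_cong[OF J, of "\<lambda>p. coeff p k"] that by (simp add: coeff_conjJ)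
    have q: "q \<in> ?U"
      unfolding d_real_carrier
    proof
      show "q \<in> Sym (2 * n)" by (simp add: Sym_iff cq)
      show "conjJ (2 * n) q = q"
      proof (rule poly_eqI)
        fix k
        have "weight (2 * n) (2 * n - k) = - weight (2 * n) k" if "k \<le> 2 * n"
          using that by (simp add: weight_def of_nat_diff)
        then show "coeff (conjJ (2 * n) q) k = coeff q k"
          using Jc[of k] by (auto simp: coeff_conjJ cq)
      qed
    qed
    define w where "w = coeff y n / \<i> ^ n"
    have "coeff y n = (-1) ^ n * cnj (coeff y n)"
      using Jc[of n] by (simp add: mult_2)
    from arg_cong[OF this, of cnj] have "cnj (coeff y n) = (-1) ^ n * coeff y n"
      by simp
    then have "cnj w = ((-1) ^ n * coeff y n) / ((-1) ^ n * \<i> ^ n)"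
      unfolding w_def complex_cnj_divide cnj_i by simp
    then have "cnj w = w"
      by (simp add: w_def)
    then have "w = of_real (Re w)"
      by (simp add: complex_eq_iff)
    moreover have "coeff y n = w * \<i> ^ n"
      by (simp add: w_def)
    ultimately have s: "coeff y n = of_real (Re w) * \<i> ^ n"
      by simp
    have "y = Re w *\<^sub>R z + ?R q"
    proof (rule poly_eqI)
      fix k
      show "coeff y k = coeff (Re w *\<^sub>R z + ?R q) k"
      proof (cases "k = n")
        case True
        then show ?thesis
          using s by (simp add: z_def coeff_rep3 cq scaleR_conv_of_real)
      next
        case False
        then have "weight (2 * n) k \<noteq> 0" by (simp add: weight_def)
        moreover have "k > 2 * n \<Longrightarrow> coeff y k = 0" using yS by (simp add: Sym_iff)
        ultimately show ?thesis
          using False by (auto simp: z_def coeff_rep3 cq)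
      qed
    qed
    moreover have "\<omega> z (?R q) = 0"
      using alt_inv_formD(6)[OF \<omega> so3_mat_in_so3 z q, of 0 0 1] alt_inv_form_zero[OF \<omega> U q] by (simp add: Rz)
    moreover have "?R q \<in> ?U" using stable_d_real[of n] q so3_mat_in_so3 by (simp add: stable_def)
    ultimately show "\<omega> z y = 0"
      by (metis (no_types, lifting) alt_inv_formD(2,4,5)[OF \<omega>] z subspace_scale[OF U] add_0_right scaleR_zero_right)
  qed
  then have "z \<in> {x \<in> ?U. \<forall>y\<in>?U. \<omega> x y = 0}"
    using z by simp
  moreover have "z \<noteq> 0"
    by (simp add: z_def)
  ultimately have "{x \<in> ?U. \<forall>y\<in>?U. \<omega> x y = 0} = ?U"
    using n by (intro d_real_irreducible radical_stable[OF \<omega>] stable_d_real) auto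
  then show ?thesis
    using xy by auto
qed

section \<open>Transport of structure along isomorphisms\<close>

lemma real_ring_simps [simp]:
  "carrier real_ring = UNIV" "mult real_ring = (*)" "one real_ring = 1" "zero real_ring = 0"
  "add real_ring = (+)"
  by (simp_all add: real_ring_def)

lemma cring_real_ring: "cring real_ring"
proof (intro cringI abelian_groupI comm_monoidI)
  fix x :: real
  show "\<exists>y\<in>carrier real_ring. y \<oplus>\<^bsub>real_ring\<^esub> x = \<zero>\<^bsub>real_ring\<^esub>"
    by (rule bexI[of _ "- x"]) simp_all
qed (simp_all add: algebra_simps)

lemma real_moduleI:
  fixes V (structure)
  assumes "\<zero> \<in> carrier V"
    "\<And>x y. x \<in> carrier V \<Longrightarrow> y \<in> carrier V \<Longrightarrow> x \<oplus> y \<in> carrier V"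
    "\<And>x y. x \<in> carrier V \<Longrightarrow> y \<in> carrier V \<Longrightarrow> x \<oplus> y = y \<oplus> x"
    "\<And>x y z. x \<in> carrier V \<Longrightarrow> y \<in> carrier V \<Longrightarrow> z \<in> carrier V \<Longrightarrow> (x \<oplus> y) \<oplus> z = x \<oplus> (y \<oplus> z)"
    "\<And>x. x \<in> carrier V \<Longrightarrow> \<zero> \<oplus> x = x"
    "\<And>(r::real) x. x \<in> carrier V \<Longrightarrow> r \<odot> x \<in> carrier V"
    "\<And>r s x. x \<in> carrier V \<Longrightarrow> (r + s) \<odot> x = r \<odot> x \<oplus> s \<odot> x"
    "\<And>r x y. x \<in> carrier V \<Longrightarrow> y \<in> carrier V \<Longrightarrow> r \<odot> (x \<oplus> y) = r \<odot> x \<oplus> r \<odot> y"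
    "\<And>r s x. x \<in> carrier V \<Longrightarrow> (r * s) \<odot> x = r \<odot> (s \<odot> x)"
    "\<And>x. x \<in> carrier V \<Longrightarrow> 1 \<odot> x = x"
    "\<And>x. x \<in> carrier V \<Longrightarrow> 0 \<odot> x = \<zero>"
  shows "module real_ring V"
proof (rule moduleI[OF cring_real_ring])
  show "abelian_group V"
  proof (rule abelian_groupI)
    fix x assume x: "x \<in> carrier V"
    have "(-1) \<odot> x \<oplus> x = (-1 + 1) \<odot> x"
      using assms(7)[OF x, of "-1" 1] assms(10)[OF x] by simp
    also have "\<dots> = \<zero>" using assms(11)[OF x] by simp
    finally show "\<exists>y\<in>carrier V. y \<oplus> x = \<zero>"
      using assms(6)[OF x] by blast
  qed (use assms in auto)
qed (use assms in auto)

lemma real_zero_smult: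
  assumes "module real_ring M" "x \<in> carrier M" shows "0 \<odot>\<^bsub>M\<^esub> x = \<zero>\<^bsub>M\<^esub>"
proof -
  interpret module real_ring M by fact
  show ?thesis using smult_l_null[OF assms(2)] by simp
qed

lemma real_minus:
  assumes "module real_ring M" and x: "x \<in> carrier M" shows "\<ominus>\<^bsub>M\<^esub> x = (-1) \<odot>\<^bsub>M\<^esub> x"
proof -
  interpret module real_ring M by fact
  have "(-1 + 1) \<odot>\<^bsub>M\<^esub> x = (-1) \<odot>\<^bsub>M\<^esub> x \<oplus>\<^bsub>M\<^esub> 1 \<odot>\<^bsub>M\<^esub> x"
    using smult_l_distr[of "-1" 1 x] x by simp
  then have "(-1) \<odot>\<^bsub>M\<^esub> x \<oplus>\<^bsub>M\<^esub> x = \<zero>\<^bsub>M\<^esub>"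
    using x smult_one[OF x] by (simp add: real_zero_smult[OF assms])
  then show ?thesis
    using x smult_closed[of "-1" x] by (intro M.minus_equality) simp_all
qed

lemma vsubspace_iff:
  assumes "module real_ring V"
  shows "vsubspace H V \<longleftrightarrow> H \<subseteq> carrier V \<and> \<zero>\<^bsub>V\<^esub> \<in> H \<and> (\<forall>x\<in>H. \<forall>y\<in>H. x \<oplus>\<^bsub>V\<^esub> y \<in> H) \<and>
    (\<forall>r. \<forall>x\<in>H. r \<odot>\<^bsub>V\<^esub> x \<in> H)" (is "_ \<longleftrightarrow> ?R")
proof -
  interpret module real_ring V by fact
  show ?thesis
  proof
    assume H: "vsubspace H V"
    obtain x where "x \<in> H" using submoduleE(2)[OF H] by blast
    then have "0 \<odot>\<^bsub>V\<^esub> x \<in> H" "x \<in> carrier V" using submoduleE(1,4)[OF H] by auto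
    then have "\<zero>\<^bsub>V\<^esub> \<in> H" by (simp add: real_zero_smult[OF assms])
    then show ?R using submoduleE(1,4,5)[OF H] by auto
  next
    assume ?R
    then show "vsubspace H V"
      by (intro submoduleI) (auto simp: real_minus[OF assms] subset_iff)
  qed
qed

lemma lin_span_subspace:
  assumes V: "module real_ring V" and S: "S \<subseteq> carrier V"
  shows "vsubspace (lin_span V S) V" "S \<subseteq> lin_span V S" "lin_span V S \<subseteq> carrier V"
proof -
  have c: "vsubspace (carrier V) V"
    using V by (simp add: module.carrier_is_submodule)
  then show "lin_span V S \<subseteq> carrier V"
    using S unfolding lin_span_def by blast
  then show "vsubspace (lin_span V S) V" "S \<subseteq> lin_span V S"
    unfolding vsubspace_iff[OF V] unfolding lin_span_def vsubspace_iff[OF V]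
    by (blast, blast)
qed

lemma lin_span_least: "vsubspace H V \<Longrightarrow> S \<subseteq> H \<Longrightarrow> lin_span V S \<subseteq> H"
  unfolding lin_span_def by blast

text \<open>Only \<open>L\<close> is assumed to be a module. This allows the same locale to prove that a structure is a
  module by comparing it with a known one.\<close>

locale module_iso = L?: module real_ring L for f :: "'a \<Rightarrow> 'b" and L :: "(real, 'a, 'm) module_scheme"
    and M :: "(real, 'b, 'n) module_scheme" +
  assumes f_bij: "bij_betw f (carrier L) (carrier M)"
    and f_zero: "f \<zero>\<^bsub>L\<^esub> = \<zero>\<^bsub>M\<^esub>"
    and f_add: "x \<in> carrier L \<Longrightarrow> y \<in> carrier L \<Longrightarrow> f (x \<oplus>\<^bsub>L\<^esub> y) = f x \<oplus>\<^bsub>M\<^esub> f y"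
    and f_smult: "x \<in> carrier L \<Longrightarrow> f (r \<odot>\<^bsub>L\<^esub> x) = r \<odot>\<^bsub>M\<^esub> f x"
begin

lemma f_carrier: "f ` carrier L = carrier M"
  using f_bij by (simp add: bij_betw_def)

lemma f_inj: "inj_on f (carrier L)"
  using f_bij by (simp add: bij_betw_def)

lemma f_closed: "x \<in> carrier L \<Longrightarrow> f x \<in> carrier M"
  using f_carrier by blast

lemma f_eq_iff: "x \<in> carrier L \<Longrightarrow> y \<in> carrier L \<Longrightarrow> f x = f y \<longleftrightarrow> x = y"
  using f_inj by (simp add: inj_on_eq_iff)

lemma carrier_M_cases: "y \<in> carrier M \<Longrightarrow> (\<And>x. x \<in> carrier L \<Longrightarrow> y = f x \<Longrightarrow> P) \<Longrightarrow> P"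
  using f_carrier by blast

lemma L_smult_closed: "x \<in> carrier L \<Longrightarrow> r \<odot>\<^bsub>L\<^esub> x \<in> carrier L"
  using L.smult_closed by simp

lemma M_module: "module real_ring M"
proof (rule real_moduleI)
  show "\<zero>\<^bsub>M\<^esub> \<in> carrier M"
    using f_closed[of "\<zero>\<^bsub>L\<^esub>"] by (simp add: f_zero)
  fix x y z r s assume x: "x \<in> carrier M"
  then obtain a where a: "a \<in> carrier L" "x = f a" by (rule carrier_M_cases)
  show "r \<odot>\<^bsub>M\<^esub> x \<in> carrier M" "1 \<odot>\<^bsub>M\<^esub> x = x" "0 \<odot>\<^bsub>M\<^esub> x = \<zero>\<^bsub>M\<^esub>" "\<zero>\<^bsub>M\<^esub> \<oplus>\<^bsub>M\<^esub> x = x"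
    "(r * s) \<odot>\<^bsub>M\<^esub> x = r \<odot>\<^bsub>M\<^esub> (s \<odot>\<^bsub>M\<^esub> x)" "(r + s) \<odot>\<^bsub>M\<^esub> x = r \<odot>\<^bsub>M\<^esub> x \<oplus>\<^bsub>M\<^esub> s \<odot>\<^bsub>M\<^esub> x"
    using a L.smult_one[of a] L.smult_assoc1[of r s a] L.smult_l_distr[of r s a]
    by (auto simp: f_closed L_smult_closed real_zero_smult[OF L.module_axioms] simp flip: f_smult f_add f_zero)
  assume y: "y \<in> carrier M"
  then obtain b where b: "b \<in> carrier L" "y = f b" by (rule carrier_M_cases)
  show "x \<oplus>\<^bsub>M\<^esub> y \<in> carrier M" "x \<oplus>\<^bsub>M\<^esub> y = y \<oplus>\<^bsub>M\<^esub> x" "r \<odot>\<^bsub>M\<^esub> (x \<oplus>\<^bsub>M\<^esub> y) = r \<odot>\<^bsub>M\<^esub> x \<oplus>\<^bsub>M\<^esub> r \<odot>\<^bsub>M\<^esub> y"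
    using a b L.smult_r_distr[of r a b]
    by (auto simp: f_closed L_smult_closed L.M.a_comm simp flip: f_smult f_add)
  assume z: "z \<in> carrier M"
  then obtain c where c: "c \<in> carrier L" "z = f c" by (rule carrier_M_cases)
  show "x \<oplus>\<^bsub>M\<^esub> y \<oplus>\<^bsub>M\<^esub> z = x \<oplus>\<^bsub>M\<^esub> (y \<oplus>\<^bsub>M\<^esub> z)"
    using a b c by (auto simp: L.M.a_assoc simp flip: f_add)
qed

lemma vsubspace_image:
  assumes "vsubspace H L" shows "vsubspace (f ` H) M"
  using assms unfolding vsubspace_iff[OF L.module_axioms] vsubspace_iff[OF M_module]
  by (auto simp: f_closed subset_iff simp flip: f_add f_smult f_zero)

lemma vsubspace_preimage:
  assumes "vsubspace K M" shows "vsubspace {x \<in> carrier L. f x \<in> K} L"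
  using assms unfolding vsubspace_iff[OF L.module_axioms] vsubspace_iff[OF M_module]
  by (auto simp: f_add f_smult f_zero L_smult_closed)

lemma image_preimage: "K \<subseteq> carrier M \<Longrightarrow> f ` {x \<in> carrier L. f x \<in> K} = K"
  using f_carrier by auto

lemma lin_span_image:
  assumes "S \<subseteq> carrier L" shows "lin_span M (f ` S) = f ` lin_span L S"
proof (rule antisym)
  note span = lin_span_subspace[OF L.module_axioms assms]
  show "lin_span M (f ` S) \<subseteq> f ` lin_span L S"
    using vsubspace_image[OF span(1)] span(2) by (intro lin_span_least) auto
  have fS: "f ` S \<subseteq> carrier M" using assms f_carrier by blast
  note span' = lin_span_subspace[OF M_module fS]
  have "lin_span L S \<subseteq> {x \<in> carrier L. f x \<in> lin_span M (f ` S)}"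
    using assms span'(2) by (intro lin_span_least vsubspace_preimage span'(1)) auto
  then show "f ` lin_span L S \<subseteq> lin_span M (f ` S)" by auto
qed

lemma has_dim_image:
  assumes "has_dim L W d" shows "has_dim M (f ` W) d"
proof -
  from assms obtain B where W: "vsubspace W L" and B: "B \<subseteq> W" "finite B" "card B = d"
    "lin_indep L B" "lin_span L B = W" by (auto simp: has_dim_def)
  have WL: "W \<subseteq> carrier L" using W by (simp add: vsubspace_iff[OF L.module_axioms])
  have inj: "inj_on f B" using f_inj B(1) WL by (meson inj_on_subset)
  have "lin_indep M (f ` B)"
    unfolding lin_indep_def
  proof
    fix c assume "c \<in> f ` B"
    then obtain b where b: "b \<in> B" "c = f b" by blast
    have "f ` B - {f b} = f ` (B - {b})"
      using inj b(1) by (auto simp: inj_on_def)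
    moreover have "B - {b} \<subseteq> carrier L" using B(1) WL by blast
    ultimately have "lin_span M (f ` B - {c}) = f ` lin_span L (B - {b})"
      using b by (simp add: lin_span_image)
    moreover have "b \<notin> lin_span L (B - {b})" using B(4) b(1) by (simp add: lin_indep_def)
    moreover have "lin_span L (B - {b}) \<subseteq> carrier L"
      using \<open>B - {b} \<subseteq> carrier L\<close> by (rule lin_span_subspace[OF L.module_axioms])
    ultimately show "c \<notin> lin_span M (f ` B - {c})"
      using b B(1) WL by (auto simp: f_eq_iff subset_iff)
  qed
  moreover have "lin_span M (f ` B) = f ` W"
    using B WL by (simp add: lin_span_image)
  ultimately show ?thesis
    unfolding has_dim_def using B inj vsubspace_image[OF W]
    by (intro conjI exI[of _ "f ` B"]) (auto simp: card_image)
qed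

end

lemma lie_subalgebraI:
  assumes "module real_ring L" "H \<subseteq> carrier L" "\<zero>\<^bsub>L\<^esub> \<in> H"
    "\<And>x y. x \<in> H \<Longrightarrow> y \<in> H \<Longrightarrow> x \<oplus>\<^bsub>L\<^esub> y \<in> H" "\<And>r x. x \<in> H \<Longrightarrow> r \<odot>\<^bsub>L\<^esub> x \<in> H"
    "\<And>x y. x \<in> H \<Longrightarrow> y \<in> H \<Longrightarrow> x \<otimes>\<^bsub>L\<^esub> y \<in> H"
  shows "lie_subalgebra H L"
  using assms by (simp add: lie_subalgebra_def vsubspace_iff)

context lie_so3_algebra
begin

text \<open>The generated subalgebra is zero as soon as its generators are, because \<open>{\<zero>}\<close> is a subalgebra.\<close>

lemma s_bracket_eq_zero_iff:
  assumes "H \<subseteq> carrier L"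
  shows "s_bracket L H = {\<zero>} \<longleftrightarrow> (\<forall>A\<in>so3. \<forall>x\<in>H. sact L A x = \<zero>)"
proof
  assume H: "s_bracket L H = {\<zero>}"
  show "\<forall>A\<in>so3. \<forall>x\<in>H. sact L A x = \<zero>"
  proof (intro ballI)
    fix A x assume "A \<in> so3" "x \<in> H"
    then have "sact L A x \<in> s_bracket L H"
      unfolding s_bracket_def lie_generated_def by blast
    then show "sact L A x = \<zero>" using H by simp
  qed
next
  assume H: "\<forall>A\<in>so3. \<forall>x\<in>H. sact L A x = \<zero>"
  have "lie_subalgebra {\<zero>} L"
    using smult_r_null by (intro lie_subalgebraI module_axioms) (simp_all add: bracket_self)
  then have "s_bracket L H \<subseteq> {\<zero>}"
    using H unfolding s_bracket_def lie_generated_def by blast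
  moreover have "\<zero> \<in> s_bracket L H"
    unfolding s_bracket_def lie_generated_def
    by (simp add: lie_subalgebra_def vsubspace_iff[OF module_axioms])
  ultimately show "s_bracket L H = {\<zero>}" by blast
qed

lemma minimal_so3_iff:
  "minimal_so3 L \<longleftrightarrow> (\<exists>A\<in>so3. \<exists>x\<in>carrier L. sact L A x \<noteq> \<zero>) \<and>
    (\<forall>H. lie_subalgebra H L \<and> s_stable L H \<longrightarrow> H = carrier L \<or> (\<forall>A\<in>so3. \<forall>x\<in>H. sact L A x = \<zero>))"
proof -
  have *: "s_bracket L H = {\<zero>} \<longleftrightarrow> (\<forall>A\<in>so3. \<forall>x\<in>H. sact L A x = \<zero>)" if "lie_subalgebra H L" for H
    using that by (intro s_bracket_eq_zero_iff) (simp add: lie_subalgebra_def vsubspace_iff[OF module_axioms])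
  show ?thesis
    unfolding minimal_so3_def s_bracket_eq_zero_iff[OF subset_refl]
    by (rule arg_cong2[where f = conj]) (simp_all add: * cong: conj_cong imp_cong)
qed

end

text \<open>The target is an arbitrary record; that it is a Lie \<open>so\<^sub>3\<close>-algebra is a conclusion.\<close>

locale so3_alg_iso = L?: lie_so3_algebra L + module_iso f L M
  for f :: "'a \<Rightarrow> 'b" and L :: "'a so3_alg" and M :: "'b so3_alg" +
  assumes f_bracket: "x \<in> carrier L \<Longrightarrow> y \<in> carrier L \<Longrightarrow> f (x \<otimes>\<^bsub>L\<^esub> y) = f x \<otimes>\<^bsub>M\<^esub> f y"
    and f_sact: "A \<in> so3 \<Longrightarrow> x \<in> carrier L \<Longrightarrow> f (sact L A x) = sact M A (f x)"
begin

lemma isomorphic: "so3_isomorphic L M"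
  unfolding so3_isomorphic_def
  using f_bij f_add f_smult f_bracket f_sact by blast

lemma s_stable_preimage:
  assumes "s_stable M K" shows "s_stable L {x \<in> carrier L. f x \<in> K}"
  using assms by (auto simp: s_stable_def L.sact_closed f_sact)

lemma s_stable_image:
  assumes "s_stable L H" "H \<subseteq> carrier L" shows "s_stable M (f ` H)"
  using assms by (auto simp: s_stable_def subset_iff simp flip: f_sact)

lemma f_minus: "x \<in> carrier L \<Longrightarrow> y \<in> carrier L \<Longrightarrow> f (x \<ominus>\<^bsub>L\<^esub> y) = f x \<ominus>\<^bsub>M\<^esub> f y"
  using real_minus[OF M_module] real_minus[OF L.module_axioms]
  by (simp add: a_minus_def f_add f_smult f_closed L_smult_closed)

lemma M_lie_so3_algebra: "lie_so3_algebra M"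
proof -
  interpret M: module real_ring M by (rule M_module)
  note cl = L_smult_closed L.bracket_closed L.sact_closed f_closed L.M.minus_closed
  note homs = f_add f_smult f_zero f_bracket f_sact f_minus
  show ?thesis
  proof (unfold_locales, goal_cases)
    case 1
    then show ?case
      using L.finite_dim has_dim_image[of "carrier L"] by (auto simp: f_carrier)
  next
    case (2 x y)
    then show ?case by (auto elim!: carrier_M_cases simp: cl simp flip: homs)
  next
    case (3 x y z)
    then show ?case by (auto elim!: carrier_M_cases simp: cl L.bracket_add_left simp flip: homs)
  next
    case (4 x y z)
    then show ?case by (auto elim!: carrier_M_cases simp: cl L.bracket_add_right simp flip: homs)
  next
    case (5 x y r)
    then show ?case by (auto elim!: carrier_M_cases simp: cl L.bracket_smult_left simp flip: homs)
  next
    case (6 x y r)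
    then show ?case by (auto elim!: carrier_M_cases simp: cl L.bracket_smult_right simp flip: homs)
  next
    case (7 x)
    then show ?case by (auto elim!: carrier_M_cases simp: cl L.bracket_self simp flip: homs)
  next
    case (8 x y z)
    then show ?case by (auto elim!: carrier_M_cases simp: cl L.jacobi simp flip: homs)
  next
    case (9 A x)
    then show ?case by (auto elim!: carrier_M_cases simp: cl simp flip: homs)
  next
    case (10 A x y)
    then show ?case by (auto elim!: carrier_M_cases simp: cl L.sact_add simp flip: homs)
  next
    case (11 A x r)
    then show ?case by (auto elim!: carrier_M_cases simp: cl L.sact_smult simp flip: homs)
  next
    case (12 A x y)
    then show ?case by (auto elim!: carrier_M_cases simp: cl L.sact_derivation simp flip: homs)
  next
    case (13 A B x)
    then show ?case by (auto elim!: carrier_M_cases simp: cl L.sact_plus subspace_add[OF subspace_so3] simp flip: homs)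
  next
    case (14 A x r)
    then show ?case by (auto elim!: carrier_M_cases simp: cl L.sact_scaleR subspace_scale[OF subspace_so3] simp flip: homs)
  next
    case (15 A B x)
    then show ?case by (auto elim!: carrier_M_cases simp: cl L.sact_commutator so3_commutator simp flip: homs)
  next
    case (16 H)
    then have HM: "H \<subseteq> carrier M" by (simp add: vsubspace_iff[OF M_module])
    let ?H = "{x \<in> carrier L. f x \<in> H}"
    obtain K where K: "vsubspace K L" "s_stable L K" "?H \<inter> K = {\<zero>\<^bsub>L\<^esub>}" "?H <+>\<^bsub>L\<^esub> K = carrier L"
      using L.completely_reducible[OF vsubspace_preimage s_stable_preimage] 16 by blast
    have KL: "K \<subseteq> carrier L" using K(1) by (simp add: vsubspace_iff[OF L.module_axioms])
    have "H \<inter> f ` K = f ` (?H \<inter> K)" using KL by blast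
    then have 1: "H \<inter> f ` K = {\<zero>\<^bsub>M\<^esub>}" by (simp add: K(3) f_zero)
    have "H <+>\<^bsub>M\<^esub> f ` K = f ` (?H <+>\<^bsub>L\<^esub> K)"
    proof -
      have "f ` ?H <+>\<^bsub>M\<^esub> f ` K = f ` (?H <+>\<^bsub>L\<^esub> K)"
        using KL by (force simp: set_add_def' f_add subset_iff)
      then show ?thesis by (simp add: image_preimage[OF HM])
    qed
    then have 2: "H <+>\<^bsub>M\<^esub> f ` K = carrier M" by (simp add: K(4) f_carrier)
    show ?case
      using vsubspace_image[OF K(1)] s_stable_image[OF K(2) KL] 1 2 by blast
  qed
qed

lemma derived_lie_subset: "derived_lie L k \<subseteq> carrier L"
proof (induction k)
  case (Suc k)
  show ?case
    unfolding derived_lie.simps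
    using Suc by (intro lin_span_subspace(3)[OF L.module_axioms]) (auto simp: subset_iff L.bracket_closed)
qed simp

lemma derived_lie_image: "derived_lie M k = f ` derived_lie L k"
proof (induction k)
  case 0
  then show ?case by (simp add: f_carrier)
next
  case (Suc k)
  let ?S = "{x \<otimes>\<^bsub>L\<^esub> y |x y. x \<in> derived_lie L k \<and> y \<in> derived_lie L k}"
  have "?S \<subseteq> carrier L" using derived_lie_subset[of k] by (auto simp: subset_iff L.bracket_closed)
  moreover have "{x \<otimes>\<^bsub>M\<^esub> y |x y. x \<in> derived_lie M k \<and> y \<in> derived_lie M k} = f ` ?S"
  proof -
    have br: "f (x \<otimes>\<^bsub>L\<^esub> y) = f x \<otimes>\<^bsub>M\<^esub> f y" if "x \<in> derived_lie L k" "y \<in> derived_lie L k" for x y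
      using that derived_lie_subset[of k] by (intro f_bracket) auto
    have "f ` ?S = {f (x \<otimes>\<^bsub>L\<^esub> y) |x y. x \<in> derived_lie L k \<and> y \<in> derived_lie L k}"
      by blast
    also have "\<dots> = {f x \<otimes>\<^bsub>M\<^esub> f y |x y. x \<in> derived_lie L k \<and> y \<in> derived_lie L k}"
      using br by (intro Collect_cong iffI; elim exE conjE) (metis, metis)
    also have "\<dots> = {x \<otimes>\<^bsub>M\<^esub> y |x y. x \<in> derived_lie M k \<and> y \<in> derived_lie M k}"
      unfolding Suc by blast
    finally show ?thesis by (rule sym)
  qed
  ultimately show ?case by (simp add: lin_span_image)
qed

lemma M_minimal_solvable:
  assumes "minimal_solvable_lie_so3 L" shows "minimal_solvable_lie_so3 M"
proof -
  interpret M: lie_so3_algebra M by (rule M_lie_so3_algebra)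
  have sol: "solvable_lie L" and min: "minimal_so3 L"
    using assms by (auto simp: minimal_solvable_lie_so3_def)
  have "solvable_lie M"
  proof -
    obtain k where "derived_lie L k = {\<zero>\<^bsub>L\<^esub>}"
      using sol by (auto simp: solvable_lie_def)
    then have "derived_lie M k = {\<zero>\<^bsub>M\<^esub>}"
      by (simp add: derived_lie_image f_zero)
    then show ?thesis by (auto simp: solvable_lie_def)
  qed
  moreover have "minimal_so3 M"
    unfolding M.minimal_so3_iff
  proof (intro conjI allI impI)
    obtain A x where "A \<in> so3" "x \<in> carrier L" "sact L A x \<noteq> \<zero>\<^bsub>L\<^esub>"
      using min by (auto simp: L.minimal_so3_iff)
    then have "f (sact L A x) \<noteq> f \<zero>\<^bsub>L\<^esub>"
      by (subst f_eq_iff) (auto simp: L.sact_closed)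
    then show "\<exists>A\<in>so3. \<exists>x\<in>carrier M. sact M A x \<noteq> \<zero>\<^bsub>M\<^esub>"
      using \<open>A \<in> so3\<close> \<open>x \<in> carrier L\<close> by (auto simp: f_sact f_zero f_closed intro!: bexI[of _ A] bexI[of _ "f x"])
  next
    fix H assume H: "lie_subalgebra H M \<and> s_stable M H"
    let ?H = "{x \<in> carrier L. f x \<in> H}"
    have HM: "H \<subseteq> carrier M" using H by (simp add: lie_subalgebra_def vsubspace_iff[OF M_module])
    have "lie_subalgebra ?H L" "s_stable L ?H"
      using H by (auto simp: lie_subalgebra_def vsubspace_preimage s_stable_preimage L.bracket_closed f_bracket)
    then consider "?H = carrier L" | "\<forall>A\<in>so3. \<forall>x\<in>?H. sact L A x = \<zero>\<^bsub>L\<^esub>"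
      using min unfolding L.minimal_so3_iff by blast
    then show "H = carrier M \<or> (\<forall>A\<in>so3. \<forall>x\<in>H. sact M A x = \<zero>\<^bsub>M\<^esub>)"
    proof cases
      case 1
      then show ?thesis using image_preimage[OF HM] f_carrier by auto
    next
      case 2
      have "sact M A y = \<zero>\<^bsub>M\<^esub>" if A: "A \<in> so3" and y: "y \<in> H" for A y
      proof -
        obtain x where "x \<in> carrier L" "y = f x" using y HM f_carrier by blast
        then show ?thesis using 2 A y f_sact[of A x] f_zero by auto
      qed
      then show ?thesis by blast
    qed
  qed
  ultimately show ?thesis
    by (simp add: minimal_solvable_lie_so3_def M_lie_so3_algebra)
qed

end

lemma so3_isomorphic_sym:
  assumes L: "lie_so3_algebra L" and iso: "so3_isomorphic L M"
  shows "so3_isomorphic M L"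
proof -
  interpret L: lie_so3_algebra L by fact
  obtain f where f: "bij_betw f (carrier L) (carrier M)"
    "\<And>x y. x \<in> carrier L \<Longrightarrow> y \<in> carrier L \<Longrightarrow> f (x \<oplus>\<^bsub>L\<^esub> y) = f x \<oplus>\<^bsub>M\<^esub> f y"
    "\<And>r x. x \<in> carrier L \<Longrightarrow> f (r \<odot>\<^bsub>L\<^esub> x) = r \<odot>\<^bsub>M\<^esub> f x"
    "\<And>x y. x \<in> carrier L \<Longrightarrow> y \<in> carrier L \<Longrightarrow> f (x \<otimes>\<^bsub>L\<^esub> y) = f x \<otimes>\<^bsub>M\<^esub> f y"
    "\<And>A x. A \<in> so3 \<Longrightarrow> x \<in> carrier L \<Longrightarrow> f (sact L A x) = sact M A (f x)"
    using iso unfolding so3_isomorphic_def by blast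
  define g where "g = the_inv_into (carrier L) f"
  have inj: "inj_on f (carrier L)" and im: "f ` carrier L = carrier M"
    using f(1) by (auto simp: bij_betw_def)
  have g: "bij_betw g (carrier M) (carrier L)"
    unfolding g_def by (rule bij_betw_the_inv_into[OF f(1)])
  have gf: "g (f x) = x" if "x \<in> carrier L" for x
    using inj that by (simp add: g_def the_inv_into_f_f)
  have *: "\<exists>x\<in>carrier L. y = f x" if "y \<in> carrier M" for y
    using that im by blast
  have cl: "r \<odot>\<^bsub>L\<^esub> x \<in> carrier L" if "x \<in> carrier L" for r x
    using that L.smult_closed by simp
  show ?thesis
    unfolding so3_isomorphic_def
    by (intro exI[of _ g] conjI g ballI allI)
      (auto dest!: * simp: gf cl L.bracket_closed L.sact_closed simp flip: f(2-5))
qed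

lemma so3_isomorphic_trans:
  assumes "so3_isomorphic L M" "so3_isomorphic M N"
  shows "so3_isomorphic L N"
proof -
  obtain f where f: "bij_betw f (carrier L) (carrier M)"
    "\<And>x y. x \<in> carrier L \<Longrightarrow> y \<in> carrier L \<Longrightarrow> f (x \<oplus>\<^bsub>L\<^esub> y) = f x \<oplus>\<^bsub>M\<^esub> f y"
    "\<And>r x. x \<in> carrier L \<Longrightarrow> f (r \<odot>\<^bsub>L\<^esub> x) = r \<odot>\<^bsub>M\<^esub> f x"
    "\<And>x y. x \<in> carrier L \<Longrightarrow> y \<in> carrier L \<Longrightarrow> f (x \<otimes>\<^bsub>L\<^esub> y) = f x \<otimes>\<^bsub>M\<^esub> f y"
    "\<And>A x. A \<in> so3 \<Longrightarrow> x \<in> carrier L \<Longrightarrow> f (sact L A x) = sact M A (f x)"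
    using assms(1) unfolding so3_isomorphic_def by blast
  obtain g where g: "bij_betw g (carrier M) (carrier N)"
    "\<And>x y. x \<in> carrier M \<Longrightarrow> y \<in> carrier M \<Longrightarrow> g (x \<oplus>\<^bsub>M\<^esub> y) = g x \<oplus>\<^bsub>N\<^esub> g y"
    "\<And>r x. x \<in> carrier M \<Longrightarrow> g (r \<odot>\<^bsub>M\<^esub> x) = r \<odot>\<^bsub>N\<^esub> g x"
    "\<And>x y. x \<in> carrier M \<Longrightarrow> y \<in> carrier M \<Longrightarrow> g (x \<otimes>\<^bsub>M\<^esub> y) = g x \<otimes>\<^bsub>N\<^esub> g y"
    "\<And>A x. A \<in> so3 \<Longrightarrow> x \<in> carrier M \<Longrightarrow> g (sact M A x) = sact N A (g x)"
    using assms(2) unfolding so3_isomorphic_def by blast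
  have "\<And>x. x \<in> carrier L \<Longrightarrow> f x \<in> carrier M"
    using f(1) by (auto simp: bij_betw_def)
  then show ?thesis
    unfolding so3_isomorphic_def
    by (intro exI[of _ "g \<circ> f"] conjI bij_betw_trans[OF f(1) g(1)]) (auto simp: f g)
qed

section \<open>Algebras on subspaces of real vector spaces\<close>

text \<open>The operations of the record are those of the type class of real vector spaces, so that the
  dimension theory of the type class applies to the carrier.\<close>

definition concrete :: "(real, 'v::real_vector, 'm) module_scheme \<Rightarrow> bool" where
  "concrete L \<longleftrightarrow> subspace (carrier L) \<and> \<zero>\<^bsub>L\<^esub> = 0 \<and> add L = (+) \<and> smult L = scaleR"

lemma concreteD:
  assumes "concrete L"
  shows "subspace (carrier L)" "\<zero>\<^bsub>L\<^esub> = 0" "x \<oplus>\<^bsub>L\<^esub> y = x + y" "r \<odot>\<^bsub>L\<^esub> x = r *\<^sub>R x"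
  using assms by (simp_all add: concrete_def)

lemma concrete_module:
  assumes "concrete L" shows "module real_ring L"
  by (rule real_moduleI)
    (use concreteD(1)[OF assms] in \<open>auto simp: concreteD[OF assms] subspace_0 subspace_add
       subspace_scale scaleR_left_distrib scaleR_right_distrib\<close>)

lemma concrete_vsubspace_iff:
  assumes "concrete L" shows "vsubspace H L \<longleftrightarrow> subspace H \<and> H \<subseteq> carrier L"
  unfolding vsubspace_iff[OF concrete_module[OF assms]] subspace_def
  by (auto simp: concreteD[OF assms])

lemma concrete_minus:
  assumes "concrete L" "x \<in> carrier L" "y \<in> carrier L" shows "x \<ominus>\<^bsub>L\<^esub> y = x - y"
  using real_minus[OF concrete_module[OF assms(1)] assms(3)]
  by (simp add: a_minus_def concreteD[OF assms(1)])

lemma concrete_lin_span: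
  assumes L: "concrete L" and S: "S \<subseteq> carrier L" shows "lin_span L S = span S"
proof (rule antisym)
  have "span S \<subseteq> carrier L"
    using S concreteD(1)[OF L] by (rule span_minimal)
  then show "lin_span L S \<subseteq> span S"
    by (intro lin_span_least) (auto simp: concrete_vsubspace_iff[OF L] span_superset)
  show "span S \<subseteq> lin_span L S"
    using lin_span_subspace[OF concrete_module[OF L] S]
    by (intro span_minimal) (auto simp: concrete_vsubspace_iff[OF L])
qed

lemma concrete_lin_indep:
  assumes L: "concrete L" and S: "S \<subseteq> carrier L" shows "lin_indep L S \<longleftrightarrow> independent S"
proof -
  have "lin_span L (S - {b}) = span (S - {b})" for b
    using S by (intro concrete_lin_span[OF L]) blast
  then show ?thesis by (auto simp: lin_indep_def dependent_def)
qed

lemma concrete_has_dim: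
  assumes L: "concrete L" and B: "finite B" "carrier L \<subseteq> span B"
  shows "\<exists>d. has_dim L (carrier L) d"
proof -
  obtain C where C: "C \<subseteq> carrier L" "independent C" "carrier L \<subseteq> span C"
    by (rule maximal_independent_subset)
  have "finite C"
    using independent_span_bound[OF B(1) C(2)] C(1) B(2) by blast
  moreover have "span C = carrier L"
    using C concreteD(1)[OF L] by (intro antisym span_minimal)
  ultimately have "has_dim L (carrier L) (card C)"
    unfolding has_dim_def using C concreteD(1)[OF L]
    by (auto simp: concrete_vsubspace_iff[OF L] concrete_lin_span[OF L] concrete_lin_indep[OF L] intro!: exI[of _ C])
  then show ?thesis by blast
qed

text \<open>The Jacobi identity is replaced by the vanishing of triple brackets, which holds in all algebras
  built here.\<close>

lemma concrete_lie_so3_algebraI: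
  fixes L :: "'v::real_vector so3_alg" (structure)
  assumes L: "concrete L" and B: "finite B" "carrier L \<subseteq> span B"
    and bracket: "\<And>x y. x \<in> carrier L \<Longrightarrow> y \<in> carrier L \<Longrightarrow> x \<otimes> y \<in> carrier L"
      "\<And>x y z. x \<in> carrier L \<Longrightarrow> y \<in> carrier L \<Longrightarrow> z \<in> carrier L \<Longrightarrow> (x + y) \<otimes> z = x \<otimes> z + y \<otimes> z"
      "\<And>x y z. x \<in> carrier L \<Longrightarrow> y \<in> carrier L \<Longrightarrow> z \<in> carrier L \<Longrightarrow> x \<otimes> (y + z) = x \<otimes> y + x \<otimes> z"
      "\<And>r x y. x \<in> carrier L \<Longrightarrow> y \<in> carrier L \<Longrightarrow> (r *\<^sub>R x) \<otimes> y = r *\<^sub>R (x \<otimes> y)"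
      "\<And>r x y. x \<in> carrier L \<Longrightarrow> y \<in> carrier L \<Longrightarrow> x \<otimes> (r *\<^sub>R y) = r *\<^sub>R (x \<otimes> y)"
      "\<And>x. x \<in> carrier L \<Longrightarrow> x \<otimes> x = 0"
      "\<And>x y z. x \<in> carrier L \<Longrightarrow> y \<in> carrier L \<Longrightarrow> z \<in> carrier L \<Longrightarrow> x \<otimes> (y \<otimes> z) = 0"
    and act: "\<And>A x. A \<in> so3 \<Longrightarrow> x \<in> carrier L \<Longrightarrow> sact L A x \<in> carrier L"
      "\<And>A x y. A \<in> so3 \<Longrightarrow> x \<in> carrier L \<Longrightarrow> y \<in> carrier L \<Longrightarrow> sact L A (x + y) = sact L A x + sact L A y"
      "\<And>A r x. A \<in> so3 \<Longrightarrow> x \<in> carrier L \<Longrightarrow> sact L A (r *\<^sub>R x) = r *\<^sub>R sact L A x"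
      "\<And>A x y. A \<in> so3 \<Longrightarrow> x \<in> carrier L \<Longrightarrow> y \<in> carrier L \<Longrightarrow> sact L A (x \<otimes> y) = sact L A x \<otimes> y + x \<otimes> sact L A y"
      "\<And>A B x. A \<in> so3 \<Longrightarrow> B \<in> so3 \<Longrightarrow> x \<in> carrier L \<Longrightarrow> sact L (A + B) x = sact L A x + sact L B x"
      "\<And>A r x. A \<in> so3 \<Longrightarrow> x \<in> carrier L \<Longrightarrow> sact L (r *\<^sub>R A) x = r *\<^sub>R sact L A x"
      "\<And>A B x. A \<in> so3 \<Longrightarrow> B \<in> so3 \<Longrightarrow> x \<in> carrier L \<Longrightarrow>
        sact L (A ** B - B ** A) x = sact L A (sact L B x) - sact L B (sact L A x)"
    and reducible: "\<And>H. subspace H \<Longrightarrow> H \<subseteq> carrier L \<Longrightarrow> s_stable L H \<Longrightarrow>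
      \<exists>K. subspace K \<and> K \<subseteq> carrier L \<and> s_stable L K \<and> H \<inter> K = {0} \<and> (\<forall>x\<in>carrier L. \<exists>h\<in>H. \<exists>k\<in>K. x = h + k)"
  shows "lie_so3_algebra L"
proof -
  interpret module real_ring L by (rule concrete_module[OF L])
  note D = concreteD[OF L]
  show ?thesis
  proof (unfold_locales, goal_cases)
    case 1
    show ?case using concrete_has_dim[OF L B] .
  next
    case (16 H)
    then obtain K where K: "subspace K" "K \<subseteq> carrier L" "s_stable L K" "H \<inter> K = {0}"
      "\<forall>x\<in>carrier L. \<exists>h\<in>H. \<exists>k\<in>K. x = h + k"
      using reducible[of H] by (auto simp: concrete_vsubspace_iff[OF L])
    have HL: "H \<subseteq> carrier L" using 16 by (simp add: concrete_vsubspace_iff[OF L])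
    have "H <+> K = carrier L"
    proof
      show "H <+> K \<subseteq> carrier L"
        using HL K(2) by (auto simp: set_add_def' D intro: subspace_add[OF D(1)])
      show "carrier L \<subseteq> H <+> K"
        using K(5) by (simp add: set_add_def' D subset_iff)
    qed
    then show ?case
      using K by (auto simp: concrete_vsubspace_iff[OF L] D)
  next
    case (15 A B x)
    then show ?case by (simp add: act(1,7) concrete_minus[OF L])
  next
    case (8 x y z)
    then show ?case by (simp add: D bracket(7))
  qed (simp_all only: D bracket(1-6) act(1-6))
qed

lemma concrete_solvableI:
  fixes L (structure)
  assumes L: "concrete L" and D: "subspace D" "D \<subseteq> carrier L"
    and 1: "\<And>x y. x \<in> carrier L \<Longrightarrow> y \<in> carrier L \<Longrightarrow> x \<otimes> y \<in> D"
    and 2: "\<And>x y. x \<in> D \<Longrightarrow> y \<in> D \<Longrightarrow> x \<otimes> y = 0"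
  shows "solvable_lie L"
proof -
  have D1: "derived_lie L 1 \<subseteq> D"
    unfolding One_nat_def derived_lie.simps
  proof (rule lin_span_least)
    show "vsubspace D L" using D by (simp add: concrete_vsubspace_iff[OF L])
  qed (use 1 in blast)
  have "0 \<in> derived_lie L 1"
  proof -
    have "{x \<otimes> y |x y. x \<in> carrier L \<and> y \<in> carrier L} \<subseteq> carrier L"
      using 1 D(2) by blast
    then have "derived_lie L 1 = span {x \<otimes> y |x y. x \<in> carrier L \<and> y \<in> carrier L}"
      unfolding One_nat_def derived_lie.simps by (rule concrete_lin_span[OF L])
    then show ?thesis by (simp only: span_zero)
  qed
  then have "{x \<otimes> y |x y. x \<in> derived_lie L 1 \<and> y \<in> derived_lie L 1} = {0}"
    using D1 2 by (intro equalityI subsetI) (blast, fastforce)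
  then have "derived_lie L (Suc 1) = lin_span L {0}"
    by (simp only: derived_lie.simps(2))
  also have "\<dots> = {0}"
    using subspace_0[OF concreteD(1)[OF L]] by (simp add: concrete_lin_span[OF L])
  finally show ?thesis
    unfolding solvable_lie_def concreteD(2)[OF L] by (rule exI)
qed

lemma Sym_spanning:
  "Sym m \<subseteq> span ((\<lambda>k. monom 1 k) ` {..m} \<union> (\<lambda>k. monom \<i> k) ` {..m})" (is "_ \<subseteq> span ?B")
proof
  fix p assume "p \<in> Sym m"
  have "monom c k \<in> span ?B" if "k \<le> m" for c k
  proof -
    have "monom c k = Re c *\<^sub>R monom 1 k + Im c *\<^sub>R monom \<i> k"
      by (rule poly_eqI) (auto simp: complex_eq_iff)
    moreover have "monom 1 k \<in> span ?B" "monom \<i> k \<in> span ?B"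
      using that by (auto intro: span_base)
    ultimately show ?thesis by (simp add: span_add span_scale)
  qed
  then have "(\<Sum>k\<le>m. monom (coeff p k) k) \<in> span ?B"
    by (intro span_sum) auto
  then show "p \<in> span ?B"
    using Sym_expand[OF \<open>p \<in> Sym m\<close>] by simp
qed

lemma rep_plus_left: "rep m (A + B) p = rep m A p + rep m B p"
  by (simp add: rep_def linear_add[OF spin_linear] sym_act_plus)

lemma rep_scaleR_left: "rep m (r *\<^sub>R A) p = r *\<^sub>R rep m A p"
  by (simp add: rep_def linear_scale[OF spin_linear] sym_act_scaleR_left)

lemma rep_commutator:
  "A \<in> so3 \<Longrightarrow> B \<in> so3 \<Longrightarrow> rep m (A ** B - B ** A) p = rep m A (rep m B p) - rep m B (rep m A p)"
  by (simp add: rep_def spin_commutator sym_act_commutator)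

lemma d_real_simps:
  "mult (d_real n) = (\<lambda>_ _. 0)" "\<zero>\<^bsub>d_real n\<^esub> = 0" "sact (d_real n) = rep (2 * n)"
  "concrete (d_real n)"
proof -
  show "mult (d_real n) = (\<lambda>_ _. 0)" "\<zero>\<^bsub>d_real n\<^esub> = 0"
    by (simp_all add: d_real_def d_complex_def)
  show "sact (d_real n) = rep (2 * n)"
    by (rule ext) (simp add: d_real_def d_complex_def rep_def fun_eq_iff)
  have "subspace (carrier (d_real n))"
    using stable_d_real[of n] by (simp add: stable_def)
  then show "concrete (d_real n)"
    unfolding concrete_def by (simp add: d_real_def d_complex_def fun_eq_iff smult_of_real)
qed

lemma d_real_trivial_or_all:
  assumes n: "n \<ge> 1" and H: "subspace H" "H \<subseteq> carrier (d_real n)" "s_stable (d_real n) H"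
  shows "H = {0} \<or> H = carrier (d_real n)"
  using d_real_irreducible[of n H] assms by (auto simp: s_stable_def stable_def d_real_simps)

lemma d_real_minimal_solvable:
  assumes n: "n \<ge> 1" shows "minimal_solvable_lie_so3 (d_real n)"
proof -
  let ?U = "carrier (d_real n)"
  have U: "subspace ?U" and act: "\<And>A x. A \<in> so3 \<Longrightarrow> x \<in> ?U \<Longrightarrow> rep (2 * n) A x \<in> ?U"
    using stable_d_real[of n] by (auto simp: stable_def)
  have alg: "lie_so3_algebra (d_real n)"
  proof (rule concrete_lie_so3_algebraI)
    show "concrete (d_real n)" by (rule d_real_simps)
    show "?U \<subseteq> span ((\<lambda>k. monom 1 k) ` {..2 * n} \<union> (\<lambda>k. monom \<i> k) ` {..2 * n})"
      using Sym_spanning[of "2 * n"] by (auto simp: d_real_carrier)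
    fix H assume H: "subspace H" "H \<subseteq> ?U" "s_stable (d_real n) H"
    show "\<exists>K. subspace K \<and> K \<subseteq> ?U \<and> s_stable (d_real n) K \<and> H \<inter> K = {0} \<and>
        (\<forall>x\<in>?U. \<exists>h\<in>H. \<exists>k\<in>K. x = h + k)"
      using d_real_trivial_or_all[OF n H]
    proof
      assume "H = {0}"
      then show ?thesis using U act by (intro exI[of _ ?U]) (auto simp: s_stable_def d_real_simps subspace_0)
    next
      assume "H = ?U"
      then show ?thesis using U by (intro exI[of _ "{0}"]) (auto simp: s_stable_def d_real_simps subspace_0)
    qed
  qed (auto simp: d_real_simps U act subspace_0 rep_add rep_scaleR rep_plus_left rep_scaleR_left rep_commutator)
  interpret lie_so3_algebra "d_real n" by (rule alg)
  have "solvable_lie (d_real n)"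
    using U by (intro concrete_solvableI[where D = "{0}"] d_real_simps) (auto simp: d_real_simps subspace_0)
  moreover have "minimal_so3 (d_real n)"
    unfolding minimal_so3_iff
  proof (intro conjI allI impI)
    define v :: "complex poly" where "v = monom 1 (2 * n) + monom 1 0"
    have "v \<in> ?U"
      unfolding v_def d_real_carrier conjJ_add
      by (intro conjI subspace_add[OF subspace_Sym] monom_in_Sym)
        (simp_all only: conjJ_monom, simp_all add: add.commute)
    moreover have "coeff (rep (2 * n) (so3_mat 0 0 1) v) 0 \<noteq> 0"
      using n by (simp add: coeff_rep3 v_def weight_def)
    then have "rep (2 * n) (so3_mat 0 0 1) v \<noteq> 0" by auto
    ultimately show "\<exists>A\<in>so3. \<exists>x\<in>?U. sact (d_real n) A x \<noteq> \<zero>\<^bsub>d_real n\<^esub>"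
      using so3_mat_in_so3 by (auto simp: d_real_simps)
  next
    fix H assume "lie_subalgebra H (d_real n) \<and> s_stable (d_real n) H"
    then have "H = {0} \<or> H = ?U"
      using n by (intro d_real_trivial_or_all) (auto simp: lie_subalgebra_def concrete_vsubspace_iff[OF d_real_simps(4)])
    then show "H = ?U \<or> (\<forall>A\<in>so3. \<forall>x\<in>H. sact (d_real n) A x = \<zero>\<^bsub>d_real n\<^esub>)"
      by (auto simp: d_real_simps)
  qed
  ultimately show ?thesis
    by (simp add: minimal_solvable_lie_so3_def alg)
qed

section \<open>A coset-free model of the algebras \<open>hu\<^sub>4\<^sub>n\<^sup>i\<close>\<close>

text \<open>The idempotent \<open>P\<close> stands for the quotient of the centre \<open>R \<times> C\<close> by the kernel of \<open>P\<close>, realized on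
  the range of \<open>P\<close>.\<close>

definition heis_model :: "nat \<Rightarrow> (real \<times> complex \<Rightarrow> real \<times> complex) \<Rightarrow> (complex poly \<times> (real \<times> complex)) so3_alg" where
  "heis_model m P =
    \<lparr>carrier = Sym m \<times> range P, mult = (\<lambda>x y. (0, P (form m (fst x) (fst y)))), one = 0, zero = 0,
     add = (+), smult = scaleR, sact = (\<lambda>A x. (rep m A (fst x), 0))\<rparr>"

lemma heis_model_simps:
  "carrier (heis_model m P) = Sym m \<times> range P"
  "x \<otimes>\<^bsub>heis_model m P\<^esub> y = (0, P (form m (fst x) (fst y)))"
  "\<zero>\<^bsub>heis_model m P\<^esub> = 0" "sact (heis_model m P) A x = (rep m A (fst x), 0)"
  by (simp_all add: heis_model_def)

lemma heis_model_concrete: "linear P \<Longrightarrow> concrete (heis_model m P)"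
  unfolding concrete_def
  by (simp add: heis_model_def subspace_Times subspace_Sym linear_subspace_image subspace_UNIV)

text \<open>The elements \<open>(A x, 0)\<close> of \<open>H\<close> show that the part of \<open>H\<close> inside \<open>Sym m \<times> {0}\<close> is a nonzero
  submodule.\<close>

lemma heis_model_stable_part:
  assumes m: "odd m" and H: "subspace H" "H \<subseteq> Sym m \<times> Q" "s_stable (heis_model m P) H"
    and moved: "A \<in> so3" "x \<in> H" "rep m A (fst x) \<noteq> 0"
  shows "Sym m \<times> {0} \<subseteq> H"
proof -
  define W where "W = {x \<in> Sym m. (x, 0) \<in> H}"
  have "linear (\<lambda>x :: complex poly. (x, 0 :: real \<times> complex))"
    by (rule linearI) simp_all
  from linear_subspace_vimage[OF this H(1)] have "subspace W"
    unfolding W_def using subspace_Sym by (simp add: vimage_def Collect_conj_eq subspace_inter)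
  moreover have act: "rep m A (fst x) \<in> W" if "A \<in> so3" "x \<in> H" for A x
    using that H by (force simp: W_def s_stable_def heis_model_simps rep_in_Sym)
  ultimately have "stable m W"
    unfolding stable_def by (auto simp: W_def dest: act[of _ "(_, 0)"])
  moreover have "W \<noteq> {0}" using act[OF moved(1,2)] moved(3) by auto
  moreover have "W \<subseteq> Sym m" by (auto simp: W_def)
  ultimately have "W = Sym m" using m by (intro Sym_odd_irreducible)
  then show ?thesis by (auto simp: W_def)
qed

lemma Sym_odd_no_invariants:
  assumes m: "odd m" and x: "x \<in> Sym m" and inv: "\<And>A. A \<in> so3 \<Longrightarrow> rep m A x = 0"
  shows "x = 0"
proof (rule poly_eqI)
  fix k
  have "of_real (weight m k) * coeff x k = 0"
    using inv[OF so3_mat_in_so3, of 0 0 1] coeff_rep3[of m x k] by simp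
  moreover have "weight m k \<noteq> 0"
  proof
    assume "weight m k = 0"
    then have "real m = real (2 * k)" by (simp add: weight_def)
    then show False using m by (simp only: of_nat_eq_iff) simp
  qed
  ultimately show "coeff x k = coeff 0 k" by simp
qed

lemma subspace_complement_in:
  fixes H S :: "'v::euclidean_space set"
  assumes "subspace H" "subspace S" "H \<subseteq> S"
  obtains K where "subspace K" "K \<subseteq> S" "H \<inter> K = {0}" "\<And>x. x \<in> S \<Longrightarrow> \<exists>h\<in>H. \<exists>k\<in>K. x = h + k"
proof -
  obtain g where g: "range g \<subseteq> H" "linear g" "\<forall>v\<in>H. g v = v"
    using linear_exists_left_inverse_on[OF linear_id assms(1)] by auto
  define K where "K = {x \<in> S. g x = 0}"
  show ?thesis
  proof
    show "subspace K"
      using assms(2) by (auto intro!: subspaceI simp: K_def subspace_0 subspace_add subspace_scale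
          linear_0[OF g(2)] linear_add[OF g(2)] linear_scale[OF g(2)])
    show "K \<subseteq> S" by (auto simp: K_def)
    show "H \<inter> K = {0}"
      using g(3) subspace_0[OF assms(1)] subspace_0[OF assms(2)] by (auto simp: K_def linear_0[OF g(2)])
    fix x assume x: "x \<in> S"
    have gx: "g x \<in> H" using g(1) by blast
    moreover have "x - g x \<in> K"
      using x gx assms g by (auto simp: K_def subspace_diff linear_diff[OF g(2)])
    ultimately show "\<exists>h\<in>H. \<exists>k\<in>K. x = h + k"
      by (metis add.commute diff_add_cancel)
  qed
qed

text \<open>A stable subspace either contains \<open>Sym m \<times> {0}\<close> or lies in \<open>{0} \<times> range P\<close>, so it suffices to take a
  complement in the centre.\<close>

lemma heis_model_reducible:
  assumes m: "odd m" and P: "linear P"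
    and H: "subspace H" "H \<subseteq> Sym m \<times> range P" "s_stable (heis_model m P) H"
  shows "\<exists>K. subspace K \<and> K \<subseteq> Sym m \<times> range P \<and> s_stable (heis_model m P) K \<and> H \<inter> K = {0} \<and>
    (\<forall>x\<in>Sym m \<times> range P. \<exists>h\<in>H. \<exists>k\<in>K. x = h + k)"
proof -
  have R: "subspace (range P)" by (simp add: P linear_subspace_image subspace_UNIV)
  define H2 where "H2 = {z. (0, z) \<in> H}"
  have "linear (\<lambda>z :: real \<times> complex. (0 :: complex poly, z))"
    by (rule linearI) simp_all
  from linear_subspace_vimage[OF this H(1)] have H2: "subspace H2"
    by (simp add: H2_def vimage_def)
  have "H2 \<subseteq> range P" using H(2) by (auto simp: H2_def)
  then obtain K2 where K2: "subspace K2" "K2 \<subseteq> range P" "H2 \<inter> K2 = {0}"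
    "\<And>x. x \<in> range P \<Longrightarrow> \<exists>h\<in>H2. \<exists>k\<in>K2. x = h + k"
    by (rule subspace_complement_in[OF H2 R]) (rule that)
  show ?thesis
  proof (cases "\<exists>A\<in>so3. \<exists>x\<in>H. rep m A (fst x) \<noteq> 0")
    case True
    then have full: "Sym m \<times> {0} \<subseteq> H" using heis_model_stable_part[OF m H] by blast
    let ?K = "{0} \<times> K2"
    have "subspace ?K" by (intro subspace_Times K2 subspace_single_0)
    moreover have "?K \<subseteq> Sym m \<times> range P" using K2 subspace_0[OF subspace_Sym] by auto
    moreover have "s_stable (heis_model m P) ?K"
      using subspace_0[OF K2(1)] by (auto simp: s_stable_def heis_model_simps)
    moreover have "H \<inter> ?K = {0}"
      using K2(3) subspace_0[OF H(1)] subspace_0[OF K2(1)] by (auto simp: H2_def zero_prod_def)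
    moreover have "\<forall>x\<in>Sym m \<times> range P. \<exists>h\<in>H. \<exists>k\<in>?K. x = h + k"
    proof
      fix x assume xin: "x \<in> Sym m \<times> range P"
      obtain y z where x: "x = (y, z)" "y \<in> Sym m" "z \<in> range P"
        using xin by (metis mem_Times_iff prod.collapse)
      obtain h k where hk: "h \<in> H2" "k \<in> K2" "z = h + k"
        using K2(4)[OF x(3)] by (elim bexE)
      have "(y, 0) \<in> H" using full x(2) by blast
      then have "(y, 0) + (0, h) \<in> H" using hk(1) by (intro subspace_add[OF H(1)]) (auto simp: H2_def)
      then have "(y, h) \<in> H" "(0, k) \<in> ?K" "x = (y, h) + (0, k)" using hk x by simp_all
      then show "\<exists>h\<in>H. \<exists>k\<in>?K. x = h + k" by (intro bexI)
    qed
    ultimately show ?thesis by (intro exI[of _ ?K] conjI)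
  next
    case False
    have z: "fst x = 0" if x: "x \<in> H" for x
    proof (rule Sym_odd_no_invariants[OF m])
      show "fst x \<in> Sym m" using subsetD[OF H(2) x] by (simp add: mem_Times_iff)
      show "rep m A (fst x) = 0" if "A \<in> so3" for A using False that x by blast
    qed
    let ?K = "Sym m \<times> K2"
    have "subspace ?K" by (intro subspace_Times K2 subspace_Sym)
    moreover have "?K \<subseteq> Sym m \<times> range P" using K2 by auto
    moreover have "s_stable (heis_model m P) ?K"
      using subspace_0[OF K2(1)] by (auto simp: s_stable_def heis_model_simps rep_in_Sym)
    moreover have "H \<inter> ?K = {0}"
    proof
      show "H \<inter> ?K \<subseteq> {0}"
      proof
        fix x assume x: "x \<in> H \<inter> ?K"
        then have "fst x = 0" using z by blast
        then have "snd x \<in> H2 \<inter> K2" using x by (cases x) (auto simp: H2_def)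
        then show "x \<in> {0}" using K2(3) \<open>fst x = 0\<close> by (simp add: prod_eq_iff)
      qed
    qed (use subspace_0[OF H(1)] subspace_0[OF \<open>subspace ?K\<close>] in auto)
    moreover have "\<forall>x\<in>Sym m \<times> range P. \<exists>h\<in>H. \<exists>k\<in>?K. x = h + k"
    proof
      fix x assume xin: "x \<in> Sym m \<times> range P"
      obtain y z where x: "x = (y, z)" "y \<in> Sym m" "z \<in> range P"
        using xin by (metis mem_Times_iff prod.collapse)
      obtain h k where hk: "h \<in> H2" "k \<in> K2" "z = h + k"
        using K2(4)[OF x(3)] by (elim bexE)
      then have "(0, h) \<in> H" "(y, k) \<in> ?K" "x = (0, h) + (y, k)" using x by (simp_all add: H2_def)
      then show "\<exists>h\<in>H. \<exists>k\<in>?K. x = h + k" by (intro bexI)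
    qed
    ultimately show ?thesis by (intro exI[of _ ?K] conjI)
  qed
qed

text \<open>A stable subalgebra with nontrivial action contains \<open>Sym m \<times> {0}\<close>, whose brackets exhaust the centre
  by \<open>form_dual_vec\<close>.\<close>

lemma heis_model_minimal_solvable:
  assumes m: "odd m" and P: "linear P"
  shows "minimal_solvable_lie_so3 (heis_model m P)"
proof -
  let ?L = "heis_model m P"
  note D = alt_inv_formD[OF form_alt_inv[OF m]]
  have R: "subspace (range P)" by (simp add: P linear_subspace_image subspace_UNIV)
  have P0: "P 0 = 0" by (rule linear_0[OF P])
  have form0: "form m x 0 = 0" "form m 0 x = 0" if "x \<in> Sym m" for x
    using alt_inv_form_zero[OF form_alt_inv[OF m] subspace_Sym that] by simp_all
  let ?SB = "(\<lambda>k. monom 1 k) ` {..m} \<union> (\<lambda>k. monom \<i> k) ` {..m} :: complex poly set"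
  let ?B = "(\<lambda>x. (x, 0)) ` ?SB \<union> (\<lambda>z. (0, z)) ` Basis :: (complex poly \<times> (real \<times> complex)) set"
  have l1: "linear (\<lambda>x::complex poly. (x, 0::real \<times> complex))" and l2: "linear (\<lambda>z::real \<times> complex. (0::complex poly, z))"
    by (rule linearI; simp)+
  have alg: "lie_so3_algebra ?L"
  proof (rule concrete_lie_so3_algebraI[of _ ?B])
    show "carrier ?L \<subseteq> span ?B"
    proof
      fix x assume "x \<in> carrier ?L"
      then obtain y z where x: "x = (y, z)" "y \<in> Sym m"
        by (metis heis_model_simps(1) mem_Times_iff prod.collapse)
      have "(y, 0) \<in> (\<lambda>x. (x, 0)) ` span ?SB" using x(2) Sym_spanning by blast
      then have 1: "(y, 0) \<in> span ((\<lambda>x. (x, 0::real \<times> complex)) ` ?SB)" by (simp only: linear_span_image[OF l1])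
      have "(0, z) \<in> (\<lambda>z. (0::complex poly, z)) ` span Basis" by simp
      then have 2: "(0, z) \<in> span ((\<lambda>z. (0::complex poly, z)) ` Basis)" by (simp only: linear_span_image[OF l2])
      have "(y, 0) + (0, z) \<in> span ?B"
        using 1 2 by (intro span_add) (blast intro: span_mono[THEN subsetD, rotated])+
      then show "x \<in> span ?B" by (simp add: x)
    qed
    fix H assume "subspace H" "H \<subseteq> carrier ?L" "s_stable ?L H"
    then show "\<exists>K. subspace K \<and> K \<subseteq> carrier ?L \<and> s_stable ?L K \<and> H \<inter> K = {0} \<and>
        (\<forall>x\<in>carrier ?L. \<exists>h\<in>H. \<exists>k\<in>K. x = h + k)"
      unfolding heis_model_simps by (rule heis_model_reducible[OF m P])
  qed (auto simp: heis_model_concrete[OF P] heis_model_simps subspace_0 subspace_Sym D rep_in_Sym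
      rep_add rep_scaleR rep_plus_left rep_scaleR_left rep_commutator form0 P0 R
      linear_scale[OF P] linear_add[OF P] linear_neg[OF P] prod_eq_iff)
  interpret lie_so3_algebra ?L by (rule alg)
  have "solvable_lie ?L"
    by (rule concrete_solvableI[OF heis_model_concrete[OF P], where D = "{0} \<times> range P"])
      (auto simp: heis_model_simps form0 P0 R subspace_Times subspace_single_0 subspace_0 subspace_Sym zero_prod_def[symmetric])
  moreover have "minimal_so3 ?L"
    unfolding minimal_so3_iff
  proof (intro conjI allI impI)
    have v: "monom 1 m \<in> Sym m" by (simp add: monom_in_Sym)
    then obtain A where "A \<in> so3" "rep m A (monom 1 m) \<noteq> 0"
      using Sym_odd_no_invariants[OF m, of "monom 1 m"] by auto
    then show "\<exists>A\<in>so3. \<exists>x\<in>carrier ?L. sact ?L A x \<noteq> \<zero>\<^bsub>?L\<^esub>"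
      using v subspace_0[OF R] by (intro bexI[of _ A] bexI[of _ "(monom 1 m, 0)"]) (auto simp: heis_model_simps prod_eq_iff)
  next
    fix H assume "lie_subalgebra H ?L \<and> s_stable ?L H"
    then have H: "subspace H" "H \<subseteq> Sym m \<times> range P" "s_stable ?L H" "\<And>x y. x \<in> H \<Longrightarrow> y \<in> H \<Longrightarrow> x \<otimes>\<^bsub>?L\<^esub> y \<in> H"
      by (auto simp: lie_subalgebra_def concrete_vsubspace_iff[OF heis_model_concrete[OF P]] heis_model_simps)
    show "H = carrier ?L \<or> (\<forall>A\<in>so3. \<forall>x\<in>H. sact ?L A x = \<zero>\<^bsub>?L\<^esub>)"
    proof (cases "\<exists>A\<in>so3. \<exists>x\<in>H. rep m A (fst x) \<noteq> 0")
      case False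
      then show ?thesis by (simp add: heis_model_simps zero_prod_def)
    next
      case True
      then have full: "Sym m \<times> {0} \<subseteq> H" using heis_model_stable_part[OF m H(1-3)] by blast
      have "(y, P z) \<in> H" if y: "y \<in> Sym m" for y z
      proof -
        have "(monom 1 m, 0) \<in> H" "(dual_vec m z, 0) \<in> H"
          using full by (auto simp: monom_in_Sym dual_vec_in_Sym)
        then have "(0, P z) \<in> H"
          using H(4)[of "(monom 1 m, 0)" "(dual_vec m z, 0)"] by (simp add: heis_model_simps form_dual_vec[OF m])
        moreover have "(y, 0) \<in> H" using full y by blast
        ultimately show ?thesis using subspace_add[OF H(1), of "(y, 0)" "(0, P z)"] by simp
      qed
      then show ?thesis using H(2) by (auto simp: heis_model_simps)
    qed
  qed
  ultimately show ?thesis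
    by (simp add: minimal_solvable_lie_so3_def alg)
qed

section \<open>Coordinates on an abstract algebra\<close>

lemma vsubspace_finsum:
  assumes V: "module real_ring V" and H: "vsubspace H V" and "finite S" "\<And>k. k \<in> S \<Longrightarrow> g k \<in> H"
  shows "finsum V g S \<in> H"
proof -
  interpret module real_ring V by fact
  have H': "H \<subseteq> carrier V" "\<zero>\<^bsub>V\<^esub> \<in> H" "\<And>x y. x \<in> H \<Longrightarrow> y \<in> H \<Longrightarrow> x \<oplus>\<^bsub>V\<^esub> y \<in> H"
    using H by (auto simp: vsubspace_iff[OF V])
  show ?thesis
    using assms(3,4)
  proof induction
    case (insert k S)
    then have "g \<in> S \<rightarrow> carrier V" "g k \<in> carrier V" using H'(1) by auto
    then show ?case using insert H'(3) by (simp add: M.finsum_insert)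
  qed (simp add: H')
qed

text \<open>A basis \<open>b\<^sub>0, \<dots>, b\<^sub>d\<^sub>-\<^sub>1\<close> identifies the module with the real polynomials of degree below \<open>d\<close>: the
  polynomial with coefficients \<open>c\<^sub>k\<close> corresponds to the sum of the \<open>c\<^sub>k b\<^sub>k\<close>.\<close>

lemma coordinates_exist:
  assumes V: "module real_ring V" and dim: "has_dim V (carrier V) d"
  shows "\<exists>f. bij_betw f (carrier V) {p :: real poly. \<forall>k\<ge>d. coeff p k = 0} \<and>
    (\<forall>x\<in>carrier V. \<forall>y\<in>carrier V. f (x \<oplus>\<^bsub>V\<^esub> y) = f x + f y) \<and>
    (\<forall>r. \<forall>x\<in>carrier V. f (r \<odot>\<^bsub>V\<^esub> x) = r *\<^sub>R f x)"
proof -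
  interpret module real_ring V by fact
  obtain B where B: "B \<subseteq> carrier V" "finite B" "card B = d" "lin_indep V B" "lin_span V B = carrier V"
    using dim by (auto simp: has_dim_def)
  obtain b where b: "bij_betw b {..<d} B"
    using ex_bij_betw_nat_finite[OF B(2)] B(3) by (auto simp: atLeast0LessThan)
  have bB: "b k \<in> B" if "k < d" for k using b that by (auto simp: bij_betw_def)
  have bV: "b k \<in> carrier V" if "k < d" for k using bB[OF that] B(1) by blast
  have sm: "r \<odot>\<^bsub>V\<^esub> x \<in> carrier V" if "x \<in> carrier V" for r x using that smult_closed by simp
  let ?Q = "{p :: real poly. \<forall>k\<ge>d. coeff p k = 0}"
  define g where "g p = finsum V (\<lambda>k. coeff p k \<odot>\<^bsub>V\<^esub> b k) {..<d}" for p
  have term_V: "(\<lambda>k. coeff p k \<odot>\<^bsub>V\<^esub> b k) \<in> {..<d} \<rightarrow> carrier V" for p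
    by (auto intro: sm bV)
  have gV: "g p \<in> carrier V" for p
    unfolding g_def by (rule M.finsum_closed[OF term_V])
  have g_add: "g (p + q) = g p \<oplus>\<^bsub>V\<^esub> g q" for p q
  proof -
    have "g (p + q) = finsum V (\<lambda>k. coeff p k \<odot>\<^bsub>V\<^esub> b k \<oplus>\<^bsub>V\<^esub> coeff q k \<odot>\<^bsub>V\<^esub> b k) {..<d}"
      unfolding g_def
    proof (rule M.finsum_cong')
      fix k assume "k \<in> {..<d}"
      then show "coeff (p + q) k \<odot>\<^bsub>V\<^esub> b k = coeff p k \<odot>\<^bsub>V\<^esub> b k \<oplus>\<^bsub>V\<^esub> coeff q k \<odot>\<^bsub>V\<^esub> b k"
        using smult_l_distr[of "coeff p k" "coeff q k" "b k"] bV by simp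
    qed (auto intro: sm bV)
    then show ?thesis unfolding g_def by (simp add: M.finsum_addf[OF term_V term_V])
  qed
  have g_smult: "g (r *\<^sub>R p) = r \<odot>\<^bsub>V\<^esub> g p" for r p
  proof -
    have "g (r *\<^sub>R p) = finsum V (\<lambda>k. r \<odot>\<^bsub>V\<^esub> (coeff p k \<odot>\<^bsub>V\<^esub> b k)) {..<d}"
      unfolding g_def
    proof (rule M.finsum_cong')
      fix k assume "k \<in> {..<d}"
      then show "coeff (r *\<^sub>R p) k \<odot>\<^bsub>V\<^esub> b k = r \<odot>\<^bsub>V\<^esub> (coeff p k \<odot>\<^bsub>V\<^esub> b k)"
        using smult_assoc1[of r "coeff p k" "b k"] bV by simp
    qed (auto intro: sm bV)
    then show ?thesis
      unfolding g_def using finsum_smult_ldistr[of "{..<d}" r "\<lambda>k. coeff p k \<odot>\<^bsub>V\<^esub> b k"] term_V by simp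
  qed
  have ker: "p = 0" if p: "p \<in> ?Q" and "g p = \<zero>\<^bsub>V\<^esub>" for p
  proof (rule ccontr)
    assume "p \<noteq> 0"
    then obtain j where j: "coeff p j \<noteq> 0" by (metis leading_coeff_0_iff)
    then have jd: "j < d" using p not_le by auto
    let ?S = "lin_span V (B - {b j})"
    have S: "vsubspace ?S V" "B - {b j} \<subseteq> ?S"
      using lin_span_subspace[OF V, of "B - {b j}"] B(1) by auto
    define s where "s = finsum V (\<lambda>k. coeff p k \<odot>\<^bsub>V\<^esub> b k) ({..<d} - {j})"
    have "s \<in> ?S"
      unfolding s_def
    proof (rule vsubspace_finsum[OF V S(1)])
      fix k assume k: "k \<in> {..<d} - {j}"
      then have "b k \<in> B - {b j}"
        using bB b jd by (auto simp: bij_betw_def inj_on_def)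
      then show "coeff p k \<odot>\<^bsub>V\<^esub> b k \<in> ?S"
        using S by (auto simp: vsubspace_iff[OF V])
    qed simp
    then have sV: "s \<in> carrier V" using S(1) by (auto simp: vsubspace_iff[OF V])
    have "g p = finsum V (\<lambda>k. coeff p k \<odot>\<^bsub>V\<^esub> b k) (insert j ({..<d} - {j}))"
      unfolding g_def using jd by (simp add: insert_absorb)
    also have "\<dots> = coeff p j \<odot>\<^bsub>V\<^esub> b j \<oplus>\<^bsub>V\<^esub> s"
      unfolding s_def using jd by (subst M.finsum_insert) (auto intro: sm bV)
    finally have "coeff p j \<odot>\<^bsub>V\<^esub> b j \<oplus>\<^bsub>V\<^esub> s = \<zero>\<^bsub>V\<^esub>" using that(2) by simp
    then have "coeff p j \<odot>\<^bsub>V\<^esub> b j = \<ominus>\<^bsub>V\<^esub> s"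
      using sV sm[OF bV[OF jd]] by (metis M.minus_equality M.a_comm)
    then have "coeff p j \<odot>\<^bsub>V\<^esub> b j = (-1) \<odot>\<^bsub>V\<^esub> s"
      by (simp add: real_minus[OF V sV])
    then have "coeff p j \<odot>\<^bsub>V\<^esub> b j \<in> ?S"
      using \<open>s \<in> ?S\<close> S(1) by (simp add: vsubspace_iff[OF V])
    then have "(1 / coeff p j) \<odot>\<^bsub>V\<^esub> (coeff p j \<odot>\<^bsub>V\<^esub> b j) \<in> ?S"
      using S(1) by (simp add: vsubspace_iff[OF V])
    also have "(1 / coeff p j) \<odot>\<^bsub>V\<^esub> (coeff p j \<odot>\<^bsub>V\<^esub> b j) = b j"
      using smult_assoc1[of "1 / coeff p j" "coeff p j" "b j"] smult_one[of "b j"] bV[OF jd] j by simp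
    finally show False
      using B(4) bB[OF jd] by (auto simp: lin_indep_def)
  qed
  have inj: "inj_on g ?Q"
  proof (rule inj_onI)
    fix p q assume pq: "p \<in> ?Q" "q \<in> ?Q" "g p = g q"
    have "g (p + (-1) *\<^sub>R q) = g q \<oplus>\<^bsub>V\<^esub> \<ominus>\<^bsub>V\<^esub> g q"
      by (simp only: g_add g_smult pq(3) real_minus[OF V gV])
    then have "g (p + (-1) *\<^sub>R q) = \<zero>\<^bsub>V\<^esub>"
      using gV M.r_neg by simp
    then have "p + (-1) *\<^sub>R q = 0" using pq by (intro ker) auto
    then show "p = q" by simp
  qed
  have "carrier V \<subseteq> g ` ?Q"
  proof -
    have "vsubspace (g ` ?Q) V"
      unfolding vsubspace_iff[OF V]
    proof (intro conjI ballI allI)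
      show "g ` ?Q \<subseteq> carrier V" using gV by blast
      have "g (0 *\<^sub>R 0) = \<zero>\<^bsub>V\<^esub>" unfolding g_smult using real_zero_smult[OF V gV] .
      then have "\<zero>\<^bsub>V\<^esub> = g 0" by simp
      then show "\<zero>\<^bsub>V\<^esub> \<in> g ` ?Q" by (rule image_eqI) simp
    next
      fix x y assume "x \<in> g ` ?Q" "y \<in> g ` ?Q"
      then obtain p q where "x = g p" "y = g q" "p \<in> ?Q" "q \<in> ?Q" by blast
      then have "x \<oplus>\<^bsub>V\<^esub> y = g (p + q)" "p + q \<in> ?Q" by (auto simp: g_add)
      then show "x \<oplus>\<^bsub>V\<^esub> y \<in> g ` ?Q" by (rule image_eqI)
    next
      fix r x assume "x \<in> g ` ?Q"
      then obtain p where "x = g p" "p \<in> ?Q" by blast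
      then have "r \<odot>\<^bsub>V\<^esub> x = g (r *\<^sub>R p)" "r *\<^sub>R p \<in> ?Q" by (auto simp: g_smult)
      then show "r \<odot>\<^bsub>V\<^esub> x \<in> g ` ?Q" by (rule image_eqI)
    qed
    moreover have "B \<subseteq> g ` ?Q"
    proof
      fix c assume "c \<in> B"
      then obtain j where j: "j < d" "c = b j" using b by (auto simp: bij_betw_def)
      have "g (monom 1 j) = finsum V (\<lambda>k. if j = k then b k else \<zero>\<^bsub>V\<^esub>) {..<d}"
        unfolding g_def
        by (rule M.finsum_cong')
          (auto simp: bV smult_one[simplified] real_zero_smult[OF V])
      also have "\<dots> = b j"
        using j by (intro M.finsum_singleton) (auto intro: bV)
      finally have "c = g (monom 1 j)" using j by simp
      then show "c \<in> g ` ?Q" using j by (intro image_eqI) auto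
    qed
    ultimately have "lin_span V B \<subseteq> g ` ?Q" by (rule lin_span_least)
    then show ?thesis using B(5) by simp
  qed
  then have bij: "bij_betw g ?Q (carrier V)"
    using inj gV by (auto simp: bij_betw_def)
  let ?f = "the_inv_into ?Q g"
  have fg: "?f (g p) = p" if "p \<in> ?Q" for p using inj that by (rule the_inv_into_f_f)
  have *: "\<exists>p\<in>?Q. x = g p" if "x \<in> carrier V" for x using that bij by (auto simp: bij_betw_def)
  show ?thesis
  proof (intro exI[of _ ?f] conjI ballI allI)
    show "bij_betw ?f (carrier V) ?Q" by (rule bij_betw_the_inv_into[OF bij])
    fix x assume "x \<in> carrier V"
    then obtain p where p: "p \<in> ?Q" "x = g p" using * by blast
    show "?f (r \<odot>\<^bsub>V\<^esub> x) = r *\<^sub>R ?f x" for r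
      unfolding p(2) g_smult[symmetric] using p(1) by (subst (1 2) fg) auto
    fix y assume "y \<in> carrier V"
    then obtain q where q: "q \<in> ?Q" "y = g q" using * by blast
    show "?f (x \<oplus>\<^bsub>V\<^esub> y) = ?f x + ?f y"
      unfolding p(2) q(2) g_add[symmetric] using p(1) q(1) by (subst (1 2 3) fg) auto
  qed
qed

lemma concrete_copy_exists:
  assumes L: "lie_so3_algebra L"
  shows "\<exists>f (M :: real poly so3_alg) B. so3_alg_iso f L M \<and> concrete M \<and> finite B \<and> carrier M \<subseteq> span B"
proof -
  interpret L: lie_so3_algebra L by fact
  obtain d where d: "has_dim L (carrier L) d" using L.finite_dim by blast
  let ?Q = "{p :: real poly. \<forall>k\<ge>d. coeff p k = 0}"
  obtain f where f: "bij_betw f (carrier L) ?Q"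
    "\<And>x y. x \<in> carrier L \<Longrightarrow> y \<in> carrier L \<Longrightarrow> f (x \<oplus>\<^bsub>L\<^esub> y) = f x + f y"
    "\<And>r x. x \<in> carrier L \<Longrightarrow> f (r \<odot>\<^bsub>L\<^esub> x) = r *\<^sub>R f x"
    using coordinates_exist[OF L.module_axioms d] by blast
  let ?g = "the_inv_into (carrier L) f"
  have gf: "?g (f x) = x" if "x \<in> carrier L" for x
    using f(1) that by (simp add: bij_betw_def the_inv_into_f_f)
  define M :: "real poly so3_alg" where "M = \<lparr>carrier = ?Q, mult = (\<lambda>x y. f (?g x \<otimes>\<^bsub>L\<^esub> ?g y)), one = 0, zero = 0, add = (+),
    smult = scaleR, sact = (\<lambda>A x. f (sact L A (?g x)))\<rparr>"
  have M: "carrier M = ?Q" "\<zero>\<^bsub>M\<^esub> = 0" "add M = (+)" "smult M = scaleR"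
    "\<And>x y. x \<otimes>\<^bsub>M\<^esub> y = f (?g x \<otimes>\<^bsub>L\<^esub> ?g y)" "\<And>A x. sact M A x = f (sact L A (?g x))"
    by (simp_all add: M_def)
  have f0: "f \<zero>\<^bsub>L\<^esub> = 0"
    using f(3)[of "\<zero>\<^bsub>L\<^esub>" 0] by (simp add: real_zero_smult[OF L.module_axioms])
  have "so3_alg_iso f L M"
    by unfold_locales (simp_all add: M f f0 gf)
  moreover have "concrete M"
    unfolding concrete_def M by (auto intro!: subspaceI)
  moreover have "carrier M \<subseteq> span ((\<lambda>k. monom 1 k) ` {..<d})"
  proof
    fix p assume p: "p \<in> carrier M"
    have "p = (\<Sum>k<d. coeff p k *\<^sub>R monom 1 k)"
      using p by (intro poly_eqI) (auto simp: M coeff_sum if_distrib not_less cong: if_cong)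
    also have "\<dots> \<in> span ((\<lambda>k. monom 1 k) ` {..<d})"
      by (intro span_sum span_scale span_base) auto
    finally show "p \<in> span ((\<lambda>k. monom 1 k) ` {..<d})" .
  qed
  ultimately show ?thesis by (metis finite_imageI finite_lessThan)
qed

section \<open>Recognizing quotients of the universal algebra\<close>

lemma idempotent_with_kernel_exists:
  fixes K :: "'v::euclidean_space set"
  assumes "subspace K"
  shows "\<exists>P. linear P \<and> (\<forall>z. P (P z) = P z) \<and> {z. P z = 0} = K"
proof -
  obtain g where g: "range g \<subseteq> K" "linear g" "\<forall>v\<in>K. g v = v"
    using linear_exists_left_inverse_on[OF linear_id assms] by auto
  have gg: "g (g z) = g z" for z using g(1,3) by blast
  show ?thesis
  proof (intro exI[of _ "\<lambda>z. z - g z"] conjI allI)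
    show "linear (\<lambda>z. z - g z)"
      using linear_compose_sub[OF linear_id g(2)] by simp
    show "z - g z - g (z - g z) = z - g z" for z
      by (simp add: linear_diff[OF g(2)] gg)
    show "{z. z - g z = 0} = K"
      using g(1,3) by auto
  qed
qed

text \<open>A surjective homomorphism from the universal algebra \<open>Sym m \<times> (R \<times> C)\<close> whose kernel is a subspace
  of the centre becomes an isomorphism on the complement \<open>Sym m \<times> range P\<close> of its kernel. Both the
  coset construction of \<open>hu\<close> and the classification reach the model in this way.\<close>

lemma heis_model_recognition:
  fixes M :: "'b so3_alg" and F :: "complex poly \<times> (real \<times> complex) \<Rightarrow> 'b"
  assumes m: "odd m" and P: "linear P" "\<And>z. P (P z) = P z"
    and surj: "F ` (Sym m \<times> UNIV) = carrier M"
    and F0: "F 0 = \<zero>\<^bsub>M\<^esub>"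
    and add: "\<And>x y. x \<in> Sym m \<times> UNIV \<Longrightarrow> y \<in> Sym m \<times> UNIV \<Longrightarrow> F (x + y) = F x \<oplus>\<^bsub>M\<^esub> F y"
    and smult: "\<And>r x. x \<in> Sym m \<times> UNIV \<Longrightarrow> F (r *\<^sub>R x) = r \<odot>\<^bsub>M\<^esub> F x"
    and bracket: "\<And>x y. x \<in> Sym m \<times> UNIV \<Longrightarrow> y \<in> Sym m \<times> UNIV \<Longrightarrow> F (0, form m (fst x) (fst y)) = F x \<otimes>\<^bsub>M\<^esub> F y"
    and act: "\<And>A x. A \<in> so3 \<Longrightarrow> x \<in> Sym m \<times> UNIV \<Longrightarrow> F (rep m A (fst x), 0) = sact M A (F x)"
    and kernel: "\<And>x. x \<in> Sym m \<times> UNIV \<Longrightarrow> F x = \<zero>\<^bsub>M\<^esub> \<longleftrightarrow> fst x = 0 \<and> P (snd x) = 0"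
  shows "so3_alg_iso F (heis_model m P) M"
proof -
  interpret L: lie_so3_algebra "heis_model m P"
    using heis_model_minimal_solvable[OF m P(1)] by (simp add: minimal_solvable_lie_so3_def)
  have S: "subspace (Sym m \<times> (UNIV :: (real \<times> complex) set))"
    by (intro subspace_Times subspace_Sym subspace_UNIV)
  have F_eq_iff: "F x = F y \<longleftrightarrow> F (x - y) = \<zero>\<^bsub>M\<^esub>" if x: "x \<in> Sym m \<times> UNIV" and y: "y \<in> Sym m \<times> UNIV" for x y
  proof
    have neg: "- 1 *\<^sub>R y \<in> Sym m \<times> UNIV" by (rule subspace_scale[OF S y])
    assume "F x = F y"
    then have "F (x + (- 1) *\<^sub>R y) = F (y + (- 1) *\<^sub>R y)"
      by (simp only: add[OF x neg] add[OF y neg])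
    then show "F (x - y) = \<zero>\<^bsub>M\<^esub>" by (simp add: F0)
  next
    have xy: "x - y \<in> Sym m \<times> UNIV" by (rule subspace_diff[OF S x y])
    assume "F (x - y) = \<zero>\<^bsub>M\<^esub>"
    then have "F (y + (x - y)) = F (y + 0)"
      by (simp only: add[OF y xy] add[OF y subspace_0[OF S]] F0)
    then show "F x = F y" by simp
  qed
  have F_P: "F (x, P z) = F (x, z)" if "x \<in> Sym m" for x z
    using that subspace_0[OF subspace_Sym] by (simp add: F_eq_iff kernel linear_diff[OF P(1)] P(2))
  show ?thesis
  proof (unfold_locales, unfold heis_model_simps)
    show "bij_betw F (Sym m \<times> range P) (carrier M)"
      unfolding bij_betw_def
    proof
      show "inj_on F (Sym m \<times> range P)"
      proof (rule inj_onI)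
        fix x y assume xy: "x \<in> Sym m \<times> range P" "y \<in> Sym m \<times> range P" "F x = F y"
        then have "x - y \<in> Sym m \<times> UNIV" "F (x - y) = \<zero>\<^bsub>M\<^esub>"
          using F_eq_iff[of x y] subspace_diff[OF S, of x y] by (auto simp: mem_Times_iff)
        then have "fst x - fst y = 0" "P (snd x - snd y) = 0" by (simp_all add: kernel)
        moreover have "P (snd x) = snd x" "P (snd y) = snd y"
          using xy by (auto simp: P(2))
        ultimately show "x = y" by (simp add: prod_eq_iff linear_diff[OF P(1)])
      qed
      show "F ` (Sym m \<times> range P) = carrier M"
      proof
        show "F ` (Sym m \<times> range P) \<subseteq> carrier M" unfolding surj[symmetric] by (intro image_mono Sigma_mono) auto
        show "carrier M \<subseteq> F ` (Sym m \<times> range P)"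
        proof
          fix b assume "b \<in> carrier M"
          then obtain x z where "b = F (x, z)" "x \<in> Sym m" unfolding surj[symmetric] by blast
          then have "b = F (x, P z)" "(x, P z) \<in> Sym m \<times> range P" by (simp_all add: F_P)
          then show "b \<in> F ` (Sym m \<times> range P)" by (rule image_eqI)
        qed
      qed
    qed
    note c = concreteD[OF heis_model_concrete[OF P(1), of m]]
    show "F 0 = \<zero>\<^bsub>M\<^esub>" by (rule F0)
    fix x assume "x \<in> Sym m \<times> range P"
    then have x: "x \<in> Sym m \<times> UNIV" by (simp add: mem_Times_iff)
    show "F (r \<odot>\<^bsub>heis_model m P\<^esub> x) = r \<odot>\<^bsub>M\<^esub> F x" for r
      unfolding c by (rule smult[OF x])
    show "F (rep m A (fst x), 0) = sact M A (F x)" if "A \<in> so3" for A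
      by (rule act[OF that x])
    fix y assume "y \<in> Sym m \<times> range P"
    then have y: "y \<in> Sym m \<times> UNIV" by (simp add: mem_Times_iff)
    show "F (x \<oplus>\<^bsub>heis_model m P\<^esub> y) = F x \<oplus>\<^bsub>M\<^esub> F y"
      unfolding c by (rule add[OF x y])
    show "F (0, P (form m (fst x) (fst y))) = F x \<otimes>\<^bsub>M\<^esub> F y"
      by (simp add: F_P subspace_0[OF subspace_Sym] bracket[OF x y])
  qed
qed

section \<open>Quaternionic symmetries of the model\<close>

text \<open>\<open>R\<close> is the rotation of the centre induced by an automorphism \<open>g\<close> of the module \<open>Sym m\<close>.\<close>

definition form_symmetry :: "nat \<Rightarrow> (real \<times> complex \<Rightarrow> real \<times> complex) \<Rightarrow> bool" where
  "form_symmetry m R \<longleftrightarrow> orthogonal_transformation R \<and>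
     (\<exists>g. linear g \<and> inj_on g (Sym m) \<and> g ` Sym m = Sym m \<and>
       (\<forall>A\<in>so3. \<forall>x\<in>Sym m. g (rep m A x) = rep m A (g x)) \<and>
       (\<forall>x\<in>Sym m. \<forall>y\<in>Sym m. form m (g x) (g y) = R (form m x y)))"

lemma form_symmetry_compose:
  assumes "form_symmetry m R" "form_symmetry m R'"
  shows "form_symmetry m (R' \<circ> R)"
proof -
  obtain g where g: "linear g" "inj_on g (Sym m)" "g ` Sym m = Sym m"
    "\<And>A x. A \<in> so3 \<Longrightarrow> x \<in> Sym m \<Longrightarrow> g (rep m A x) = rep m A (g x)"
    "\<And>x y. x \<in> Sym m \<Longrightarrow> y \<in> Sym m \<Longrightarrow> form m (g x) (g y) = R (form m x y)"
    using assms(1) unfolding form_symmetry_def by blast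
  obtain h where h: "linear h" "inj_on h (Sym m)" "h ` Sym m = Sym m"
    "\<And>A x. A \<in> so3 \<Longrightarrow> x \<in> Sym m \<Longrightarrow> h (rep m A x) = rep m A (h x)"
    "\<And>x y. x \<in> Sym m \<Longrightarrow> y \<in> Sym m \<Longrightarrow> form m (h x) (h y) = R' (form m x y)"
    using assms(2) unfolding form_symmetry_def by blast
  have gS: "g x \<in> Sym m" if "x \<in> Sym m" for x using that g(3) by blast
  show ?thesis
    unfolding form_symmetry_def
  proof (intro conjI exI[of _ "h \<circ> g"] ballI)
    show "orthogonal_transformation (R' \<circ> R)"
      using assms by (auto simp: form_symmetry_def intro: orthogonal_transformation_compose)
    show "linear (h \<circ> g)" by (rule linear_compose[OF g(1) h(1)])
    show "inj_on (h \<circ> g) (Sym m)" using g h by (intro comp_inj_on) auto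
    show "(h \<circ> g) ` Sym m = Sym m" by (simp only: image_comp[symmetric] g(3) h(3))
  qed (simp_all add: g h gS)
qed

lemma bilin_conjJ_left:
  assumes m: "odd m" and y: "y \<in> Sym m" shows "bilin m (conjJ m x) y = cnj (herm m x y)"
  using bilin_commute[of m "conjJ m x" y] m by (simp add: bilin_conjJ herm_commute[of m y x])

lemma form_smult_unit:
  assumes "cmod u = 1"
  shows "form m (Polynomial.smult u x) (Polynomial.smult u y) = (\<lambda>z. (fst z, u\<^sup>2 * snd z)) (form m x y)"
proof -
  have "u * cnj u = 1" using assms by (simp flip: complex_norm_square)
  then have w: "cnj u * (u * w) = w" for w by (simp add: mult.commute flip: mult.assoc)
  show ?thesis
    unfolding form_def herm_smult_left herm_smult_right bilin_smult_left bilin_smult_right w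
    by (simp add: power2_eq_square mult.assoc)
qed

text \<open>Multiplication by the unit complex number \<open>u\<close> preserves the Hermitian form and multiplies the
  bilinear one by \<open>u\<^sup>2\<close>.\<close>

lemma form_symmetry_phase:
  assumes u: "cmod u = 1" shows "form_symmetry m (\<lambda>z. (fst z, u\<^sup>2 * snd z))"
proof -
  have u0: "u \<noteq> 0" using u by auto
  show ?thesis
    unfolding form_symmetry_def
  proof (intro conjI exI[of _ "\<lambda>p. Polynomial.smult u p"] ballI)
    show "orthogonal_transformation (\<lambda>z :: real \<times> complex. (fst z, u\<^sup>2 * snd z))"
      unfolding orthogonal_transformation
    proof
      show "linear (\<lambda>z :: real \<times> complex. (fst z, u\<^sup>2 * snd z))"
        by (rule linearI) (simp_all add: algebra_simps)
      show "\<forall>v :: real \<times> complex. norm (fst v, u\<^sup>2 * snd v) = norm v"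
        using u by (simp add: norm_prod_def norm_mult norm_power)
    qed
    show "linear (Polynomial.smult u)"
      by (rule linearI; rule poly_eqI) (simp_all add: algebra_simps)
    show "inj_on (Polynomial.smult u) (Sym m)"
      using u0 by (intro inj_onI) (metis smult_smult left_inverse smult_1_left)
    show "Polynomial.smult u ` Sym m = Sym m"
    proof
      show "Sym m \<subseteq> Polynomial.smult u ` Sym m"
      proof
        fix p assume "p \<in> Sym m"
        then show "p \<in> Polynomial.smult u ` Sym m"
          using u0 by (intro image_eqI[of _ _ "Polynomial.smult (1 / u) p"] smult_in_Sym) simp_all
      qed
    qed (auto intro: smult_in_Sym)
  qed (simp_all add: rep_smult form_smult_unit[OF u])
qed

text \<open>This is the effect of the unit quaternion \<open>cos t + sin t J\<close>: a rotation by the angle \<open>2 t\<close> that fixes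
  the real part of the bilinear form.\<close>

lemma form_symmetry_rotation:
  assumes m: "odd m"
  shows "form_symmetry m (\<lambda>z. (cos (2 * t) * fst z + sin (2 * t) * Im (snd z),
      Complex (Re (snd z)) (cos (2 * t) * Im (snd z) - sin (2 * t) * fst z)))"
    (is "form_symmetry m ?R")
proof -
  define c s where "c = cos t" and "s = sin t"
  have cs: "c\<^sup>2 + s\<^sup>2 = 1" by (simp add: c_def s_def)
  have C: "cos (2 * t) = c\<^sup>2 - s\<^sup>2" "sin (2 * t) = 2 * c * s"
    by (simp_all add: c_def s_def cos_double sin_double)
  define g where "g p = c *\<^sub>R p + s *\<^sub>R conjJ m p" for p
  define h where "h p = c *\<^sub>R p - s *\<^sub>R conjJ m p" for p
  have J2: "conjJ m (conjJ m p) = - p" if "p \<in> Sym m" for p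
    using conjJ_conjJ[OF that] m by simp
  have gS: "g p \<in> Sym m" and hS: "h p \<in> Sym m" if "p \<in> Sym m" for p
    using that unfolding g_def h_def
    by (auto intro!: subspace_add subspace_diff subspace_scale subspace_Sym conjJ_in_Sym)
  have gh: "g (h p) = p" "h (g p) = p" if "p \<in> Sym m" for p
  proof -
    have "g (h p) = (c\<^sup>2 + s\<^sup>2) *\<^sub>R p" "h (g p) = (c\<^sup>2 + s\<^sup>2) *\<^sub>R p"
      using that by (simp_all add: g_def h_def conjJ_diff conjJ_add conjJ_scaleR J2 power2_eq_square algebra_simps)
    then show "g (h p) = p" "h (g p) = p" by (simp_all add: cs)
  qed
  show ?thesis
    unfolding form_symmetry_def
  proof (intro conjI exI[of _ g] ballI)
    show "orthogonal_transformation ?R"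
      unfolding orthogonal_transformation
    proof
      show "linear ?R"
        by (rule linearI) (simp_all add: algebra_simps complex_eq_iff)
      show "\<forall>v. norm (?R v) = norm v"
      proof
        fix v :: "real \<times> complex"
        let ?C = "cos (2 * t)" and ?S = "sin (2 * t)"
        have "(?C * fst v + ?S * Im (snd v))\<^sup>2 + (?C * Im (snd v) - ?S * fst v)\<^sup>2 =
            (?S\<^sup>2 + ?C\<^sup>2) * ((fst v)\<^sup>2 + (Im (snd v))\<^sup>2)"
          by (simp only: power2_eq_square) (simp only: algebra_simps)
        then show "norm (?R v) = norm v"
          unfolding norm_prod_def by (simp add: cmod_power2 algebra_simps)
      qed
    qed
    show "linear g"
      unfolding g_def by (rule linearI) (simp_all add: conjJ_add conjJ_scaleR algebra_simps)
    show "inj_on g (Sym m)"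
      by (rule inj_on_inverseI[of _ h]) (rule gh(2))
    show "g ` Sym m = Sym m"
      using gh(1) gS hS by (metis (no_types, lifting) image_iff subsetI subset_antisym image_subsetI)
    show "g (rep m A x) = rep m A (g x)" if "x \<in> Sym m" for A x
      using that by (simp add: g_def conjJ_rep rep_add rep_scaleR)
    fix x y assume x: "x \<in> Sym m" and y: "y \<in> Sym m"
    have 1: "bilin m x (conjJ m y) = - herm m x y" using m by (simp add: bilin_conjJ)
    have 2: "bilin m (conjJ m x) y = cnj (herm m x y)" by (rule bilin_conjJ_left[OF m y])
    have 3: "bilin m (conjJ m x) (conjJ m y) = cnj (bilin m x y)"
      using bilin_conjJ_left[OF m conjJ_in_Sym, of x y] bilin_conjJ[of m x "conjJ m y"] m y
      by (simp add: J2 bilin_smult_right[of m x "-1" y, simplified])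
    have 4: "herm m x (conjJ m y) = bilin m x y"
      using bilin_conjJ[of m x "conjJ m y"] m y by (simp add: J2 bilin_smult_right[of m x "-1" y, simplified])
    have 5: "herm m (conjJ m x) y = - cnj (bilin m x y)"
      using bilin_conjJ[of m "conjJ m x" y] 3 m by simp
    have 6: "herm m (conjJ m x) (conjJ m y) = cnj (herm m x y)"
      using bilin_conjJ[of m "conjJ m x" "conjJ m y"] 2 m y by (simp add: J2 bilin_smult_right[of m "conjJ m x" "-1" y, simplified])
    have "bilin m (g x) (g y) = c\<^sup>2 * bilin m x y + c * s * (cnj (herm m x y) - herm m x y) + s\<^sup>2 * cnj (bilin m x y)"
      unfolding g_def smult_of_real[symmetric] bilin_add_left bilin_add_right bilin_smult_left bilin_smult_right 1 2 3
      by (simp add: power2_eq_square algebra_simps)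
    moreover have "herm m (g x) (g y) = c\<^sup>2 * herm m x y + c * s * (bilin m x y - cnj (bilin m x y)) + s\<^sup>2 * cnj (herm m x y)"
      unfolding g_def smult_of_real[symmetric] herm_add_left herm_add_right herm_smult_left herm_smult_right 4 5 6
      by (simp add: power2_eq_square algebra_simps)
    moreover have "c\<^sup>2 * Re (bilin m x y) + s\<^sup>2 * Re (bilin m x y) = Re (bilin m x y)"
      using cs by (simp flip: distrib_right)
    ultimately show "form m (g x) (g y) = ?R (form m x y)"
      unfolding C by (simp add: form_def complex_eq_iff algebra_simps flip: of_real_power)
  qed
qed

text \<open>A phase makes the complex component purely imaginary; a rotation in the plane of the real component
  and the imaginary part then removes it.\<close>

lemma form_symmetry_moves_to_axis:
  assumes m: "odd m"
  shows "\<exists>R. form_symmetry m R \<and> R a = (norm a, 0)"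
proof -
  \<comment> \<open>\<open>u\<^sup>2\<close> turns the argument of \<open>snd a\<close> into \<open>pi / 2\<close>\<close>
  define u where "u = cis ((pi / 2 - Arg (snd a)) / 2)"
  define R1 where "R1 = (\<lambda>z :: real \<times> complex. (fst z, u\<^sup>2 * snd z))"
  have s1: "form_symmetry m R1"
    unfolding R1_def by (rule form_symmetry_phase) (simp add: u_def)
  have "u\<^sup>2 = cis (pi / 2 - Arg (snd a))"
    unfolding u_def power2_eq_square cis_mult by (simp only: field_sum_of_halves)
  moreover have "snd a = of_real (cmod (snd a)) * cis (Arg (snd a))"
    using rcis_cmod_Arg[of "snd a"] by (simp add: rcis_def)
  ultimately have "u\<^sup>2 * snd a = of_real (cmod (snd a)) * cis (pi / 2)"
    by (metis (no_types, lifting) cis_mult diff_add_cancel mult.left_commute)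
  then have R1: "R1 a = (fst a, \<i> * of_real (cmod (snd a)))"
    by (simp add: R1_def)
  define b where "b = Complex (fst a) (cmod (snd a))"
  define t where "t = Arg b / 2"
  define R2 where "R2 = (\<lambda>z. (cos (2 * t) * fst z + sin (2 * t) * Im (snd z),
      Complex (Re (snd z)) (cos (2 * t) * Im (snd z) - sin (2 * t) * fst z)))"
  have s2: "form_symmetry m R2"
    unfolding R2_def by (rule form_symmetry_rotation[OF m])
  have "b = of_real (cmod b) * cis (2 * t)"
    using rcis_cmod_Arg[of b] by (simp add: rcis_def t_def)
  then have ab: "fst a = cmod b * cos (2 * t)" "cmod (snd a) = cmod b * sin (2 * t)"
    unfolding complex_eq_iff by (simp_all add: b_def)
  have "cos (2 * t) * fst a + sin (2 * t) * cmod (snd a) = cmod b * ((cos (2 * t))\<^sup>2 + (sin (2 * t))\<^sup>2)"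
    unfolding ab power2_eq_square by (simp only: algebra_simps)
  then have "cos (2 * t) * fst a + sin (2 * t) * cmod (snd a) = cmod b"
    by simp
  moreover have "cos (2 * t) * cmod (snd a) - sin (2 * t) * fst a = 0"
    unfolding ab by simp
  ultimately have "R2 (R1 a) = (cmod b, 0)"
    by (simp add: R1 R2_def complex_eq_iff)
  moreover have "cmod b = norm a"
    by (simp add: b_def cmod_def norm_prod_def)
  ultimately show ?thesis
    using form_symmetry_compose[OF s1 s2] by (intro exI[of _ "R2 \<circ> R1"]) simp
qed

lemma heis_model_iso_of_symmetry:
  assumes m: "odd m" and P: "linear P" "\<And>z. P (P z) = P z" and Q: "linear Q" "\<And>z. Q (Q z) = Q z"
    and R: "form_symmetry m R" "R ` {z. P z = 0} = {z. Q z = 0}"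
  shows "so3_isomorphic (heis_model m P) (heis_model m Q)"
proof -
  obtain g where g: "linear g" "inj_on g (Sym m)" "g ` Sym m = Sym m"
    "\<And>A x. A \<in> so3 \<Longrightarrow> x \<in> Sym m \<Longrightarrow> g (rep m A x) = rep m A (g x)"
    "\<And>x y. x \<in> Sym m \<Longrightarrow> y \<in> Sym m \<Longrightarrow> form m (g x) (g y) = R (form m x y)"
    using R(1) unfolding form_symmetry_def by blast
  have oR: "orthogonal_transformation R" using R(1) by (simp add: form_symmetry_def)
  have lR: "linear R" "surj R" "inj R"
    using orthogonal_transformation_bij[OF oR] orthogonal_transformation_linear[OF oR] by (auto simp: bij_def)
  let ?F = "\<lambda>x. (g (fst x), Q (R (snd x)))"
  have "so3_alg_iso ?F (heis_model m P) (heis_model m Q)"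
  proof (rule heis_model_recognition[OF m P])
    have "?F ` (Sym m \<times> UNIV) = g ` Sym m \<times> Q ` R ` UNIV" by force
    then show "?F ` (Sym m \<times> UNIV) = carrier (heis_model m Q)"
      using lR(2) by (simp add: g(3) heis_model_simps)
    fix x :: "complex poly \<times> (real \<times> complex)" assume "x \<in> Sym m \<times> UNIV"
    then have x: "fst x \<in> Sym m" by auto
    have "g (fst x) = 0 \<longleftrightarrow> fst x = 0"
      using inj_on_eq_iff[OF g(2) x subspace_0[OF subspace_Sym]] by (simp add: linear_0[OF g(1)])
    moreover have "Q (R (snd x)) = 0 \<longleftrightarrow> P (snd x) = 0"
    proof -
      have "R (snd x) \<in> R ` {z. P z = 0} \<longleftrightarrow> snd x \<in> {z. P z = 0}"
        by (rule inj_image_mem_iff[OF lR(3)])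
      then show ?thesis unfolding R(2) by simp
    qed
    ultimately show "?F x = \<zero>\<^bsub>heis_model m Q\<^esub> \<longleftrightarrow> fst x = 0 \<and> P (snd x) = 0"
      by (simp add: heis_model_simps zero_prod_def)
    show "?F (rep m A (fst x), 0) = sact (heis_model m Q) A (?F x)" if "A \<in> so3" for A
      using that x by (simp add: heis_model_simps g linear_0[OF lR(1)] linear_0[OF Q(1)])
    fix y :: "complex poly \<times> (real \<times> complex)" assume "y \<in> Sym m \<times> UNIV"
    then have y: "fst y \<in> Sym m" by auto
    show "?F (0, form m (fst x) (fst y)) = ?F x \<otimes>\<^bsub>heis_model m Q\<^esub> ?F y"
      using x y by (simp add: heis_model_simps g linear_0[OF g(1)])
  qed (simp_all add: concreteD[OF heis_model_concrete[OF Q(1)]] linear_add[OF g(1)] linear_add[OF lR(1)]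
      linear_add[OF Q(1)] linear_scale[OF g(1)] linear_scale[OF lR(1)] linear_scale[OF Q(1)]
      linear_0[OF g(1)] linear_0[OF lR(1)] linear_0[OF Q(1)] prod_eq_iff)
  then show ?thesis by (rule so3_alg_iso.isomorphic)
qed

text \<open>One representative of each dimension. The junk value for \<open>d > 3\<close> never occurs as a dimension.\<close>

definition canonical_subspace :: "nat \<Rightarrow> (real \<times> complex) set" where
  "canonical_subspace d = (if d = 0 then {0} else if d = 1 then span {(1, 0)}
     else if d = 2 then {z. (1, 0) \<bullet> z = 0} else UNIV)"

lemma subspace_canonical: "subspace (canonical_subspace d)"
  by (simp add: canonical_subspace_def subspace_span subspace_hyperplane subspace_UNIV)

text \<open>A line is moved to the axis by moving a spanning vector there, a plane by moving its normal
  vector.\<close>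

lemma symmetry_to_canonical:
  assumes m: "odd m" and K: "subspace K"
  shows "\<exists>R. form_symmetry m R \<and> R ` K = canonical_subspace (dim K)"
proof -
  have D: "DIM(real \<times> complex) = 3" by simp
  have "dim K \<le> 3" using dim_subset_UNIV[of K] D by simp
  then consider "dim K = 0" | "dim K = 1" | "dim K = 2" | "dim K = 3" by linarith
  then show ?thesis
  proof cases
    case 1
    obtain R where R: "form_symmetry m R" using form_symmetry_moves_to_axis[OF m] by blast
    have "K = {0}" using 1 K dim_eq_0 subspace_0 by blast
    moreover have "R 0 = 0"
      using R orthogonal_transformation_linear linear_0 by (auto simp: form_symmetry_def)
    ultimately show ?thesis using R 1 by (auto simp: canonical_subspace_def)
  next
    case 2
    obtain B where B: "B \<subseteq> K" "independent B" "K \<subseteq> span B" "card B = 1"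
      using basis_exists[of K] 2 by auto
    then obtain a where a: "B = {a}" by (auto simp: card_1_singleton_iff)
    then have "a \<noteq> 0" using B(2) by (metis dependent_single)
    have Ka: "K = span {a}" using B a K span_minimal by blast
    obtain R where R: "form_symmetry m R" "R a = (norm a, 0)" using form_symmetry_moves_to_axis[OF m] by blast
    have "linear R" using R(1) orthogonal_transformation_linear by (auto simp: form_symmetry_def)
    then have "R ` K = span {norm a *\<^sub>R (1::real, 0::complex)}"
      by (simp add: Ka linear_span_image[symmetric] R(2))
    also have "\<dots> = span {(1, 0)}"
      using \<open>a \<noteq> 0\<close> span_image_scale[of "{(1::real, 0::complex)}" "\<lambda>_. norm a"] by simp
    finally show ?thesis using R(1) 2 by (auto simp: canonical_subspace_def)
  next
    case 3
    let ?N = "{y \<in> UNIV. \<forall>x\<in>K. orthogonal x y}"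
    have "dim ?N + dim K = 3"
      using dim_subspace_orthogonal_to_vectors[OF K subspace_UNIV] by simp
    then have "dim ?N \<noteq> 0" using 3 by simp
    then obtain a where a: "a \<in> ?N" "a \<noteq> 0" by (metis (no_types, lifting) dim_eq_0 singletonI subsetI)
    have "K \<subseteq> {y. a \<bullet> y = 0}" using a(1) by (auto simp: orthogonal_def inner_commute)
    moreover have "dim {y. a \<bullet> y = 0} = 2" using dim_hyperplane[OF a(2)] by simp
    ultimately have Ka: "K = {y. a \<bullet> y = 0}"
      using 3 by (intro subspace_dim_equal K subspace_hyperplane) auto
    obtain R where R: "form_symmetry m R" "R a = (norm a, 0)" using form_symmetry_moves_to_axis[OF m] by blast
    have oR: "orthogonal_transformation R" using R(1) by (simp add: form_symmetry_def)
    have inner: "(norm a, 0) \<bullet> R y = a \<bullet> y" for y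
      using oR unfolding orthogonal_transformation_def R(2)[symmetric] by blast
    have "R ` K = {z. (norm a, 0) \<bullet> z = 0}"
    proof (intro equalityI subsetI)
      fix z assume "z \<in> R ` K"
      then show "z \<in> {z. (norm a, 0) \<bullet> z = 0}" using inner by (auto simp: Ka)
    next
      fix z :: "real \<times> complex" assume z: "z \<in> {z. (norm a, 0) \<bullet> z = 0}"
      obtain y where y: "z = R y" using orthogonal_transformation_surj[OF oR] by (rule surjE)
      then have "y \<in> K" using z inner[of y] by (simp add: Ka)
      then show "z \<in> R ` K" using y by blast
    qed
    also have "\<dots> = {z. (1, 0) \<bullet> z = 0}"
      using a(2) by (simp add: inner_prod_def)
    finally show ?thesis using R(1) 3 by (auto simp: canonical_subspace_def)
  next
    case 4
    obtain R where R: "form_symmetry m R" using form_symmetry_moves_to_axis[OF m] by blast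
    have "K = UNIV" using 4 K D by (metis dim_eq_full span_eq_iff)
    moreover have "surj R" using R orthogonal_transformation_surj by (auto simp: form_symmetry_def)
    ultimately show ?thesis using R 4 by (auto simp: canonical_subspace_def)
  qed
qed

lemma heis_model_isomorphic_if_dim_eq:
  assumes m: "odd m" and P: "linear P" "\<And>z. P (P z) = P z" and Q: "linear Q" "\<And>z. Q (Q z) = Q z"
    and dim: "dim {z. P z = 0} = dim {z. Q z = 0}"
  shows "so3_isomorphic (heis_model m P) (heis_model m Q)"
proof -
  obtain C where C: "linear C" "\<And>z. C (C z) = C z" "{z. C z = 0} = canonical_subspace (dim {z. P z = 0})"
    using idempotent_with_kernel_exists[OF subspace_canonical] by metis
  have "so3_isomorphic (heis_model m T) (heis_model m C)"
    if T: "linear T" "\<And>z. T (T z) = T z" "dim {z. T z = 0} = dim {z. P z = 0}" for T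
  proof -
    obtain R where "form_symmetry m R" "R ` {z. T z = 0} = {z. C z = 0}"
      using symmetry_to_canonical[OF m linear_subspace_kernel[OF T(1)]] T(3) C(3) by metis
    then show ?thesis by (rule heis_model_iso_of_symmetry[OF m T(1,2) C(1,2)])
  qed
  from this[OF P refl] this[OF Q dim[symmetric]] show ?thesis
    using heis_model_minimal_solvable[OF m Q(1)]
    by (metis minimal_solvable_lie_so3_def so3_isomorphic_sym so3_isomorphic_trans)
qed

section \<open>The coset construction of \<open>hu\<^sub>4\<^sub>n\<^sup>i\<close>\<close>

lemma (in module_iso) module_iso_inverse: "module_iso (the_inv_into (carrier L) f) M L"
proof -
  interpret M: module real_ring M by (rule M_module)
  have inv: "the_inv_into (carrier L) f (f x) = x" if "x \<in> carrier L" for x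
    using f_inj that by (rule the_inv_into_f_f)
  show ?thesis
  proof unfold_locales
    show "bij_betw (the_inv_into (carrier L) f) (carrier M) (carrier L)"
      by (rule bij_betw_the_inv_into[OF f_bij])
    show "the_inv_into (carrier L) f \<zero>\<^bsub>M\<^esub> = \<zero>\<^bsub>L\<^esub>"
      by (simp add: inv flip: f_zero)
  qed (auto elim!: carrier_M_cases simp: inv L_smult_closed simp flip: f_add f_smult)
qed

lemma d_complex_simps:
  shows "carrier (d_complex (Suc m)) = Sym m" "\<zero>\<^bsub>d_complex (Suc m)\<^esub> = 0" "add (d_complex (Suc m)) = (+)"
    "smult (d_complex (Suc m)) = scaleR" "sact (d_complex (Suc m)) = rep m"
  by (auto simp: d_complex_def Sym_def rep_def fun_eq_iff smult_of_real)

lemma alt_forms_carrier: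
  "\<phi> \<in> carrier (alt_forms (d_complex (Suc m))) \<longleftrightarrow>
    alt_inv_form m (Sym m) \<phi> \<and>
    (\<forall>x y. x \<notin> Sym m \<or> y \<notin> Sym m \<longrightarrow> \<phi> x y = 0)"
  unfolding alt_inv_form_def
  by (simp add: alt_forms_def d_complex_simps conj_assoc)

lemma alt_dual_carrier:
  "f \<in> carrier (alt_dual V) \<longleftrightarrow>
    (\<forall>\<phi>\<in>carrier (alt_forms V). \<forall>\<psi>\<in>carrier (alt_forms V). f (\<lambda>x y. \<phi> x y + \<psi> x y) = f \<phi> + f \<psi>) \<and>
    (\<forall>r. \<forall>\<phi>\<in>carrier (alt_forms V). f (\<lambda>x y. r * \<phi> x y) = r * f \<phi>) \<and>
    (\<forall>\<phi>. \<phi> \<notin> carrier (alt_forms V) \<longrightarrow> f \<phi> = 0)"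
proof -
  have "add (alt_forms V) = (\<lambda>\<phi> \<psi> x y. \<phi> x y + \<psi> x y)" "smult (alt_forms V) = (\<lambda>r \<phi> x y. r * \<phi> x y)"
    by (simp_all add: alt_forms_def)
  then show ?thesis by (simp add: dual_space_def)
qed

lemma alt_inv_form_add:
  assumes "alt_inv_form m U \<phi>" "alt_inv_form m U \<psi>"
  shows "alt_inv_form m U (\<lambda>x y. \<phi> x y + \<psi> x y)"
  unfolding alt_inv_form_def
  by (simp add: alt_inv_formD[OF assms(1)] alt_inv_formD[OF assms(2)] scaleR_add_right)

lemma alt_inv_form_mult:
  fixes \<phi> :: "complex poly \<Rightarrow> complex poly \<Rightarrow> real"
  assumes "alt_inv_form m U \<phi>"
  shows "alt_inv_form m U (\<lambda>x y. r * \<phi> x y)"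
  unfolding alt_inv_form_def by (simp add: alt_inv_formD[OF assms] distrib_left)

lemma alt_forms_closed:
  assumes "\<phi> \<in> carrier (alt_forms (d_complex (Suc m)))"
  shows "\<psi> \<in> carrier (alt_forms (d_complex (Suc m))) \<Longrightarrow>
      (\<lambda>x y. \<phi> x y + \<psi> x y) \<in> carrier (alt_forms (d_complex (Suc m)))"
    "(\<lambda>x y. r * \<phi> x y) \<in> carrier (alt_forms (d_complex (Suc m)))"
  using assms by (auto simp: alt_forms_carrier alt_inv_form_add alt_inv_form_mult)

text \<open>The functional \<open>\<phi> \<mapsto> T z\<close>, where \<open>\<phi> = T \<circ> form m\<close> is the factorization of an invariant alternating
  form; here \<open>T z\<close> is obtained as \<open>\<phi> t\<^sup>m (dual_vec m z)\<close>.\<close>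

definition alt_dual_of :: "nat \<Rightarrow> real \<times> complex \<Rightarrow> (complex poly \<Rightarrow> complex poly \<Rightarrow> real) \<Rightarrow> real" where
  "alt_dual_of m z = alt_eval (d_complex (Suc m)) (monom 1 m) (dual_vec m z)"

definition form_of :: "nat \<Rightarrow> (real \<times> complex \<Rightarrow> real) \<Rightarrow> complex poly \<Rightarrow> complex poly \<Rightarrow> real" where
  "form_of m l x y = (if x \<in> Sym m \<and> y \<in> Sym m then l (form m x y) else 0)"

text \<open>\<open>R \<times> C\<close> as a record, so that dimensions of its subspaces can be compared with those in
  \<open>alt_dual\<close>.\<close>

definition real_complex_module :: "(real, real \<times> complex) module" where
  "real_complex_module = \<lparr>carrier = UNIV, mult = (\<lambda>_ _. 0), one = 0, zero = 0, add = (+), smult = scaleR\<rparr>"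

lemma real_complex_module_concrete: "concrete real_complex_module" "carrier real_complex_module = UNIV"
  by (simp_all add: concrete_def real_complex_module_def)

lemma form_of_in_alt_forms:
  assumes m: "odd m" and l: "linear l"
  shows "form_of m l \<in> carrier (alt_forms (d_complex (Suc m)))"
proof -
  note D = alt_inv_formD[OF form_alt_inv[OF m]]
  show ?thesis
    unfolding alt_forms_carrier alt_inv_form_def
    by (auto simp: form_of_def D rep_in_Sym subspace_add[OF subspace_Sym] subspace_scale[OF subspace_Sym]
        linear_add[OF l] linear_scale[OF l] linear_neg[OF l] linear_0[OF l])
qed

lemma alt_dual_of_form_of:
  assumes m: "odd m" and l: "linear l"
  shows "alt_dual_of m z (form_of m l) = l z"
  using m form_of_in_alt_forms[OF assms]
  by (simp add: alt_dual_of_def alt_eval_def form_of_def monom_in_Sym dual_vec_in_Sym form_dual_vec)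

lemma alt_eval_eq:
  assumes m: "odd m" and xy: "x \<in> Sym m" "y \<in> Sym m"
  shows "alt_eval (d_complex (Suc m)) x y = alt_dual_of m (form m x y)"
proof
  fix \<phi>
  show "alt_eval (d_complex (Suc m)) x y \<phi> = alt_dual_of m (form m x y) \<phi>"
  proof (cases "\<phi> \<in> carrier (alt_forms (d_complex (Suc m)))")
    case True
    then have "\<phi> x y = \<phi> (monom 1 m) (dual_vec m (form m x y))"
      by (intro alt_inv_form_classification m xy) (simp add: alt_forms_carrier)
    with True show ?thesis by (simp add: alt_eval_def alt_dual_of_def)
  qed (simp add: alt_eval_def alt_dual_of_def)
qed

lemma alt_dual_of_linear:
  assumes m: "odd m"
  shows "alt_dual_of m (z + w) \<phi> = alt_dual_of m z \<phi> + alt_dual_of m w \<phi>"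
    "alt_dual_of m (r *\<^sub>R z) \<phi> = r * alt_dual_of m z \<phi>"
  unfolding alt_dual_of_def alt_eval_def linear_add[OF linear_dual_vec] linear_scale[OF linear_dual_vec]
  by (auto simp: alt_forms_carrier alt_inv_formD dual_vec_in_Sym monom_in_Sym)

lemma alt_dual_simps:
  "\<zero>\<^bsub>alt_dual V\<^esub> = (\<lambda>_. 0)" "f \<oplus>\<^bsub>alt_dual V\<^esub> g = (\<lambda>\<phi>. f \<phi> + g \<phi>)" "r \<odot>\<^bsub>alt_dual V\<^esub> f = (\<lambda>\<phi>. r * f \<phi>)"
  by (simp_all add: dual_space_def)

text \<open>The three real components of \<open>form m\<close> are a basis of the invariant alternating forms, and
  \<open>alt_dual_of m\<close> sends \<open>R \<times> C\<close> to the dual space in the coordinates of the dual basis.\<close>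

lemma alt_dual_of_iso:
  assumes m: "odd m"
  shows "module_iso (alt_dual_of m) real_complex_module (alt_dual (d_complex (Suc m)))"
proof -
  let ?A = "carrier (alt_forms (d_complex (Suc m)))"
  let ?v = "monom 1 m :: complex poly"
  have v: "?v \<in> Sym m" by (rule monom_in_Sym) simp
  interpret module real_ring real_complex_module
    by (rule concrete_module[OF real_complex_module_concrete(1)])
  have l1: "linear (fst :: real \<times> complex \<Rightarrow> real)" and l2: "linear (\<lambda>z :: real \<times> complex. Re (snd z))"
    and l3: "linear (\<lambda>z :: real \<times> complex. Im (snd z))"
    by (rule linearI; simp)+
  let ?e1 = "form_of m fst" and ?e2 = "form_of m (\<lambda>z. Re (snd z))" and ?e3 = "form_of m (\<lambda>z. Im (snd z))"
  note e_in = form_of_in_alt_forms[OF m l1] form_of_in_alt_forms[OF m l2] form_of_in_alt_forms[OF m l3]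
  have inj: "inj (alt_dual_of m)"
  proof (rule injI)
    fix z w assume eq: "alt_dual_of m z = alt_dual_of m w"
    show "z = w"
      using alt_dual_of_form_of[OF m l1, of z] alt_dual_of_form_of[OF m l1, of w]
        alt_dual_of_form_of[OF m l2, of z] alt_dual_of_form_of[OF m l2, of w]
        alt_dual_of_form_of[OF m l3, of z] alt_dual_of_form_of[OF m l3, of w] eq
      by (simp add: prod_eq_iff complex_eq_iff)
  qed
  have mem: "alt_dual_of m z \<in> carrier (alt_dual (d_complex (Suc m)))" for z
  proof -
    have "alt_dual_of m z (\<lambda>x y. \<phi> x y + \<psi> x y) = alt_dual_of m z \<phi> + alt_dual_of m z \<psi>"
      "alt_dual_of m z (\<lambda>x y. r * \<phi> x y) = r * alt_dual_of m z \<phi>" if "\<phi> \<in> ?A" "\<psi> \<in> ?A" for \<phi> \<psi> r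
    proof -
      have "(\<lambda>x y. \<phi> x y + \<psi> x y) \<in> ?A" "(\<lambda>x y. r * \<phi> x y) \<in> ?A"
        using that by (simp_all add: alt_forms_closed)
      then show "alt_dual_of m z (\<lambda>x y. \<phi> x y + \<psi> x y) = alt_dual_of m z \<phi> + alt_dual_of m z \<psi>"
        "alt_dual_of m z (\<lambda>x y. r * \<phi> x y) = r * alt_dual_of m z \<phi>"
        using that by (simp_all add: alt_dual_of_def alt_eval_def)
    qed
    then show ?thesis
      unfolding alt_dual_carrier by (simp add: alt_dual_of_def alt_eval_def)
  qed
  have "f \<in> range (alt_dual_of m)" if f: "f \<in> carrier (alt_dual (d_complex (Suc m)))" for f
  proof -
    have f_add: "f (\<lambda>x y. \<phi> x y + \<psi> x y) = f \<phi> + f \<psi>" and f_smult: "f (\<lambda>x y. r * \<phi> x y) = r * f \<phi>"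
      if "\<phi> \<in> ?A" "\<psi> \<in> ?A" for \<phi> \<psi> r
      using f that by (simp_all add: alt_dual_carrier)
    define z where "z = (f ?e1, Complex (f ?e2) (f ?e3))"
    have "f \<psi> = alt_dual_of m z \<psi>" for \<psi>
    proof (cases "\<psi> \<in> ?A")
      case False
      then show ?thesis using f by (simp add: alt_dual_carrier alt_dual_of_def alt_eval_def)
    next
      case True
      define T where "T z = \<psi> ?v (dual_vec m z)" for z
      have \<psi>: "alt_inv_form m (Sym m) \<psi>" using True by (simp add: alt_forms_carrier)
      have T: "linear T"
        unfolding T_def using alt_inv_formD[OF \<psi>] v
        by (intro linearI) (simp_all add: linear_add[OF linear_dual_vec] linear_scale[OF linear_dual_vec] dual_vec_in_Sym)
      define a1 a2 a3 where "a1 = T (1, 0)" and "a2 = T (0, 1)" and "a3 = T (0, \<i>)"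
      have T_eq: "T w = a1 * fst w + (a2 * Re (snd w) + a3 * Im (snd w))" for w
      proof -
        have "w = fst w *\<^sub>R (1, 0) + (Re (snd w) *\<^sub>R (0, 1) + Im (snd w) *\<^sub>R (0, \<i>))"
          by (simp add: prod_eq_iff complex_eq_iff)
        then have "T w = T (fst w *\<^sub>R (1, 0) + (Re (snd w) *\<^sub>R (0, 1) + Im (snd w) *\<^sub>R (0, \<i>)))"
          by (rule arg_cong)
        then show ?thesis
          by (simp only: linear_add[OF T] linear_scale[OF T] a1_def a2_def a3_def real_scaleR_def mult.commute)
      qed
      have "\<psi> x y = a1 * ?e1 x y + (a2 * ?e2 x y + a3 * ?e3 x y)" for x y
      proof (cases "x \<in> Sym m \<and> y \<in> Sym m")
        case False
        then show ?thesis using True by (auto simp: form_of_def alt_forms_carrier)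
      next
        case xy: True
        have "\<psi> x y = T (form m x y)"
          unfolding T_def using \<psi> xy m by (intro alt_inv_form_classification) auto
        then show ?thesis using xy by (simp add: T_eq form_of_def)
      qed
      then have "\<psi> = (\<lambda>x y. a1 * ?e1 x y + (a2 * ?e2 x y + a3 * ?e3 x y))" by blast
      then have "f \<psi> = a1 * f ?e1 + (a2 * f ?e2 + a3 * f ?e3)"
        using e_in by (simp add: f_add f_smult alt_forms_closed)
      also have "\<dots> = T z" by (simp add: T_eq z_def)
      also have "\<dots> = alt_dual_of m z \<psi>"
        using True by (simp add: T_def alt_dual_of_def alt_eval_def)
      finally show ?thesis .
    qed
    then have "f = alt_dual_of m z" by blast
    then show ?thesis by blast
  qed
  then have surj: "range (alt_dual_of m) = carrier (alt_dual (d_complex (Suc m)))"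
    using mem by blast
  note c = concreteD[OF real_complex_module_concrete(1)]
  have "alt_dual_of m 0 = (\<lambda>_. 0)"
    using alt_dual_of_linear(2)[OF m, of 0 0] by (simp add: fun_eq_iff)
  then show ?thesis
    by unfold_locales
      (simp_all add: c real_complex_module_concrete(2) bij_betw_def inj surj alt_dual_simps alt_dual_of_linear[OF m] fun_eq_iff)
qed

lemma heis_simps:
  assumes m: "odd m"
  shows "carrier (heis (d_complex (Suc m))) = Sym m \<times> range (alt_dual_of m)"
    "(x, alt_dual_of m z) \<oplus>\<^bsub>heis (d_complex (Suc m))\<^esub> (y, alt_dual_of m w) = (x + y, alt_dual_of m (z + w))"
    "r \<odot>\<^bsub>heis (d_complex (Suc m))\<^esub> (x, alt_dual_of m z) = (r *\<^sub>R x, alt_dual_of m (r *\<^sub>R z))"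
    "x \<in> Sym m \<Longrightarrow> y \<in> Sym m \<Longrightarrow>
      (x, f) \<otimes>\<^bsub>heis (d_complex (Suc m))\<^esub> (y, g) = (0, alt_dual_of m (form m x y))"
    "sact (heis (d_complex (Suc m))) A (x, f) = (rep m A x, alt_dual_of m 0)"
proof -
  interpret i: module_iso "alt_dual_of m" real_complex_module "alt_dual (d_complex (Suc m))"
    by (rule alt_dual_of_iso[OF m])
  have "range (alt_dual_of m) = carrier (alt_dual (d_complex (Suc m)))"
    using i.f_carrier by (simp add: real_complex_module_concrete)
  then show "carrier (heis (d_complex (Suc m))) = Sym m \<times> range (alt_dual_of m)"
    by (simp add: heis_def d_complex_simps)
  have "alt_dual_of m 0 = (\<lambda>_. 0)"
    using alt_dual_of_linear(2)[OF m, of 0 0] by (simp add: fun_eq_iff)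
  then show "sact (heis (d_complex (Suc m))) A (x, f) = (rep m A x, alt_dual_of m 0)"
    by (simp add: heis_def d_complex_simps alt_dual_simps)
qed (simp_all add: heis_def d_complex_simps alt_dual_simps alt_dual_of_linear[OF m] alt_eval_eq[OF m] fun_eq_iff)

text \<open>The coset of \<open>(x, alt_dual_of m z)\<close> depends on \<open>z\<close> modulo the preimage \<open>K\<close> of \<open>Z\<close> only, and the map
  that sends \<open>(x, z)\<close> to this coset is a homomorphism from the universal algebra with kernel \<open>{0} \<times> K\<close>.\<close>

lemma hu_isomorphic_heis_model:
  assumes n1: "n \<ge> 1" and Z': "has_dim (alt_dual (u_module n)) Z d"
  shows "\<exists>F P. linear P \<and> (\<forall>z. P (P z) = P z) \<and> dim {z. P z = 0} = d \<and>
    so3_alg_iso F (heis_model (2 * n - 1) P) (hu n Z)"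
proof -
  obtain m where mn: "2 * n = Suc m" using n1 by (cases n) auto
  then have m: "odd m" and m_eq: "2 * n - 1 = m" by presburger+
  have Z: "has_dim (alt_dual (d_complex (Suc m))) Z d" using Z' by (simp only: mn)
  let ?G = "heis (d_complex (Suc m))" and ?I = "{\<zero>\<^bsub>d_complex (Suc m)\<^esub>} \<times> Z"
  let ?ev = "alt_dual_of m"
  interpret i: module_iso "?ev" real_complex_module "alt_dual (d_complex (Suc m))"
    by (rule alt_dual_of_iso[OF m])
  define K where "K = {z. ?ev z \<in> Z}"
  let ?h = "the_inv_into (carrier real_complex_module) ?ev"
  have "vsubspace Z (alt_dual (d_complex (Suc m)))" using Z by (simp add: has_dim_def)
  then have "Z \<subseteq> range ?ev"
    using i.f_carrier by (simp add: vsubspace_iff[OF i.M_module] real_complex_module_concrete)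
  then have Z_eq: "Z = ?ev ` K" by (auto simp: K_def)
  have inj: "inj ?ev" using i.f_inj by (simp add: real_complex_module_concrete)
  have "?h ` Z = K"
    unfolding Z_eq image_comp comp_def
    using the_inv_into_f_f[OF inj] by (simp add: real_complex_module_concrete)
  then have "has_dim real_complex_module K d"
    using module_iso.has_dim_image[OF i.module_iso_inverse Z] by simp
  then obtain B where B: "subspace K" "B \<subseteq> K" "finite B" "card B = d" "independent B" "span B = K"
    by (auto simp: has_dim_def concrete_vsubspace_iff[OF real_complex_module_concrete(1)]
        concrete_lin_indep[OF real_complex_module_concrete(1)]
        concrete_lin_span[OF real_complex_module_concrete(1)] real_complex_module_concrete(2))
  have dimK: "dim K = d"
    using B by (metis dim_eq_card_independent dim_span)
  obtain P where P: "linear P" "\<And>z. P (P z) = P z" "{z. P z = 0} = K"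
    using idempotent_with_kernel_exists[OF B(1)] by blast
  define F where "F x = ?I +>\<^bsub>?G\<^esub> (fst x, ?ev (snd x))" for x
  have F: "F x = (\<lambda>k. (fst x, ?ev (k + snd x))) ` K" for x
    unfolding F_def a_r_coset_def' Z_eq d_complex_simps by (auto simp: heis_simps[OF m])
  have F_cong: "F (x, z) = F (x, w)" if "z - w \<in> K" for x z w
  proof -
    have "F (x, z) \<subseteq> F (x, w)" if "z - w \<in> K" for z w
    proof
      fix p assume "p \<in> F (x, z)"
      then obtain k where k: "k \<in> K" "p = (x, ?ev (k + z))" by (auto simp: F)
      then have "p = (x, ?ev ((k + (z - w)) + w))" "k + (z - w) \<in> K"
        using subspace_add[OF B(1) _ that] by (simp_all add: algebra_simps)
      then show "p \<in> F (x, w)" unfolding F fst_conv snd_conv by (rule image_eqI)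
    qed
    from this[OF that] this[of w z] show ?thesis
      using subspace_neg[OF B(1) that] by (simp add: subset_antisym)
  qed
  have F_coset: "?I +>\<^bsub>?G\<^esub> (x, ?ev z) = F (x, z)" for x z
    by (simp add: F_def)
  have K0: "0 \<in> K" by (rule subspace_0[OF B(1)])
  have hu_simps: "carrier (hu n Z) = a_rcosets\<^bsub>?G\<^esub> ?I" "\<zero>\<^bsub>hu n Z\<^esub> = ?I" "add (hu n Z) = set_add ?G"
    "mult (hu n Z) = rcoset_mult ?G ?I" "smult (hu n Z) r C = (\<Union>x\<in>C. ?I +>\<^bsub>?G\<^esub> (r \<odot>\<^bsub>?G\<^esub> x))"
    "sact (hu n Z) A C = (\<Union>x\<in>C. ?I +>\<^bsub>?G\<^esub> sact ?G A x)" for r A C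
    by (simp_all add: hu_def so3_quot_def mn)
  have I_eq: "?I = F 0"
    by (auto simp: F Z_eq d_complex_simps)
  have "so3_alg_iso F (heis_model m P) (hu n Z)"
  proof (rule heis_model_recognition)
    show "odd m" by (rule m)
    show "linear P" "P (P z) = P z" for z by (rule P)+
    show "F ` (Sym m \<times> UNIV) = carrier (hu n Z)"
      unfolding hu_simps A_RCOSETS_def' heis_simps(1)[OF m]
    proof (intro equalityI subsetI)
      fix C assume "C \<in> F ` (Sym m \<times> UNIV)"
      then obtain x where x: "C = F x" "fst x \<in> Sym m" by (auto simp: mem_Times_iff)
      then have "(fst x, ?ev (snd x)) \<in> Sym m \<times> range ?ev" by simp
      then show "C \<in> (\<Union>a\<in>Sym m \<times> range ?ev. {?I +>\<^bsub>?G\<^esub> a})"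
        unfolding x(1) F_def by blast
    next
      fix C assume "C \<in> (\<Union>a\<in>Sym m \<times> range ?ev. {?I +>\<^bsub>?G\<^esub> a})"
      then obtain x z where "x \<in> Sym m" "C = ?I +>\<^bsub>?G\<^esub> (x, ?ev z)" by blast
      then have "C = F (x, z)" "(x, z) \<in> Sym m \<times> UNIV" by (simp_all add: F_coset)
      then show "C \<in> F ` (Sym m \<times> UNIV)" by (rule image_eqI)
    qed
    show "F 0 = \<zero>\<^bsub>hu n Z\<^esub>" by (simp add: hu_simps I_eq)
    fix x :: "complex poly \<times> (real \<times> complex)" assume x: "x \<in> Sym m \<times> UNIV"
    show "F (r *\<^sub>R x) = r \<odot>\<^bsub>hu n Z\<^esub> F x" for r
    proof -
      have "?I +>\<^bsub>?G\<^esub> (r \<odot>\<^bsub>?G\<^esub> p) = F (r *\<^sub>R x)" if "p \<in> F x" for p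
      proof -
        obtain k where k: "k \<in> K" "p = (fst x, ?ev (k + snd x))" using \<open>p \<in> F x\<close> by (auto simp: F)
        then have "?I +>\<^bsub>?G\<^esub> (r \<odot>\<^bsub>?G\<^esub> p) = F (r *\<^sub>R fst x, r *\<^sub>R (k + snd x))"
          by (simp add: heis_simps[OF m] F_coset)
        also have "\<dots> = F (r *\<^sub>R fst x, r *\<^sub>R snd x)"
          using subspace_scale[OF B(1) k(1)] by (intro F_cong) (simp add: scaleR_add_right)
        finally show ?thesis by (simp add: scaleR_prod_def)
      qed
      moreover have "F x \<noteq> {}" using K0 by (auto simp: F)
      ultimately show ?thesis by (simp add: hu_simps)
    qed
    show "F (rep m A (fst x), 0) = sact (hu n Z) A (F x)" for A
    proof -
      have "?I +>\<^bsub>?G\<^esub> sact ?G A p = F (rep m A (fst x), 0)" if "p \<in> F x" for p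
        using that by (auto simp: F[of x] heis_simps[OF m] F_coset)
      moreover have "F x \<noteq> {}" using K0 by (auto simp: F)
      ultimately show ?thesis by (simp add: hu_simps)
    qed
    show "F x = \<zero>\<^bsub>hu n Z\<^esub> \<longleftrightarrow> fst x = 0 \<and> P (snd x) = 0"
    proof
      assume "F x = \<zero>\<^bsub>hu n Z\<^esub>"
      then have "F x = F 0" by (simp only: hu_simps I_eq)
      moreover have "(fst x, ?ev (0 + snd x)) \<in> F x"
        unfolding F using K0 by blast
      ultimately have "(fst x, ?ev (0 + snd x)) \<in> F 0" by simp
      then have "fst x = 0" "snd x \<in> K" using inj by (auto simp: F inj_eq)
      then show "fst x = 0 \<and> P (snd x) = 0" using P(3) by auto
    next
      assume *: "fst x = 0 \<and> P (snd x) = 0"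
      then have "snd x \<in> K" using P(3) by auto
      then have "F (0, snd x) = F (0, 0)" by (intro F_cong) simp
      moreover have "x = (0, snd x)" using * by (simp add: prod_eq_iff)
      ultimately show "F x = \<zero>\<^bsub>hu n Z\<^esub>" unfolding hu_simps I_eq zero_prod_def by simp
    qed
    fix y :: "complex poly \<times> (real \<times> complex)" assume y: "y \<in> Sym m \<times> UNIV"
    show "F (0, form m (fst x) (fst y)) = F x \<otimes>\<^bsub>hu n Z\<^esub> F y"
    proof -
      have "?I +>\<^bsub>?G\<^esub> (p \<otimes>\<^bsub>?G\<^esub> q) = F (0, form m (fst x) (fst y))" if "p \<in> F x" "q \<in> F y" for p q
        using that x y by (auto simp: F[of x] F[of y] heis_simps[OF m] F_coset)
      moreover have "F x \<noteq> {}" "F y \<noteq> {}" using K0 by (auto simp: F)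
      ultimately show ?thesis by (simp add: hu_simps rcoset_mult_def)
    qed
    show "F (x + y) = F x \<oplus>\<^bsub>hu n Z\<^esub> F y"
      unfolding hu_simps set_add_def'
    proof (intro equalityI subsetI)
      fix p assume "p \<in> F (x + y)"
      then obtain k where k: "k \<in> K" "p = (fst x + fst y, ?ev (k + (snd x + snd y)))" by (auto simp: F)
      then have "p = (fst x, ?ev (k + snd x)) \<oplus>\<^bsub>?G\<^esub> (fst y, ?ev (0 + snd y))"
        by (simp add: heis_simps[OF m] algebra_simps)
      moreover have "(fst x, ?ev (k + snd x)) \<in> F x" "(fst y, ?ev (0 + snd y)) \<in> F y"
        unfolding F using k(1) K0 by blast+
      ultimately show "p \<in> (\<Union>h\<in>F x. \<Union>k\<in>F y. {h \<oplus>\<^bsub>?G\<^esub> k})" by blast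
    next
      fix p assume "p \<in> (\<Union>h\<in>F x. \<Union>k\<in>F y. {h \<oplus>\<^bsub>?G\<^esub> k})"
      then obtain j k where jk: "j \<in> K" "k \<in> K" "p = (fst x, ?ev (j + snd x)) \<oplus>\<^bsub>?G\<^esub> (fst y, ?ev (k + snd y))"
        by (auto simp: F)
      then have "p = (fst (x + y), ?ev ((j + k) + snd (x + y)))"
        by (simp add: heis_simps[OF m] algebra_simps)
      then show "p \<in> F (x + y)"
        unfolding F using subspace_add[OF B(1) jk(1,2)] by blast
    qed
  qed
  then show ?thesis unfolding m_eq using P dimK by blast
qed

section \<open>Complexification and lowest weight vectors\<close>

text \<open>Pairs \<open>(x, y)\<close> stand for \<open>x + \<i> y\<close> in the complexification of a real vector space.\<close>

definition cscale :: "complex \<Rightarrow> 'v \<times> 'v \<Rightarrow> 'v::real_vector \<times> 'v" where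
  "cscale c w = (Re c *\<^sub>R fst w - Im c *\<^sub>R snd w, Re c *\<^sub>R snd w + Im c *\<^sub>R fst w)"

interpretation cvec: vector_space cscale
  by unfold_locales (simp_all add: cscale_def algebra_simps prod_eq_iff)

lemma cscale_of_real: "cscale (of_real r) w = r *\<^sub>R w"
  by (simp add: cscale_def prod_eq_iff)

lemma cscale_scaleR: "cscale c (r *\<^sub>R w) = r *\<^sub>R cscale c w" "r *\<^sub>R cscale c w = cscale (of_real r * c) w"
  by (simp_all add: cvec.scale_scale mult.commute flip: cscale_of_real)

definition lift2 :: "('v \<Rightarrow> 'v) \<Rightarrow> 'v \<times> 'v \<Rightarrow> 'v \<times> 'v" where
  "lift2 T w = (T (fst w), T (snd w))"

lemma linear_lift2: "linear T \<Longrightarrow> linear (lift2 T)"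
  by (rule linearI) (simp_all add: lift2_def linear_add linear_scale prod_eq_iff)

lemma lift2_cscale: "linear T \<Longrightarrow> lift2 T (cscale c w) = cscale c (lift2 T w)"
  by (simp add: lift2_def cscale_def linear_add linear_diff linear_scale)

text \<open>The last coefficient is nonzero, which suits arguments with a relation of minimal length.\<close>

lemma finite_span_relation:
  fixes v :: "nat \<Rightarrow> 'w::real_vector"
  assumes "finite B" "\<And>k. v k \<in> span B"
  shows "\<exists>n a. a n \<noteq> 0 \<and> (\<Sum>k\<le>n. a k *\<^sub>R v k) = 0"
proof -
  let ?N = "card B"
  have "\<exists>a. (\<exists>k\<le>?N. a k \<noteq> 0) \<and> (\<Sum>k\<le>?N. a k *\<^sub>R v k) = 0"
  proof (cases "inj_on v {..?N}")
    case True
    have "dependent (v ` {..?N})"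
    proof (rule ccontr)
      assume "independent (v ` {..?N})"
      then have "card (v ` {..?N}) \<le> card B"
        using independent_span_bound[OF assms(1)] assms(2) by blast
      then show False using True by (simp add: card_image)
    qed
    then obtain u where u: "\<exists>x\<in>v ` {..?N}. u x \<noteq> 0" "(\<Sum>x\<in>v ` {..?N}. u x *\<^sub>R x) = 0"
      by (auto simp: dependent_finite)
    then show ?thesis
      using True by (intro exI[of _ "u \<circ> v"]) (auto simp: sum.reindex)
  next
    case False
    then obtain i j where ij: "i \<le> ?N" "j \<le> ?N" "i \<noteq> j" "v i = v j"
      by (auto simp: inj_on_def)
    let ?a = "\<lambda>k. (if k = i then 1 else 0) - (if k = j then 1 else 0 :: real)"
    have "(\<Sum>k\<le>?N. ?a k *\<^sub>R v k) = (\<Sum>k\<le>?N. if k = i then v k else 0) - (\<Sum>k\<le>?N. if k = j then v k else 0)"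
      unfolding sum_subtractf[symmetric] by (intro sum.cong) auto
    also have "\<dots> = 0" using ij by simp
    finally show ?thesis using ij by (intro exI[of _ ?a]) auto
  qed
  then obtain a where a: "\<exists>k\<le>?N. a k \<noteq> 0" "(\<Sum>k\<le>?N. a k *\<^sub>R v k) = 0" by blast
  define n where "n = Max {k. k \<le> ?N \<and> a k \<noteq> 0}"
  have fin: "finite {k. k \<le> ?N \<and> a k \<noteq> 0}" by simp
  have n: "n \<le> ?N" "a n \<noteq> 0"
    using Max_in[OF fin] a(1) by (auto simp: n_def)
  have "a k = 0" if "k \<le> ?N" "k > n" for k
  proof (rule ccontr)
    assume "a k \<noteq> 0"
    then have "k \<le> n" using that(1) Max_ge[OF fin, of k] by (simp add: n_def)
    then show False using that(2) by simp
  qed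
  then have "(\<Sum>k\<le>n. a k *\<^sub>R v k) = (\<Sum>k\<le>?N. a k *\<^sub>R v k)"
    using n by (intro sum.mono_neutral_left) auto
  then show ?thesis using n a(2) by auto
qed

text \<open>Nonzero vectors \<open>w k\<close> would be eigenvectors for infinitely many different eigenvalues. Applying
  \<open>H\<close> minus the last eigenvalue shortens a linear relation of minimal length, and this reduces it to
  the single term \<open>w n\<close>. The coefficients remain real because the eigenvalues differ by reals.\<close>

lemma eigenvector_chain_vanishes:
  assumes H: "linear H" and B: "finite B" "\<And>k. w k \<in> span B"
    and eig: "\<And>k. H (w k) = cscale (l + of_real (e * real k)) (w k)" and e: "e \<noteq> 0"
  shows "\<exists>k. w k = 0"
proof -
  let ?Q = "\<lambda>n. \<exists>a. a n \<noteq> 0 \<and> (\<Sum>k\<le>n. a k *\<^sub>R w k) = 0"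
  define n where "n = (LEAST n. ?Q n)"
  have "?Q n"
    unfolding n_def by (rule LeastI_ex) (rule finite_span_relation[OF B])
  then obtain a where a: "a n \<noteq> 0" "(\<Sum>k\<le>n. a k *\<^sub>R w k) = 0" by blast
  have least: "a' j = 0" if "j < n" "(\<Sum>k\<le>j. a' k *\<^sub>R w k) = 0" for a' j
    using not_less_Least[of j ?Q] that unfolding n_def by blast
  \<comment> \<open>the coefficients after applying \<open>H\<close> minus the eigenvalue of \<open>w n\<close>; the one at \<open>n\<close> is zero\<close>
  let ?b = "\<lambda>k. a k * (e * real k - e * real n)"
  have "H (\<Sum>k\<le>n. a k *\<^sub>R w k) - cscale (l + of_real (e * real n)) (\<Sum>k\<le>n. a k *\<^sub>R w k) = (\<Sum>k\<le>n. ?b k *\<^sub>R w k)"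
    unfolding linear_sum[OF H] cvec.scale_sum_right sum_subtractf[symmetric]
  proof (rule sum.cong)
    fix k
    have "H (a k *\<^sub>R w k) - cscale (l + of_real (e * real n)) (a k *\<^sub>R w k) =
        a k *\<^sub>R cscale ((l + of_real (e * real k)) - (l + of_real (e * real n))) (w k)"
      by (simp only: linear_scale[OF H] eig cscale_scaleR(1) cvec.scale_left_diff_distrib scaleR_diff_right)
    also have "(l + of_real (e * real k)) - (l + of_real (e * real n)) = of_real (e * real k - e * real n)"
      by simp
    finally show "H (a k *\<^sub>R w k) - cscale (l + of_real (e * real n)) (a k *\<^sub>R w k) = ?b k *\<^sub>R w k"
      by (simp only: cscale_of_real scaleR_scaleR)
  qed simp
  then have sum_b: "(\<Sum>k\<le>n. ?b k *\<^sub>R w k) = 0"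
    by (simp add: a(2) linear_0[OF H])
  have "?b k = 0" if "k < n" for k
  proof -
    have "\<forall>j\<le>i. ?b (n - j) = 0" if "i \<le> n" for i
      using that
    proof (induction i)
      case (Suc i)
      then have IH: "\<forall>j\<le>i. ?b (n - j) = 0" by simp
      have "(\<Sum>k\<le>n - Suc i. ?b k *\<^sub>R w k) = (\<Sum>k\<le>n. ?b k *\<^sub>R w k)"
      proof (rule sum.mono_neutral_left)
        show "\<forall>k\<in>{..n} - {..n - Suc i}. ?b k *\<^sub>R w k = 0"
        proof
          fix k assume "k \<in> {..n} - {..n - Suc i}"
          then have "n - k \<le> i" "n - (n - k) = k" using Suc.prems by auto
          then have "?b k = 0" using IH by metis
          then show "?b k *\<^sub>R w k = 0" by simp
        qed
      qed auto
      then have "?b (n - Suc i) = 0"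
        using Suc.prems sum_b by (intro least) auto
      then show ?case using IH le_Suc_eq by auto
    qed simp
    from this[of n] show ?thesis using \<open>k < n\<close> by (metis diff_diff_cancel diff_le_self less_or_eq_imp_le order_refl)
  qed
  then have "a k = 0" if "k < n" for k using that e by force
  then have "(\<Sum>k\<le>n. a k *\<^sub>R w k) = a n *\<^sub>R w n"
    by (simp add: lessThan_Suc_atMost[symmetric])
  then show ?thesis using a by auto
qed

text \<open>A nonzero complex polynomial \<open>p\<close> of least degree with \<open>p(T) v = 0\<close> has a root \<open>z\<close>; for
  \<open>p = (X - z) r\<close> the vector \<open>r(T) v\<close> is an eigenvector.\<close>

lemma eigenvector_exists:
  assumes T: "linear T" "\<And>c w. T (cscale c w) = cscale c (T w)"
    and W: "subspace W" "\<And>c w. w \<in> W \<Longrightarrow> cscale c w \<in> W" "\<And>w. w \<in> W \<Longrightarrow> T w \<in> W"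
    and B: "finite B" "W \<subseteq> span B" and v: "v \<in> W" "v \<noteq> 0"
  shows "\<exists>w\<in>W. \<exists>z. w \<noteq> 0 \<and> T w = cscale z w"
proof -
  define x where "x k = (T ^^ k) v" for k
  have x_Suc: "x (Suc k) = T (x k)" and x0: "x 0 = v" for k by (simp_all add: x_def)
  have xW: "x k \<in> W" for k by (induction k) (simp_all add: x_Suc x0 v W)
  define ev where "ev p = (\<Sum>k\<le>degree p. cscale (coeff p k) (x k))" for p
  have ev_bound: "ev p = (\<Sum>k\<le>N. cscale (coeff p k) (x k))" if "degree p \<le> N" for p N
    unfolding ev_def using that by (intro sum.mono_neutral_left) (auto simp: coeff_eq_0)
  let ?Q = "\<lambda>p. p \<noteq> 0 \<and> ev p = 0"
  have "\<exists>p. ?Q p"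
  proof -
    have "x k \<in> span B" for k using xW B(2) by blast
    then obtain n a where a: "a n \<noteq> 0" "(\<Sum>k\<le>n. a k *\<^sub>R x k) = 0"
      using finite_span_relation[OF B(1), of x] by blast
    define p :: "complex poly" where "p = (\<Sum>k\<le>n. monom (of_real (a k)) k)"
    have cp: "coeff p k = (if k \<le> n then of_real (a k) else 0)" for k
      by (simp add: p_def coeff_sum if_distrib cong: if_cong)
    then have "degree p \<le> n" by (intro degree_le) simp
    then have "ev p = (\<Sum>k\<le>n. a k *\<^sub>R x k)"
      by (simp add: ev_bound cp cscale_of_real)
    moreover have "coeff p n \<noteq> 0" using a(1) by (simp add: cp)
    then have "p \<noteq> 0" by auto
    ultimately show ?thesis using a(2) by auto
  qed
  then obtain p where p: "?Q p" "\<And>q. ?Q q \<Longrightarrow> degree p \<le> degree q"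
    using ex_has_least_nat[of ?Q _ degree] by blast
  have "degree p \<noteq> 0"
  proof
    assume "degree p = 0"
    then obtain c where "p = [:c:]" by (metis degree_eq_zeroE)
    then show False using p(1) v(2) by (simp add: ev_def x0)
  qed
  then have "\<not> constant (poly p)" by (simp add: constant_degree)
  then obtain z where "poly p z = 0" using fundamental_theorem_of_algebra by blast
  then obtain r where r: "p = [:- z, 1:] * r" by (metis dvdE poly_eq_0_iff_dvd)
  have r0: "r \<noteq> 0" using p(1) r by auto
  then have deg: "degree p = Suc (degree r)" unfolding r by (subst degree_mult_eq) auto
  define w where "w = ev r"
  have "w \<noteq> 0" using p(2)[of r] r0 deg by (auto simp: w_def)
  moreover have "w \<in> W"
    unfolding w_def ev_def by (intro subspace_sum[OF W(1)] W(2) xW)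
  moreover have "T w = cscale z w"
  proof -
    let ?N = "degree r"
    have cp: "coeff p k = (case k of 0 \<Rightarrow> 0 | Suc j \<Rightarrow> coeff r j) - z * coeff r k" for k
      unfolding r by (cases k) simp_all
    have "T w = (\<Sum>k\<le>?N. cscale (coeff r k) (x (Suc k)))"
      unfolding w_def ev_def linear_sum[OF T(1)] T(2) x_Suc ..
    also have "\<dots> = (\<Sum>k\<le>Suc ?N. cscale (case k of 0 \<Rightarrow> 0 | Suc j \<Rightarrow> coeff r j) (x k))"
      unfolding sum.atMost_Suc_shift by simp
    finally have Tw: "T w = (\<Sum>k\<le>Suc ?N. cscale (case k of 0 \<Rightarrow> 0 | Suc j \<Rightarrow> coeff r j) (x k))" .
    have "w = (\<Sum>k\<le>Suc ?N. cscale (coeff r k) (x k))"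
      unfolding w_def by (rule ev_bound) simp
    then have "T w - cscale z w = (\<Sum>k\<le>Suc ?N. cscale (coeff p k) (x k))"
      unfolding Tw cp
      by (simp only: cvec.scale_sum_right sum_subtractf[symmetric] cvec.scale_scale cvec.scale_left_diff_distrib)
    also have "\<dots> = 0" using p(1) ev_bound[of p "Suc ?N"] deg by simp
    finally show ?thesis by simp
  qed
  ultimately show ?thesis by blast
qed

text \<open>The images of \<open>R\<^sub>1, R\<^sub>2, R\<^sub>3\<close> are linear on the whole type, which keeps side conditions out of the
  computations; \<open>K\<close> is the finite-dimensional module of interest.\<close>

locale so3_rep =
  fixes \<rho>1 \<rho>2 \<rho>3 :: "'v::real_vector \<Rightarrow> 'v" and K B :: "'v set"
  assumes linear: "linear \<rho>1" "linear \<rho>2" "linear \<rho>3"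
    and brackets: "\<rho>1 (\<rho>2 x) - \<rho>2 (\<rho>1 x) = \<rho>3 x" "\<rho>2 (\<rho>3 x) - \<rho>3 (\<rho>2 x) = \<rho>1 x" "\<rho>3 (\<rho>1 x) - \<rho>1 (\<rho>3 x) = \<rho>2 x"
    and K: "subspace K" "\<And>x. x \<in> K \<Longrightarrow> \<rho>1 x \<in> K" "\<And>x. x \<in> K \<Longrightarrow> \<rho>2 x \<in> K" "\<And>x. x \<in> K \<Longrightarrow> \<rho>3 x \<in> K"
    and B: "finite B" "K \<subseteq> span B"
    and nontrivial: "K \<noteq> {0}"
begin

text \<open>The operators that correspond to the standard triple of \<open>sl\<^sub>2\<close>, with \<open>[H, E] = 2 E\<close>,
  \<open>[H, F] = -2 F\<close> and \<open>[E, F] = H\<close>.\<close>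

definition H :: "'v \<times> 'v \<Rightarrow> 'v \<times> 'v" where "H w = cscale (2 * \<i>) (lift2 \<rho>3 w)"
definition E :: "'v \<times> 'v \<Rightarrow> 'v \<times> 'v" where "E w = cscale \<i> (lift2 \<rho>1 w) - lift2 \<rho>2 w"
definition F :: "'v \<times> 'v \<Rightarrow> 'v \<times> 'v" where "F w = cscale \<i> (lift2 \<rho>1 w) + lift2 \<rho>2 w"

lemma lift_parts:
  "lift2 \<rho>1 w = cscale (- \<i> / 2) (E w + F w)" "lift2 \<rho>2 w = cscale (- 1 / 2) (E w - F w)"
    "lift2 \<rho>3 w = cscale (- \<i> / 2) (H w)"
proof -
  have "E w + F w = cscale \<i> (lift2 \<rho>1 w) + cscale \<i> (lift2 \<rho>1 w)" by (simp add: E_def F_def)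
  then show "lift2 \<rho>1 w = cscale (- \<i> / 2) (E w + F w)"
    by (simp add: cvec.scale_scale flip: cvec.scale_left_distrib)
  have "E w - F w = cscale (- 2) (lift2 \<rho>2 w)"
    by (simp add: E_def F_def cscale_def prod_eq_iff scaleR_2)
  then show "lift2 \<rho>2 w = cscale (- 1 / 2) (E w - F w)"
    by (simp add: cvec.scale_scale)
  show "lift2 \<rho>3 w = cscale (- \<i> / 2) (H w)"
    by (simp add: H_def cvec.scale_scale)
qed

lemma HEF_cscale: "H (cscale c w) = cscale c (H w)" "E (cscale c w) = cscale c (E w)" "F (cscale c w) = cscale c (F w)"
  by (simp_all add: H_def E_def F_def lift2_cscale linear cvec.scale_scale mult.commute
      cvec.scale_right_distrib cvec.scale_right_diff_distrib)

lemma linear_cscale: "linear (cscale c)"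
  by (rule linearI) (simp_all add: cvec.scale_right_distrib cscale_scaleR(1))

lemma linear_HEF: "linear H" "linear E" "linear F"
  unfolding H_def[abs_def] E_def[abs_def] F_def[abs_def]
  using linear_lift2[OF linear(1)] linear_lift2[OF linear(2)] linear_lift2[OF linear(3)]
  by (auto intro!: linear_compose_add linear_compose_sub linear_compose[OF _ linear_cscale, unfolded comp_def])

lemma HEF_commute: "H (E w) = E (H w) + cscale 2 (E w)" "H (F w) = F (H w) - cscale 2 (F w)" "E (F w) = F (E w) + H w"
proof -
  have br: "\<rho>1 (\<rho>2 x) = \<rho>3 x + \<rho>2 (\<rho>1 x)" "\<rho>2 (\<rho>3 x) = \<rho>1 x + \<rho>3 (\<rho>2 x)" "\<rho>3 (\<rho>1 x) = \<rho>2 x + \<rho>1 (\<rho>3 x)" for x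
    using brackets[of x] by (simp_all add: algebra_simps)
  note l = linear_add[OF linear(1)] linear_add[OF linear(2)] linear_add[OF linear(3)]
    linear_diff[OF linear(1)] linear_diff[OF linear(2)] linear_diff[OF linear(3)]
    linear_scale[OF linear(1)] linear_scale[OF linear(2)] linear_scale[OF linear(3)]
    linear_neg[OF linear(1)] linear_neg[OF linear(2)] linear_neg[OF linear(3)]
  show "H (E w) = E (H w) + cscale 2 (E w)" "H (F w) = F (H w) - cscale 2 (F w)" "E (F w) = F (E w) + H w"
    by (simp_all add: H_def E_def F_def lift2_def cscale_def prod_eq_iff l br algebra_simps flip: scaleR_2)
qed

lemma pairs_closed:
  "subspace (K \<times> K)" "w \<in> K \<times> K \<Longrightarrow> cscale c w \<in> K \<times> K" "w \<in> K \<times> K \<Longrightarrow> H w \<in> K \<times> K"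
  "w \<in> K \<times> K \<Longrightarrow> E w \<in> K \<times> K" "w \<in> K \<times> K \<Longrightarrow> F w \<in> K \<times> K"
proof -
  show 1: "subspace (K \<times> K)" by (intro subspace_Times K)
  show 2: "cscale c w \<in> K \<times> K" if "w \<in> K \<times> K" for c w
    using that by (auto simp: cscale_def K subspace_add subspace_diff subspace_scale)
  have "lift2 \<rho>1 w \<in> K \<times> K" "lift2 \<rho>2 w \<in> K \<times> K" "lift2 \<rho>3 w \<in> K \<times> K" if "w \<in> K \<times> K" for w
    using that by (auto simp: lift2_def K)
  then show "H w \<in> K \<times> K" "E w \<in> K \<times> K" "F w \<in> K \<times> K" if "w \<in> K \<times> K" for w
    using that unfolding H_def E_def F_def by (auto intro!: subspace_add[OF 1] subspace_diff[OF 1] 2)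
qed

lemma pairs_finite_span: "\<exists>C. finite C \<and> K \<times> K \<subseteq> span C"
proof -
  have l1: "linear (\<lambda>x::'v. (x, 0::'v))" and l2: "linear (\<lambda>x::'v. (0::'v, x))"
    by (rule linearI; simp)+
  let ?C = "(\<lambda>x. (x, 0)) ` B \<union> (\<lambda>x. (0, x)) ` B"
  have "span B \<subseteq> (\<lambda>x. (x, 0)) -` span ?C" "span B \<subseteq> (\<lambda>x. (0, x)) -` span ?C"
    by (rule span_minimal, blast intro: span_base, intro linear_subspace_vimage l1 l2 subspace_span)+
  then have "(x, 0) + (0, y) \<in> span ?C" if "x \<in> K" "y \<in> K" for x y
    using that B(2) by (intro span_add) auto
  then show ?thesis using B(1) by (intro exI[of _ ?C]) auto
qed

lemma weight_chain:
  assumes w: "w \<in> K \<times> K" "H w = cscale l w"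
  shows "H ((E ^^ k) w) = cscale (l + of_real (2 * real k)) ((E ^^ k) w)"
    "H ((F ^^ k) w) = cscale (l + of_real (- 2 * real k)) ((F ^^ k) w)"
    "(E ^^ k) w \<in> K \<times> K" "(F ^^ k) w \<in> K \<times> K"
proof -
  show "H ((E ^^ k) w) = cscale (l + of_real (2 * real k)) ((E ^^ k) w)"
  proof (induction k)
    case (Suc k)
    have "H ((E ^^ Suc k) w) = cscale ((l + of_real (2 * real k)) + 2) (E ((E ^^ k) w))"
      by (simp only: funpow.simps comp_apply HEF_commute Suc.IH HEF_cscale)
        (simp only: cvec.scale_left_distrib)
    then show ?case by (simp add: algebra_simps)
  qed (simp add: w)
  show "H ((F ^^ k) w) = cscale (l + of_real (- 2 * real k)) ((F ^^ k) w)"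
  proof (induction k)
    case (Suc k)
    have "H ((F ^^ Suc k) w) = cscale ((l + of_real (- 2 * real k)) - 2) (F ((F ^^ k) w))"
      by (simp only: funpow.simps comp_apply HEF_commute Suc.IH HEF_cscale)
        (simp only: cvec.scale_left_diff_distrib)
    then show ?case by (simp add: algebra_simps)
  qed (simp add: w)
  show "(E ^^ k) w \<in> K \<times> K" "(F ^^ k) w \<in> K \<times> K"
    by (induction k) (simp_all only: funpow.simps id_apply comp_apply w pairs_closed)
qed

lemma lowest_weight_vector_exists: "\<exists>w l. w \<in> K \<times> K \<and> w \<noteq> 0 \<and> H w = cscale l w \<and> F w = 0"
proof -
  obtain C where C: "finite C" "K \<times> K \<subseteq> span C" using pairs_finite_span by blast
  obtain x where x: "x \<in> K" "x \<noteq> 0" using nontrivial subspace_0[OF K(1)] by blast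
  then obtain w l where w: "w \<in> K \<times> K" "w \<noteq> 0" "H w = cscale l w"
    using eigenvector_exists[OF linear_HEF(1) HEF_cscale(1) pairs_closed(1,2,3) C, of "(x, 0)"] subspace_0[OF K(1)]
    by (auto simp: zero_prod_def)
  have "(F ^^ k) w \<in> span C" for k using weight_chain(4)[OF w(1,3)] C(2) by blast
  then have "\<exists>k. (F ^^ k) w = 0"
    by (intro eigenvector_chain_vanishes[OF linear_HEF(1) C(1) _ weight_chain(2)[OF w(1,3)]]) auto
  then obtain k where k: "(F ^^ k) w = 0" "\<And>j. j < k \<Longrightarrow> (F ^^ j) w \<noteq> 0"
    using exists_least_iff[of "\<lambda>k. (F ^^ k) w = 0"] by blast
  then have "k \<noteq> 0" using w(2) by (intro notI) simp
  then obtain j where j: "k = Suc j" by (cases k) auto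
  have "F ((F ^^ j) w) = 0" "(F ^^ j) w \<noteq> 0" using k j by auto
  then show ?thesis using weight_chain(2,4)[OF w(1,3)] by blast
qed

text \<open>Raising a lowest weight vector \<open>w\<close> gives a chain \<open>E\<^sup>k w\<close> that ends at some \<open>k = m\<close>, and then the weight of
  \<open>w\<close> is \<open>-m\<close>. The vectors \<open>(m - k)! E\<^sup>k w\<close> behave under \<open>H\<close>, \<open>E\<close>, \<open>F\<close> like the monomials \<open>t\<^sup>k\<close>, which
  gives a complex homomorphism \<open>\<Phi>\<close>. Its real part is nonzero, because the real part of \<open>\<Phi> (\<i> p)\<close> is
  minus the imaginary part of \<open>\<Phi> p\<close>.\<close>

lemma homomorphism_from_Sym:
  "\<exists>m \<psi>. linear \<psi> \<and> \<psi> ` Sym m \<subseteq> K \<and> (\<exists>p\<in>Sym m. \<psi> p \<noteq> 0) \<and>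
    (\<forall>p\<in>Sym m. \<psi> (rep m (so3_mat 1 0 0) p) = \<rho>1 (\<psi> p) \<and> \<psi> (rep m (so3_mat 0 1 0) p) = \<rho>2 (\<psi> p) \<and>
      \<psi> (rep m (so3_mat 0 0 1) p) = \<rho>3 (\<psi> p))"
proof -
  obtain w \<mu> where w: "w \<in> K \<times> K" "w \<noteq> 0" "H w = cscale \<mu> w" "F w = 0"
    using lowest_weight_vector_exists by blast
  obtain C where C: "finite C" "K \<times> K \<subseteq> span C" using pairs_finite_span by blast
  define v where "v k = (E ^^ k) w" for k
  have v_Suc: "E (v k) = v (Suc k)" and v0: "v 0 = w" for k by (simp_all add: v_def)
  have vK: "v k \<in> K \<times> K" for k unfolding v_def by (rule weight_chain(3)[OF w(1,3)])
  have Hv: "H (v k) = cscale (\<mu> + of_real (2 * real k)) (v k)" for k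
    unfolding v_def by (rule weight_chain(1)[OF w(1,3)])
  have Fv: "F (v (Suc k)) = cscale (- (of_nat (Suc k) * (\<mu> + of_nat k))) (v k)" for k
  proof (induction k)
    case 0
    have "F (E w) = - H w" using HEF_commute(3)[of w] w(4) linear_0[OF linear_HEF(2)] by (simp add: eq_neg_iff_add_eq_0)
    then show ?case by (simp add: v_Suc[symmetric] v0 w(3))
  next
    case (Suc k)
    have "F (v (Suc (Suc k))) = E (F (v (Suc k))) - H (v (Suc k))"
      using HEF_commute(3)[of "v (Suc k)"] by (simp add: v_Suc)
    also have "\<dots> = cscale (- (of_nat (Suc k) * (\<mu> + of_nat k)) - (\<mu> + of_real (2 * real (Suc k)))) (v (Suc k))"
      by (simp only: Suc.IH HEF_cscale v_Suc Hv cvec.scale_left_diff_distrib)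
    also have "- (of_nat (Suc k) * (\<mu> + of_nat k)) - (\<mu> + of_real (2 * real (Suc k))) =
        - (of_nat (Suc (Suc k)) * (\<mu> + of_nat (Suc k)))"
      by (simp add: algebra_simps)
    finally show ?case .
  qed
  have "v k \<in> span C" for k using vK C(2) by blast
  then have "\<exists>k. v k = 0"
    by (intro eigenvector_chain_vanishes[OF linear_HEF(1) C(1) _ Hv]) auto
  then obtain k where k: "v k = 0" "\<And>j. j < k \<Longrightarrow> v j \<noteq> 0"
    using exists_least_iff[of "\<lambda>k. v k = 0"] by blast
  then have "k \<noteq> 0" using w(2) v0 by (intro notI) simp
  then obtain m where m: "k = Suc m" by (cases k) auto
  have vm: "v m \<noteq> 0" "v (Suc m) = 0" using k m by auto
  have "cscale (- (of_nat (Suc m) * (\<mu> + of_nat m))) (v m) = 0"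
    using Fv[of m] vm(2) linear_0[OF linear_HEF(3)] by simp
  then have "of_nat (Suc m) * (\<mu> + of_nat m) = 0"
    using vm(1) by (simp only: cvec.scale_eq_0_iff neg_equal_0_iff_equal) auto
  then have \<mu>: "\<mu> = - of_nat m"
    by (simp only: mult_eq_0_iff of_nat_eq_0_iff) (simp add: eq_neg_iff_add_eq_0)
  define u where "u k = cscale (fact (m - k)) (v k)" for k
  have uK: "u k \<in> K \<times> K" for k unfolding u_def by (intro pairs_closed vK)
  have u_Suc_m: "u (Suc m) = 0" by (simp add: u_def vm)
  have Hu: "H (u k) = cscale (2 * of_nat k - of_nat m) (u k)" for k
    by (simp add: u_def HEF_cscale Hv \<mu> cvec.scale_scale algebra_simps)
  have Eu: "E (u k) = cscale (of_nat m - of_nat k) (u (Suc k))" if "k \<le> m" for k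
  proof (cases "k = m")
    case True
    then show ?thesis by (simp add: u_def HEF_cscale v_Suc vm)
  next
    case False
    then have "m - k = Suc (m - Suc k)" "of_nat m - of_nat k = (of_nat (m - k) :: complex)"
      using that by (auto simp: of_nat_diff)
    then show ?thesis by (simp add: u_def HEF_cscale v_Suc cvec.scale_scale mult.commute)
  qed
  have Fu: "F (u k) = cscale (of_nat k) (u (k - 1))" if "k \<le> m" for k
  proof (cases k)
    case 0
    then show ?thesis by (simp add: u_def HEF_cscale v0 w)
  next
    case (Suc j)
    then have "m - j = Suc (m - k)" "of_nat (m - j) = (of_nat m - of_nat j :: complex)"
      using that by (auto simp: of_nat_diff)
    then have "fact (m - j) = (of_nat m - of_nat j) * (fact (m - k) :: complex)"
      by (metis fact_Suc of_nat_fact of_nat_mult)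
    then have "fact (m - k) * - (of_nat (Suc j) * (\<mu> + of_nat j)) = of_nat k * (fact (m - j) :: complex)"
      by (simp add: \<mu> Suc) (simp add: algebra_simps)
    then show ?thesis
      by (simp only: u_def HEF_cscale Suc Fv cvec.scale_scale diff_Suc_1)
  qed
  define \<Phi> where "\<Phi> p = (\<Sum>k\<le>m. cscale (coeff p k) (u k))" for p
  have \<Phi>: "linear \<Phi>"
    unfolding \<Phi>_def
    by (rule linearI) (simp_all add: cvec.scale_left_distrib sum.distrib scaleR_sum_right cscale_scaleR(2) scaleR_conv_of_real)
  have \<Phi>_monom: "\<Phi> (monom c k) = cscale c (u k)" if "k \<le> Suc m" for c k
  proof (cases "k = Suc m")
    case True
    then show ?thesis by (simp add: \<Phi>_def u_Suc_m)
  next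
    case False
    then show ?thesis using that by (simp add: \<Phi>_def if_distrib[of "\<lambda>c. cscale c _"] cong: if_cong)
  qed
  have equiv: "\<Phi> (rep m (so3_mat a b c) p) = lift2 \<rho> (\<Phi> p)"
    if p: "p \<in> Sym m" and \<rho>: "linear \<rho>"
      and mon: "\<And>d k. k \<le> m \<Longrightarrow> \<Phi> (rep m (so3_mat a b c) (monom d k)) = lift2 \<rho> (\<Phi> (monom d k))"
    for p \<rho> a b c
  proof -
    have "\<Phi> (rep m (so3_mat a b c) (\<Sum>k\<le>m. monom (coeff p k) k)) = lift2 \<rho> (\<Phi> (\<Sum>k\<le>m. monom (coeff p k) k))"
      unfolding linear_sum[OF linear_rep] linear_sum[OF \<Phi>] linear_sum[OF linear_lift2[OF \<rho>]]
      by (intro sum.cong mon) auto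
    then show ?thesis using Sym_expand[OF p] by simp
  qed
  have 1: "\<Phi> (rep m (so3_mat 1 0 0) p) = lift2 \<rho>1 (\<Phi> p)" if "p \<in> Sym m" for p
  proof (rule equiv[OF that linear(1)])
    fix d k assume k: "k \<le> m"
    then show "\<Phi> (rep m (so3_mat 1 0 0) (monom d k)) = lift2 \<rho>1 (\<Phi> (monom d k))"
      by (simp add: rep1_monom linear_add[OF \<Phi>] \<Phi>_monom lift2_cscale linear lift_parts HEF_cscale Eu Fu
          cvec.scale_right_distrib cvec.scale_scale mult_ac)
  qed
  have 2: "\<Phi> (rep m (so3_mat 0 1 0) p) = lift2 \<rho>2 (\<Phi> p)" if "p \<in> Sym m" for p
  proof (rule equiv[OF that linear(2)])
    fix d k assume k: "k \<le> m"
    then show "\<Phi> (rep m (so3_mat 0 1 0) (monom d k)) = lift2 \<rho>2 (\<Phi> (monom d k))"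
      by (simp add: rep2_monom linear_add[OF \<Phi>] \<Phi>_monom lift2_cscale linear lift_parts HEF_cscale Eu Fu
          cvec.scale_right_diff_distrib cvec.scale_scale mult_ac)
  qed
  have 3: "\<Phi> (rep m (so3_mat 0 0 1) p) = lift2 \<rho>3 (\<Phi> p)" if "p \<in> Sym m" for p
  proof (rule equiv[OF that linear(3)])
    fix d k assume k: "k \<le> m"
    have e: "\<i> * of_real (weight m k) * d = d * (- \<i> / 2 * (2 * of_nat k - of_nat m))"
      by (simp add: weight_def field_simps)
    have "lift2 \<rho>3 (cscale d (u k)) = cscale d (cscale (- \<i> / 2) (cscale (2 * of_nat k - of_nat m) (u k)))"
      unfolding lift2_cscale[OF linear(3)] unfolding lift_parts Hu ..
    then show "\<Phi> (rep m (so3_mat 0 0 1) (monom d k)) = lift2 \<rho>3 (\<Phi> (monom d k))"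
      using k by (simp only: rep3_monom e \<Phi>_monom le_SucI cvec.scale_scale)
  qed
  have \<Phi>_in: "\<Phi> p \<in> K \<times> K" for p
    unfolding \<Phi>_def by (intro subspace_sum[OF pairs_closed(1)] pairs_closed(2) uK)
  define \<psi> where "\<psi> = (\<lambda>p. fst (\<Phi> p))"
  have lin: "linear \<psi>"
    unfolding \<psi>_def by (rule linearI) (simp_all add: linear_add[OF \<Phi>] linear_scale[OF \<Phi>])
  have nz: "\<exists>p\<in>Sym m. \<psi> p \<noteq> 0"
  proof -
    have "\<Phi> (monom d 0) = cscale (d * of_real (fact m)) w" for d
      unfolding \<Phi>_monom[OF le0] by (simp add: u_def v0 cvec.scale_scale)
    then have "\<psi> (monom 1 0) = fact m *\<^sub>R fst w" "\<psi> (monom \<i> 0) = - (fact m *\<^sub>R snd w)"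
      unfolding \<psi>_def by (simp_all only: cscale_def) simp_all
    then have "\<psi> (monom 1 0) \<noteq> 0 \<or> \<psi> (monom \<i> 0) \<noteq> 0"
      using w(2) by (auto simp: prod_eq_iff)
    then show ?thesis using monom_in_Sym[of 0 m] by blast
  qed
  have range: "\<psi> ` Sym m \<subseteq> K"
    unfolding \<psi>_def using \<Phi>_in by (auto simp: mem_Times_iff)
  show ?thesis
  proof (intro exI[of _ m] exI[of _ \<psi>] conjI ballI lin range nz)
    fix p assume p: "p \<in> Sym m"
    show "\<psi> (rep m (so3_mat 1 0 0) p) = \<rho>1 (\<psi> p)" "\<psi> (rep m (so3_mat 0 1 0) p) = \<rho>2 (\<psi> p)"
      "\<psi> (rep m (so3_mat 0 0 1) p) = \<rho>3 (\<psi> p)"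
      unfolding \<psi>_def by (simp_all add: 1 2 3 p lift2_def)
  qed
qed

end

section \<open>The structure of minimal solvable algebras\<close>

locale concrete_so3_algebra = lie_so3_algebra L for L :: "'v::real_vector so3_alg" (structure) +
  assumes concrete: "concrete L"
begin

lemmas ops = concreteD[OF concrete]
lemmas V = ops(1)

lemma sact_zero: "A \<in> so3 \<Longrightarrow> sact L A 0 = 0"
  using sact_smult[of A 0 0] subspace_0[OF V] by (simp add: ops)

lemma bracket_zero: "x \<in> carrier L \<Longrightarrow> 0 \<otimes> x = 0" "x \<in> carrier L \<Longrightarrow> x \<otimes> 0 = 0"
  using bracket_smult_left[of 0 x 0] bracket_smult_right[of x 0 0] subspace_0[OF V] by (simp_all add: ops)

lemma bracket_anticommute:
  assumes "x \<in> carrier L" "y \<in> carrier L" shows "x \<otimes> y = - (y \<otimes> x)"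
proof -
  have "(x + y) \<otimes> (x + y) = 0"
    using bracket_self[of "x + y"] subspace_add[OF V] assms by (simp add: ops)
  then have "x \<otimes> y + y \<otimes> x = 0"
    using assms bracket_add_left[of x y "x + y"] bracket_add_right[of _ x y] bracket_self subspace_add[OF V]
    by (simp add: ops add.commute)
  then show ?thesis by (simp add: eq_neg_iff_add_eq_0)
qed

lemma stable_complement:
  assumes H: "subspace H" "H \<subseteq> carrier L" "s_stable L H"
  shows "\<exists>K. subspace K \<and> K \<subseteq> carrier L \<and> s_stable L K \<and> H \<inter> K = {0} \<and>
    (\<forall>x\<in>carrier L. \<exists>h\<in>H. \<exists>k\<in>K. x = h + k)"
proof -
  obtain K where K: "subspace K" "K \<subseteq> carrier L" "s_stable L K" "H \<inter> K = {0}" "H <+> K = carrier L"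
    using completely_reducible[of H] H by (auto simp: concrete_vsubspace_iff[OF concrete] ops(2))
  have "\<exists>h\<in>H. \<exists>k\<in>K. x = h + k" if "x \<in> carrier L" for x
    using that unfolding K(5)[symmetric] set_add_def' ops by blast
  then show ?thesis using K by blast
qed

text \<open>Subalgebras of the form \<open>W + D\<close> with trivial action on \<open>D\<close> are the ones to which minimality is
  applied.\<close>

lemma stable_plus_invariants:
  assumes W: "subspace W" "W \<subseteq> carrier L" "s_stable L W"
    and D: "subspace D" "D \<subseteq> carrier L" "\<And>A d. A \<in> so3 \<Longrightarrow> d \<in> D \<Longrightarrow> sact L A d = 0"
  defines "M \<equiv> {w + d |w d. w \<in> W \<and> d \<in> D}"
  shows "subspace M" "M \<subseteq> carrier L" "s_stable L M" "W \<subseteq> M" "D \<subseteq> M"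
proof -
  show WM: "W \<subseteq> M" using subspace_0[OF D(1)] by (force simp: M_def)
  show "D \<subseteq> M" using subspace_0[OF W(1)] by (force simp: M_def)
  show "subspace M" unfolding M_def by (rule subspace_sums[OF W(1) D(1)])
  show "M \<subseteq> carrier L"
    using W(2) D(2) by (auto simp: M_def intro!: subspace_add[OF V])
  show "s_stable L M"
    unfolding s_stable_def
  proof (intro ballI)
    fix A x assume A: "A \<in> so3" and "x \<in> M"
    then obtain w d where wd: "w \<in> W" "d \<in> D" "x = w + d" by (auto simp: M_def)
    then have "sact L A x = sact L A w"
      using sact_add[OF A, of w d] W(2) D(2,3) A by (auto simp: ops subset_iff)
    then show "sact L A x \<in> M" using W(3) A wd WM by (auto simp: s_stable_def)
  qed
qed

lemma minimal_cases:
  assumes "minimal_so3 L" "subspace H" "H \<subseteq> carrier L" "\<And>x y. x \<in> H \<Longrightarrow> y \<in> H \<Longrightarrow> x \<otimes> y \<in> H"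
    "s_stable L H"
  shows "H = carrier L \<or> (\<forall>A\<in>so3. \<forall>x\<in>H. sact L A x = 0)"
  using assms unfolding minimal_so3_iff lie_subalgebra_def concrete_vsubspace_iff[OF concrete] ops(2) by blast

lemma minimal_moves: "minimal_so3 L \<Longrightarrow> \<exists>A\<in>so3. \<exists>x\<in>carrier L. sact L A x \<noteq> 0"
  unfolding minimal_so3_iff ops(2) by blast

end

text \<open>The shape of a minimal solvable algebra: an irreducible module \<open>K\<close> and a central subspace \<open>D\<close>
  spanned by \<open>[K, K]\<close> on which \<open>so\<^sub>3\<close> acts trivially.\<close>

locale irreducible_plus_centre = concrete_so3_algebra +
  fixes K D
  assumes K: "subspace K" "K \<subseteq> carrier L" "s_stable L K"
    and K_moves: "\<exists>A\<in>so3. \<exists>x\<in>K. sact L A x \<noteq> 0"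
    and K_irreducible: "\<And>W. subspace W \<Longrightarrow> W \<subseteq> K \<Longrightarrow> s_stable L W \<Longrightarrow> W = {0} \<or> W = K"
    and D: "D = span {x \<otimes> y |x y. x \<in> K \<and> y \<in> K}" "D \<subseteq> carrier L" "K \<inter> D = {0}"
    and K_plus_D: "\<forall>x\<in>carrier L. \<exists>k\<in>K. \<exists>d\<in>D. x = k + d"
    and D_invariant: "\<And>A d. A \<in> so3 \<Longrightarrow> d \<in> D \<Longrightarrow> sact L A d = 0"
    and D_central: "\<And>x d. x \<in> carrier L \<Longrightarrow> d \<in> D \<Longrightarrow> x \<otimes> d = 0 \<and> d \<otimes> x = 0"

context concrete_so3_algebra
begin

text \<open>\<open>D\<close> is the derived algebra. It is proper by solvability, so minimality forces the trivial action
  on it; the other properties of \<open>K\<close> and \<open>D\<close> come from complete reducibility, from minimality applied to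
  sums of a submodule of \<open>K\<close> and a subspace of \<open>D\<close>, and from irreducibility applied to centralizers
  in \<open>K\<close>.\<close>

lemma minimal_solvable_decomposition:
  assumes ms: "minimal_solvable_lie_so3 L"
  shows "\<exists>K D. irreducible_plus_centre L K D"
proof -
  let ?V = "carrier L"
  have min: "minimal_so3 L" using ms by (simp add: minimal_solvable_lie_so3_def)
  define D where "D = span {x \<otimes> y |x y. x \<in> ?V \<and> y \<in> ?V}"
  have DV: "D \<subseteq> ?V" unfolding D_def by (rule span_minimal[OF _ V]) (auto simp: bracket_closed)
  have D: "subspace D" by (simp add: D_def subspace_span)
  have brD: "x \<otimes> y \<in> D" if "x \<in> ?V" "y \<in> ?V" for x y
    using that unfolding D_def by (intro span_base) blast
  have "D \<noteq> ?V"
  proof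
    assume eq: "D = ?V"
    have "derived_lie L k = ?V" for k
    proof (induction k)
      case (Suc k)
      have "{x \<otimes> y |x y. x \<in> ?V \<and> y \<in> ?V} \<subseteq> ?V" by (auto simp: bracket_closed)
      then show ?case using eq by (simp add: Suc concrete_lin_span[OF concrete] D_def)
    qed simp
    then have "?V = {0}"
      using ms by (auto simp: minimal_solvable_lie_so3_def solvable_lie_def ops)
    then show False using minimal_moves[OF min] sact_closed by auto
  qed
  have "s_stable L D"
    unfolding s_stable_def
  proof (intro ballI)
    fix A d assume A: "A \<in> so3" and d: "d \<in> D"
    have "D \<subseteq> {d \<in> ?V. sact L A d \<in> D}"
      unfolding D_def
    proof (rule span_minimal)
      show "{x \<otimes> y |x y. x \<in> ?V \<and> y \<in> ?V} \<subseteq> {d \<in> ?V. sact L A d \<in> span {x \<otimes> y |x y. x \<in> ?V \<and> y \<in> ?V}}"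
        unfolding D_def[symmetric]
        using A by (auto simp: bracket_closed sact_derivation sact_closed ops intro!: subspace_add[OF D] brD)
      show "subspace {d \<in> ?V. sact L A d \<in> span {x \<otimes> y |x y. x \<in> ?V \<and> y \<in> ?V}}"
        unfolding D_def[symmetric]
        using sact_add[OF A] sact_smult[OF A]
        by (intro subspaceI) (simp_all add: ops sact_zero A subspace_0 subspace_add subspace_scale V D)
    qed
    then show "sact L A d \<in> D" using d by blast
  qed
  then have "D = ?V \<or> (\<forall>A\<in>so3. \<forall>d\<in>D. sact L A d = 0)"
    using brD DV by (intro minimal_cases[OF min D DV]) (simp_all add: subset_iff)
  then have actD: "sact L A d = 0" if "A \<in> so3" "d \<in> D" for A d
    using \<open>D \<noteq> ?V\<close> that by blast
  obtain K where K: "subspace K" "K \<subseteq> ?V" "s_stable L K" "D \<inter> K = {0}" "\<forall>x\<in>?V. \<exists>d\<in>D. \<exists>k\<in>K. x = d + k"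
    using stable_complement[OF D DV \<open>s_stable L D\<close>] by (elim exE conjE) (rule that)
  have actK: "sact L A k \<in> K" if "A \<in> so3" "k \<in> K" for A k using K(3) that by (simp add: s_stable_def)
  have movedK: "\<exists>A\<in>so3. \<exists>x\<in>K. sact L A x \<noteq> 0"
  proof -
    obtain A x where A: "A \<in> so3" "x \<in> ?V" "sact L A x \<noteq> 0" using minimal_moves[OF min] by blast
    obtain d k where dk: "d \<in> D" "k \<in> K" "x = d + k" using bspec[OF K(5) A(2)] by blast
    then have "sact L A x = sact L A d + sact L A k"
      using sact_add[OF A(1), of d k] DV K(2) by (auto simp: ops)
    then show ?thesis using A dk actD by auto
  qed
  \<comment> \<open>\<open>W + D\<close> is a stable subalgebra that is moved, hence everything.\<close>
  have big: "W = K" if W: "subspace W" "W \<subseteq> K" "s_stable L W" and moved: "\<exists>A\<in>so3. \<exists>x\<in>W. sact L A x \<noteq> 0" for W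
  proof -
    let ?M = "{w + d |w d. w \<in> W \<and> d \<in> D}"
    have WV: "W \<subseteq> ?V" using W(2) K(2) by blast
    note M = stable_plus_invariants[OF W(1) WV W(3) D DV actD]
    have "x \<otimes> y \<in> ?M" if "x \<in> ?M" "y \<in> ?M" for x y
      using brD[of x y] subsetD[OF M(2)] subsetD[OF M(5)] that by simp
    then have "?M = ?V"
      using minimal_cases[OF min M(1,2) _ M(3)] moved M(4) by blast
    have "K \<subseteq> W"
    proof
      fix k assume k: "k \<in> K"
      then have "k \<in> ?M" using \<open>?M = ?V\<close> K(2) by blast
      then obtain w d where wd: "w \<in> W" "d \<in> D" "k = w + d" by auto
      then have "d \<in> D \<inter> K" using k W(2) subspace_diff[OF K(1), of k w] by (auto simp: subset_iff)
      then show "k \<in> W" using wd K(4) by auto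
    qed
    then show ?thesis using W(2) by blast
  qed
  have irred: "W = {0} \<or> W = K" if W: "subspace W" "W \<subseteq> K" "s_stable L W" for W
  proof (cases "\<exists>A\<in>so3. \<exists>x\<in>W. sact L A x \<noteq> 0")
    case True
    then show ?thesis using big[OF W] by blast
  next
    \<comment> \<open>A complement of \<open>W\<close> meets \<open>K\<close> in a submodule that is moved, so it contains \<open>K\<close>.\<close>
    case False
    have "W \<subseteq> ?V" using W(2) K(2) by blast
    from stable_complement[OF W(1) this W(3)]
    obtain U where U: "subspace U" "U \<subseteq> ?V" "s_stable L U" "W \<inter> U = {0}" "\<forall>x\<in>?V. \<exists>w\<in>W. \<exists>u\<in>U. x = w + u"
      by (elim exE conjE) (rule that)
    obtain A x where A: "A \<in> so3" "x \<in> K" "sact L A x \<noteq> 0" using movedK by blast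
    obtain w u where wu: "w \<in> W" "u \<in> U" "x = w + u" using bspec[OF U(5) subsetD[OF K(2) A(2)]] by blast
    have "u \<in> K" using wu A(2) W(2) subspace_diff[OF K(1), of x w] by (auto simp: subset_iff)
    have "sact L A x = sact L A w + sact L A u"
      using sact_add[OF A(1), of w u] wu W(2) K(2) U(2) by (auto simp: ops subset_iff)
    then have "sact L A u \<noteq> 0" using False A wu(1) by auto
    then have "U \<inter> K = K"
      using U K A(1) wu(2) \<open>u \<in> K\<close>
      by (intro big) (auto simp: s_stable_def intro: subspace_inter)
    then have "W = {0}" using U(4) W(2) subspace_0[OF W(1)] by blast
    then show ?thesis by blast
  qed
  \<comment> \<open>\<open>so3\<close> kills \<open>k \<otimes> d\<close> and \<open>d\<close>, hence also \<open>(A k) \<otimes> d\<close>: the centralizer of \<open>d\<close> in \<open>K\<close> is a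
    nonzero submodule.\<close>
  have KD: "k \<otimes> d = 0" if k: "k \<in> K" and d: "d \<in> D" for k d
  proof -
    have dV: "d \<in> ?V" using d DV by blast
    let ?W = "{x \<in> K. x \<otimes> d = 0}"
    have act_in: "sact L A x \<otimes> d = 0" if "A \<in> so3" "x \<in> K" for A x
    proof -
      have xV: "x \<in> ?V" using that K(2) by blast
      have "sact L A (x \<otimes> d) = sact L A x \<otimes> d + x \<otimes> sact L A d"
        using sact_derivation[OF that(1) xV dV] by (simp add: ops)
      then show ?thesis using actD[OF that(1)] d brD[OF xV dV] bracket_zero[OF xV] by simp
    qed
    have "subspace ?W"
    proof (rule subspaceI)
      show "0 \<in> ?W" using subspace_0[OF K(1)] bracket_zero[OF dV] by simp
      show "x + y \<in> ?W" if "x \<in> ?W" "y \<in> ?W" for x y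
        using that bracket_add_left[of x y d] dV K(2) subspace_add[OF K(1)] by (auto simp: ops subset_iff)
      show "r *\<^sub>R x \<in> ?W" if "x \<in> ?W" for r x
        using that bracket_smult_left[of x d r] dV K(2) subspace_scale[OF K(1)] by (auto simp: ops subset_iff)
    qed
    moreover have "s_stable L ?W"
      unfolding s_stable_def using act_in actK by blast
    moreover have "?W \<noteq> {0}" using movedK act_in actK by blast
    ultimately have "?W = K" using irred[of ?W] by blast
    then show ?thesis using k by blast
  qed
  \<comment> \<open>By the Jacobi identity \<open>D\<close> centralizes \<open>D'\<close>, which makes \<open>K + D'\<close> a subalgebra below.\<close>
  define D' where "D' = span {x \<otimes> y |x y. x \<in> K \<and> y \<in> K}"
  have D'D: "D' \<subseteq> D"
    unfolding D'_def using K(2) brD by (intro span_minimal D) blast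
  have D': "subspace D'" by (simp add: D'_def subspace_span)
  have DD': "d \<otimes> e = 0" if d: "d \<in> D" and e: "e \<in> D'" for d e
  proof -
    have dV: "d \<in> ?V" using d DV by blast
    have "D' \<subseteq> {e \<in> ?V. d \<otimes> e = 0}"
      unfolding D'_def
    proof (rule span_minimal)
      show "{x \<otimes> y |x y. x \<in> K \<and> y \<in> K} \<subseteq> {e \<in> ?V. d \<otimes> e = 0}"
      proof
        fix e assume "e \<in> {x \<otimes> y |x y. x \<in> K \<and> y \<in> K}"
        then obtain x y where xy: "x \<in> K" "y \<in> K" "e = x \<otimes> y" by blast
        then have xyV: "x \<in> ?V" "y \<in> ?V" using K(2) by blast+
        have "d \<otimes> x = 0" using bracket_anticommute[OF dV xyV(1)] KD[OF xy(1) d] by simp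
        then have "d \<otimes> (x \<otimes> y) = 0"
          using jacobi[OF dV xyV] KD[OF xy(2) d] bracket_zero xyV by (simp add: ops)
        then show "e \<in> {e \<in> ?V. d \<otimes> e = 0}" using xy(3) xyV by (simp add: bracket_closed)
      qed
      show "subspace {e \<in> ?V. d \<otimes> e = 0}"
        using bracket_add_right[OF dV] bracket_smult_right[OF dV]
        by (intro subspaceI) (simp_all add: ops bracket_zero dV subspace_0 subspace_add subspace_scale V)
    qed
    then show ?thesis using e by blast
  qed
  \<comment> \<open>\<open>K + D'\<close> is a stable subalgebra that is moved, hence everything.\<close>
  have "D = D'"
  proof
    let ?M = "{k + d |k d. k \<in> K \<and> d \<in> D'}"
    have D'V: "D' \<subseteq> ?V" using D'D DV by blast
    note M = stable_plus_invariants[OF K(1-3) D' D'V actD[OF _ subsetD[OF D'D]]]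
    have "x \<otimes> y \<in> ?M" if "x \<in> ?M" "y \<in> ?M" for x y
    proof -
      obtain k d where kd: "k \<in> K" "d \<in> D'" "x = k + d" using \<open>x \<in> ?M\<close> by auto
      obtain j e where je: "j \<in> K" "e \<in> D'" "y = j + e" using \<open>y \<in> ?M\<close> by auto
      have in_V: "k \<in> ?V" "d \<in> ?V" "j \<in> ?V" "e \<in> ?V" using kd je K(2) D'V by blast+
      have zero: "k \<otimes> e = 0" "d \<otimes> j = 0" "d \<otimes> e = 0"
        using KD[of k e] KD[of j d] DD'[of d e] bracket_anticommute[of d j] kd je D'D in_V by auto
      have "x \<otimes> y = k \<otimes> j"
        using bracket_add_left[of k d "j + e"] bracket_add_right[of k j e] bracket_add_right[of d j e] in_V zero subspace_add[OF V]
        by (simp add: ops kd(3) je(3))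
      also have "k \<otimes> j \<in> D'" unfolding D'_def using kd je by (intro span_base) blast
      finally show ?thesis using M(5) by blast
    qed
    then have "?M = ?V" using minimal_cases[OF min M(1,2) _ M(3)] movedK M(4) by blast
    show "D \<subseteq> D'"
    proof
      fix d assume d: "d \<in> D"
      then have "d \<in> ?M" using \<open>?M = ?V\<close> DV by blast
      then obtain k e where ke: "k \<in> K" "e \<in> D'" "d = k + e" by auto
      then have "k \<in> D \<inter> K" using d D'D subspace_diff[OF D, of d e] by (auto simp: subset_iff)
      then show "d \<in> D'" using ke K(4) by auto
    qed
  qed (rule D'D)
  have central: "x \<otimes> d = 0 \<and> d \<otimes> x = 0" if x: "x \<in> ?V" and d: "d \<in> D" for x d
  proof -
    obtain e k where ek: "e \<in> D" "k \<in> K" "x = e + k" using bspec[OF K(5) x] by blast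
    have in_V: "e \<in> ?V" "k \<in> ?V" "d \<in> ?V" using ek d DV K(2) by blast+
    have "x \<otimes> d = 0"
      using bracket_add_left[of e k d] in_V KD[OF ek(2) d] DD'[OF ek(1), of d] d \<open>D = D'\<close> by (simp add: ops ek(3))
    then show ?thesis using bracket_anticommute[OF in_V(3) x] by simp
  qed
  have "irreducible_plus_centre L K D"
  proof
    show "\<forall>x\<in>?V. \<exists>k\<in>K. \<exists>d\<in>D. x = k + d"
      using K(5) by (metis add.commute)
    show "D = span {x \<otimes> y |x y. x \<in> K \<and> y \<in> K}" using \<open>D = D'\<close> by (simp add: D'_def)
  qed (use K movedK irred DV actD central in \<open>auto simp: Int_commute\<close>)
  then show ?thesis by blast
qed

end

context irreducible_plus_centre
begin

definition intertwiner :: "nat \<Rightarrow> (complex poly \<Rightarrow> 'a) \<Rightarrow> bool" where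
  "intertwiner m \<theta> \<longleftrightarrow> linear \<theta> \<and> \<theta> ` Sym m \<subseteq> K \<and>
    (\<forall>A\<in>so3. \<forall>p\<in>Sym m. \<theta> (rep m A p) = sact L A (\<theta> p))"

lemma intertwinerD:
  assumes "intertwiner m \<theta>"
  shows "linear \<theta>" "\<And>p. p \<in> Sym m \<Longrightarrow> \<theta> p \<in> K" "\<And>p. p \<in> Sym m \<Longrightarrow> \<theta> p \<in> carrier L"
    "\<And>A p. A \<in> so3 \<Longrightarrow> p \<in> Sym m \<Longrightarrow> \<theta> (rep m A p) = sact L A (\<theta> p)"
  using assms K(2) by (auto simp: intertwiner_def)

lemma intertwiner_surj:
  assumes \<theta>: "intertwiner m \<theta>" and U: "stable m U" "U \<subseteq> Sym m" and nz: "\<exists>p\<in>U. \<theta> p \<noteq> 0"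
  shows "\<theta> ` U = K"
proof -
  note D = intertwinerD[OF \<theta>]
  have "subspace (\<theta> ` U)"
    using U(1) by (intro linear_subspace_image[OF D(1)]) (simp add: stable_def)
  moreover have "s_stable L (\<theta> ` U)"
    unfolding s_stable_def
  proof (intro ballI)
    fix A x assume A: "A \<in> so3" and "x \<in> \<theta> ` U"
    then obtain p where p: "p \<in> U" "x = \<theta> p" by blast
    then have "sact L A x = \<theta> (rep m A p)" "rep m A p \<in> U" using D(4)[OF A] U A by (auto simp: stable_def)
    then show "sact L A x \<in> \<theta> ` U" by (rule image_eqI)
  qed
  moreover have "\<theta> ` U \<subseteq> K" using D(2) U(2) by blast
  ultimately show ?thesis using K_irreducible nz by blast
qed

lemma intertwiner_kernel_stable:
  assumes \<theta>: "intertwiner m \<theta>" and U: "stable m U" "U \<subseteq> Sym m"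
  shows "stable m {p \<in> U. \<theta> p = 0}"
proof -
  note D = intertwinerD[OF \<theta>]
  have "subspace U" "\<And>A p. A \<in> so3 \<Longrightarrow> p \<in> U \<Longrightarrow> rep m A p \<in> U" "\<And>p. p \<in> U \<Longrightarrow> p \<in> Sym m"
    using U by (auto simp: stable_def)
  then show ?thesis
    unfolding stable_def
    by (auto intro!: subspaceI simp: subspace_0 subspace_add subspace_scale linear_0[OF D(1)]
        linear_add[OF D(1)] linear_scale[OF D(1)] D(4) sact_zero)
qed

lemma intertwiner_nonzero:
  assumes "\<theta> ` U = K" shows "\<exists>p\<in>U. \<theta> p \<noteq> 0"
proof -
  obtain A x where "A \<in> so3" "x \<in> K" "sact L A x \<noteq> 0" using K_moves by blast
  then have "x \<noteq> 0" using sact_zero by auto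
  then show ?thesis using \<open>x \<in> K\<close> assms by blast
qed

text \<open>The bracket of \<open>K\<close> takes values in \<open>D\<close>, where \<open>so\<^sub>3\<close> acts trivially, so the derivation rule says
  that it is invariant.\<close>

lemma intertwiner_bracket_form:
  assumes \<theta>: "intertwiner m \<theta>"
  shows "alt_inv_form m (Sym m) (\<lambda>p q. \<theta> p \<otimes> \<theta> q)"
proof -
  note T = intertwinerD[OF \<theta>]
  have "sact L A (\<theta> p) \<otimes> \<theta> q + \<theta> p \<otimes> sact L A (\<theta> q) = 0" if A: "A \<in> so3" and pq: "p \<in> Sym m" "q \<in> Sym m" for A p q
  proof -
    have "\<theta> p \<otimes> \<theta> q \<in> D" unfolding D(1) using T(2) pq by (intro span_base) blast
    then show ?thesis
      using sact_derivation[OF A T(3) T(3), OF pq] D_invariant[OF A] by (simp add: ops)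
  qed
  then show ?thesis
    unfolding alt_inv_form_def
    using bracket_add_left[OF T(3) T(3) T(3)] bracket_add_right[OF T(3) T(3) T(3)]
      bracket_smult_left[OF T(3) T(3)] bracket_smult_right[OF T(3) T(3)] bracket_self[OF T(3)]
    by (simp add: linear_add[OF T(1)] linear_scale[OF T(1)] T(4) ops)
qed

lemma intertwiner_exists:
  assumes B: "finite B" "K \<subseteq> span B"
  shows "\<exists>m \<psi>. m \<ge> 1 \<and> intertwiner m \<psi> \<and> \<psi> ` Sym m = K"
proof -
  have KL: "x \<in> carrier L" if "x \<in> K" for x using that K(2) by blast
  have act_K: "sact L A x \<in> K" if "A \<in> so3" "x \<in> K" for A x
    using that K(3) by (simp add: s_stable_def)
  obtain A0 x0 where moved: "A0 \<in> so3" "x0 \<in> K" "sact L A0 x0 \<noteq> 0" using K_moves by blast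
  \<comment> \<open>A linear projection \<open>g\<close> onto \<open>K\<close> turns the action, which is linear on \<open>K\<close> only, into maps
    that are linear everywhere.\<close>
  obtain g where g: "range g \<subseteq> K" "linear g" "\<forall>v\<in>K. g v = v"
    using linear_exists_left_inverse_on[OF linear_id K(1)] by auto
  have gK: "g x \<in> K" for x using g(1) by blast
  define \<rho> where "\<rho> A x = sact L A (g x)" for A x
  have \<rho>K: "\<rho> A x = sact L A x" if "x \<in> K" for A x using g(3) that by (simp add: \<rho>_def)
  have \<rho>_in: "\<rho> A x \<in> K" if "A \<in> so3" for A x using that gK by (simp add: \<rho>_def act_K)
  have lin: "linear (\<rho> A)" if A: "A \<in> so3" for A
    using sact_add[OF A] sact_smult[OF A] KL[OF gK]
    by (intro linearI) (simp_all add: \<rho>_def linear_add[OF g(2)] linear_scale[OF g(2)] ops)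
  have comm: "\<rho> A (\<rho> C x) - \<rho> C (\<rho> A x) = \<rho> (A ** C - C ** A) x" if "A \<in> so3" "C \<in> so3" for A C x
    using that sact_commutator[OF that, of "g x"] g(3) KL[OF gK] act_K gK
    by (simp add: \<rho>_def concrete_minus[OF concrete] sact_closed)
  let ?R1 = "so3_mat 1 0 0" and ?R2 = "so3_mat 0 1 0" and ?R3 = "so3_mat 0 0 1"
  interpret so3_rep "\<rho> ?R1" "\<rho> ?R2" "\<rho> ?R3" K B
  proof
    show "K \<noteq> {0}" using moved sact_zero by auto
  qed (simp_all add: linear_add[OF lin] linear_scale[OF lin] so3_mat_in_so3 comm so3_brackets K(1) B \<rho>_in)
  obtain m \<psi> where \<psi>: "linear \<psi>" "\<psi> ` Sym m \<subseteq> K" "\<exists>p\<in>Sym m. \<psi> p \<noteq> 0"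
    "\<And>p. p \<in> Sym m \<Longrightarrow> \<psi> (rep m ?R1 p) = \<rho> ?R1 (\<psi> p)"
    "\<And>p. p \<in> Sym m \<Longrightarrow> \<psi> (rep m ?R2 p) = \<rho> ?R2 (\<psi> p)"
    "\<And>p. p \<in> Sym m \<Longrightarrow> \<psi> (rep m ?R3 p) = \<rho> ?R3 (\<psi> p)"
    using homomorphism_from_Sym by blast
  have equiv: "\<psi> (rep m A p) = sact L A (\<psi> p)" if A: "A \<in> so3" and p: "p \<in> Sym m" for A p
  proof -
    obtain a b d where Aeq: "A = a *\<^sub>R ?R1 + b *\<^sub>R ?R2 + d *\<^sub>R ?R3"
      using so3_matE[OF A] so3_mat_decomp by metis
    have \<psi>p: "\<psi> p \<in> K" using \<psi>(2) p by blast
    have in_so3: "a *\<^sub>R ?R1 \<in> so3" "b *\<^sub>R ?R2 \<in> so3" "d *\<^sub>R ?R3 \<in> so3" "a *\<^sub>R ?R1 + b *\<^sub>R ?R2 \<in> so3"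
      by (intro subspace_add[OF subspace_so3] subspace_scale[OF subspace_so3] so3_mat_in_so3)+
    have "sact L A (\<psi> p) = a *\<^sub>R sact L ?R1 (\<psi> p) + b *\<^sub>R sact L ?R2 (\<psi> p) + d *\<^sub>R sact L ?R3 (\<psi> p)"
      unfolding Aeq using in_so3 KL[OF \<psi>p]
      by (simp add: sact_plus sact_scaleR so3_mat_in_so3 ops)
    also have "\<dots> = \<psi> (rep m A p)"
      unfolding Aeq rep_plus_left rep_scaleR_left linear_add[OF \<psi>(1)] linear_scale[OF \<psi>(1)]
      by (simp add: \<psi>(4,5,6)[OF p] \<rho>K[OF \<psi>p])
    finally show ?thesis by simp
  qed
  then have int: "intertwiner m \<psi>" using \<psi>(1,2) by (simp add: intertwiner_def)
  then have surj: "\<psi> ` Sym m = K" using intertwiner_surj[OF int stable_Sym subset_refl] \<psi>(3) by blast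
  have "m \<noteq> 0"
  proof
    assume m: "m = 0"
    have "rep m A p = 0" if "p \<in> Sym m" for A p
    proof (rule poly_eqI)
      fix k
      have "coeff p (Suc j) = 0" for j using that m by (simp add: Sym_iff)
      then show "coeff (rep m A p) k = coeff 0 k"
        using m by (cases k; cases "k - 1") (simp_all add: coeff_rep)
    qed
    then have "sact L A0 x0 = 0"
      using moved(1,2) surj equiv linear_0[OF \<psi>(1)] by (metis (no_types, lifting) imageE)
    then show False using moved(3) by simp
  qed
  then show ?thesis using int surj by (intro exI[of _ m] exI[of _ \<psi>]) simp
qed

text \<open>The bracket is a linear function \<open>T\<close> of \<open>form m\<close>, so \<open>(p, z) \<mapsto> \<psi> p + T z\<close> is a homomorphism from the
  universal algebra; its kernel is \<open>{0} \<times> ker T\<close> because \<open>K\<close> and \<open>D\<close> meet in zero.\<close>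

lemma isomorphic_heis_model:
  assumes m: "odd m" and \<psi>: "intertwiner m \<psi>" "\<psi> ` Sym m = K"
  shows "\<exists>P. linear P \<and> (\<forall>z. P (P z) = P z) \<and> so3_isomorphic (heis_model m P) L"
proof -
  note \<psi>D = intertwinerD[OF \<psi>(1)]
  have ker: "{p \<in> Sym m. \<psi> p = 0} = {0}"
    using Sym_odd_irreducible[OF intertwiner_kernel_stable[OF \<psi>(1) stable_Sym subset_refl] _ _ m]
      intertwiner_nonzero[OF \<psi>(2)] by blast
  define T where "T z = \<psi> (monom 1 m) \<otimes> \<psi> (dual_vec m z)" for z
  have v: "monom 1 m \<in> Sym m" by (simp add: monom_in_Sym)
  note \<omega> = intertwiner_bracket_form[OF \<psi>(1)]
  have T: "linear T"
    unfolding T_def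
    using alt_inv_formD(2,4)[OF \<omega>] v dual_vec_in_Sym
    by (intro linearI) (simp_all add: linear_add[OF linear_dual_vec] linear_scale[OF linear_dual_vec])
  have br: "\<psi> p \<otimes> \<psi> q = T (form m p q)" if "p \<in> Sym m" "q \<in> Sym m" for p q
    unfolding T_def by (rule alt_inv_form_classification[OF \<omega> m that])
  have TD: "T z \<in> D" for z
    unfolding T_def D(1) using \<psi>D(2) v dual_vec_in_Sym by (intro span_base) blast
  have DT: "D \<subseteq> range T"
    unfolding D(1)
  proof (rule span_minimal)
    show "subspace (range T)" by (rule linear_subspace_image[OF T subspace_UNIV])
    show "{x \<otimes> y |x y. x \<in> K \<and> y \<in> K} \<subseteq> range T"
      unfolding \<psi>(2)[symmetric] using br by auto
  qed
  have TV: "T z \<in> carrier L" for z using TD D(2) by blast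
  obtain P where P: "linear P" "\<And>z. P (P z) = P z" "{z. P z = 0} = {z. T z = 0}"
    using idempotent_with_kernel_exists[OF linear_subspace_kernel[OF T]] by blast
  let ?F = "\<lambda>x. \<psi> (fst x) + T (snd x)"
  have "so3_alg_iso ?F (heis_model m P) L"
  proof (rule heis_model_recognition[OF m P(1,2)])
    show "?F ` (Sym m \<times> UNIV) = carrier L"
    proof
      show "?F ` (Sym m \<times> UNIV) \<subseteq> carrier L" using \<psi>D(3) TV by (auto intro!: subspace_add[OF V])
      show "carrier L \<subseteq> ?F ` (Sym m \<times> UNIV)"
      proof
        fix x assume "x \<in> carrier L"
        then obtain k d where kd: "k \<in> K" "d \<in> D" "x = k + d" using K_plus_D by blast
        obtain p where p: "p \<in> Sym m" "k = \<psi> p" using kd(1) \<psi>(2) by blast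
        obtain z where z: "d = T z" using kd(2) DT by blast
        have "x = ?F (p, z)" "(p, z) \<in> Sym m \<times> UNIV" using kd p z by simp_all
        then show "x \<in> ?F ` (Sym m \<times> UNIV)" by (rule image_eqI)
      qed
    qed
    fix x :: "complex poly \<times> (real \<times> complex)" assume "x \<in> Sym m \<times> UNIV"
    then have x: "fst x \<in> Sym m" by auto
    show "?F (rep m A (fst x), 0) = sact L A (?F x)" if "A \<in> so3" for A
      using sact_add[OF that \<psi>D(3)[OF x] TV] D_invariant[OF that TD] x
      by (simp add: \<psi>D(4)[OF that x] linear_0[OF T] ops)
    show "?F x = \<zero> \<longleftrightarrow> fst x = 0 \<and> P (snd x) = 0"
    proof
      assume "?F x = \<zero>"
      then have eq: "\<psi> (fst x) = - T (snd x)" by (simp add: ops eq_neg_iff_add_eq_0)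
      have "subspace D" unfolding D(1) by (rule subspace_span)
      then have "\<psi> (fst x) \<in> K \<inter> D" using \<psi>D(2)[OF x] TD[of "snd x"] by (simp add: eq subspace_neg)
      then have "\<psi> (fst x) = 0" using D(3) by blast
      then show "fst x = 0 \<and> P (snd x) = 0" using eq ker x P(3) by auto
    next
      assume "fst x = 0 \<and> P (snd x) = 0"
      then show "?F x = \<zero>" using P(3) by (auto simp: ops linear_0[OF \<psi>D(1)])
    qed
    fix y :: "complex poly \<times> (real \<times> complex)" assume "y \<in> Sym m \<times> UNIV"
    then have y: "fst y \<in> Sym m" by auto
    note yV = subspace_add[OF V \<psi>D(3)[OF y] TV]
    show "?F (0, form m (fst x) (fst y)) = ?F x \<otimes> ?F y"
      using bracket_add_left[OF \<psi>D(3)[OF x] TV yV] bracket_add_right[OF \<psi>D(3)[OF x] \<psi>D(3)[OF y] TV]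
        D_central[OF \<psi>D(3)[OF x] TD] D_central[OF yV TD]
      by (simp add: ops linear_0[OF \<psi>D(1)] br[OF x y])
  qed (simp_all add: ops linear_add[OF \<psi>D(1)] linear_add[OF T] linear_scale[OF \<psi>D(1)] linear_scale[OF T]
      linear_0[OF \<psi>D(1)] linear_0[OF T] scaleR_add_right)
  then have "so3_isomorphic (heis_model m P) L" by (rule so3_alg_iso.isomorphic)
  then show ?thesis using P(1,2) by blast
qed

text \<open>\<open>Sym (2 n)\<close> is the sum of the carrier of \<open>d_real n\<close> and \<open>\<i>\<close> times it, so \<open>\<psi>\<close> or \<open>p \<mapsto> \<psi> (\<i> p)\<close> is
  nonzero on that carrier.\<close>

lemma intertwiner_on_d_real_exists:
  assumes \<psi>: "intertwiner (2 * n) \<psi>" "\<psi> ` Sym (2 * n) = K"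
  shows "\<exists>\<theta>. intertwiner (2 * n) \<theta> \<and> (\<exists>p\<in>carrier (d_real n). \<theta> p \<noteq> 0)"
proof (rule ccontr)
  let ?U = "carrier (d_real n)"
  note D = intertwinerD[OF \<psi>(1)]
  define \<psi>i where "\<psi>i p = \<psi> (Polynomial.smult \<i> p)" for p
  have sm: "Polynomial.smult \<i> (r *\<^sub>R p) = r *\<^sub>R Polynomial.smult \<i> p" for r p
    by (rule poly_eqI) simp
  have "linear \<psi>i"
    unfolding \<psi>i_def by (intro linearI) (simp_all add: smult_add_right sm linear_add[OF D(1)] linear_scale[OF D(1)])
  then have \<psi>i: "intertwiner (2 * n) \<psi>i"
    unfolding intertwiner_def using D(2,4) by (auto simp: \<psi>i_def smult_in_Sym simp flip: rep_smult)
  assume no: "\<not> ?thesis"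
  then have zero: "\<And>p. p \<in> ?U \<Longrightarrow> \<psi> p = 0" "\<And>p. p \<in> ?U \<Longrightarrow> \<psi>i p = 0"
    using \<psi>(1) \<psi>i by blast+
  obtain p where p: "p \<in> Sym (2 * n)" "\<psi> p \<noteq> 0" using intertwiner_nonzero[OF \<psi>(2)] by blast
  then have "p \<in> carrier (d_complex (2 * n + 1))" by (simp add: d_complex_def Sym_def)
  then obtain q r where "q \<in> ?U" "r \<in> ?U" "p = q + Polynomial.smult \<i> r"
    using d_real_complexification[of p n] by auto
  then have "\<psi> p = 0" using zero by (simp add: linear_add[OF D(1)] \<psi>i_def)
  then show False using p(2) by simp
qed

lemma isomorphic_d_real:
  assumes n: "n \<ge> 1" and \<psi>: "intertwiner (2 * n) \<psi>" "\<psi> ` Sym (2 * n) = K"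
  shows "so3_isomorphic (d_real n) L"
proof -
  let ?U = "carrier (d_real n)"
  have U: "stable (2 * n) ?U" "?U \<subseteq> Sym (2 * n)" using stable_d_real[of n] by (auto simp: d_real_carrier)
  then have subU: "subspace ?U" by (simp add: stable_def)
  obtain \<theta> where \<theta>: "intertwiner (2 * n) \<theta>" "\<exists>p\<in>?U. \<theta> p \<noteq> 0"
    using intertwiner_on_d_real_exists[OF \<psi>] by blast
  note D' = intertwinerD[OF \<theta>(1)]
  have \<theta>U: "\<theta> ` ?U = K" by (rule intertwiner_surj[OF \<theta>(1) U \<theta>(2)])
  have ker: "{p \<in> ?U. \<theta> p = 0} = {0}"
    using d_real_irreducible[OF intertwiner_kernel_stable[OF \<theta>(1) U] _ _ n] \<theta>(2) by blast
  have zero_br: "x \<otimes> y = 0" if xy: "x \<in> K" "y \<in> K" for x y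
  proof -
    have "alt_inv_form (2 * n) ?U (\<lambda>p q. \<theta> p \<otimes> \<theta> q)"
      using intertwiner_bracket_form[OF \<theta>(1)] U(2) unfolding alt_inv_form_def by (simp add: subset_iff)
    then have "\<theta> p \<otimes> \<theta> q = 0" if "p \<in> ?U" "q \<in> ?U" for p q
      using d_real_no_alt_form[OF _ n that] by blast
    then show ?thesis using xy \<theta>U by blast
  qed
  have "D \<subseteq> {0}"
    unfolding D(1) using zero_br by (intro span_minimal) (auto simp: subspace_single_0)
  then have KV: "K = carrier L" using K_plus_D K(2) by force
  interpret dr: lie_so3_algebra "d_real n"
    using d_real_minimal_solvable[OF n] by (simp add: minimal_solvable_lie_so3_def)
  have "so3_alg_iso \<theta> (d_real n) L"
  proof unfold_locales
    have "inj_on \<theta> ?U"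
      using ker by (intro linear_inj_on_iff_eq_0[OF D'(1) subU, THEN iffD2]) auto
    then show "bij_betw \<theta> ?U (carrier L)"
      unfolding bij_betw_def using \<theta>U KV by simp
    show "\<theta> \<zero>\<^bsub>d_real n\<^esub> = \<zero>" by (simp add: d_real_simps ops linear_0[OF D'(1)])
    fix x assume x: "x \<in> ?U"
    show "\<theta> (r \<odot>\<^bsub>d_real n\<^esub> x) = r \<odot> \<theta> x" for r
      by (simp add: concreteD[OF d_real_simps(4)] ops linear_scale[OF D'(1)])
    show "\<theta> (sact (d_real n) A x) = sact L A (\<theta> x)" if "A \<in> so3" for A
      using D'(4)[OF that, of x] x U(2) by (auto simp: d_real_simps)
    fix y assume y: "y \<in> ?U"
    show "\<theta> (x \<oplus>\<^bsub>d_real n\<^esub> y) = \<theta> x \<oplus> \<theta> y"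
      by (simp add: concreteD[OF d_real_simps(4)] ops linear_add[OF D'(1)])
    show "\<theta> (x \<otimes>\<^bsub>d_real n\<^esub> y) = \<theta> x \<otimes> \<theta> y"
      using zero_br x y \<theta>U by (auto simp: d_real_simps linear_0[OF D'(1)])
  qed
  then show ?thesis by (rule so3_alg_iso.isomorphic)
qed

end

lemma (in concrete_so3_algebra) classification:
  assumes ms: "minimal_solvable_lie_so3 L" and B: "finite B" "carrier L \<subseteq> span B"
  shows "(\<exists>n\<ge>1. so3_isomorphic (d_real n) L) \<or>
    (\<exists>n\<ge>1. \<exists>P. linear P \<and> (\<forall>z. P (P z) = P z) \<and> so3_isomorphic (heis_model (2 * n - 1) P) L)"
proof -
  obtain K D where "irreducible_plus_centre L K D"
    using minimal_solvable_decomposition[OF ms] by blast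
  then interpret irreducible_plus_centre L K D .
  have "K \<subseteq> span B" using K(2) B(2) by blast
  then obtain m \<psi> where m: "m \<ge> 1" and \<psi>: "intertwiner m \<psi>" "\<psi> ` Sym m = K"
    using intertwiner_exists[OF B(1)] by blast
  show ?thesis
  proof (cases "odd m")
    case True
    then obtain n where "n \<ge> 1" "m = 2 * n - 1" by (intro that[of "(m + 1) div 2"]) presburger+
    then show ?thesis using isomorphic_heis_model[OF True \<psi>] by blast
  next
    case False
    then obtain n where "m = 2 * n" "n \<ge> 1" using m by (auto elim!: evenE)
    then show ?thesis using isomorphic_d_real \<psi> by blast
  qed
qed

section \<open>The classification\<close>

theorem proposition2p3:
  fixes Z :: "nat \<Rightarrow> nat \<Rightarrow> ((complex poly \<Rightarrow> complex poly \<Rightarrow> real) \<Rightarrow> real) set"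
  assumes Z: "\<And>n i. n \<ge> 1 \<Longrightarrow> i \<le> 3 \<Longrightarrow> has_dim (alt_dual (u_module n)) (Z n i) (3 - i)"
  shows "(\<forall>n\<ge>1. minimal_solvable_lie_so3 (d_real n))
    \<and> (\<forall>n\<ge>1. \<forall>i\<le>3. minimal_solvable_lie_so3 (hu n (Z n i)))
    \<and> (\<forall>L :: 'a so3_alg. minimal_solvable_lie_so3 L \<longrightarrow>
          (\<exists>n\<ge>1. so3_isomorphic L (d_real n))
        \<or> (\<exists>n\<ge>1. \<exists>i\<le>3. so3_isomorphic L (hu n (Z n i))))"
proof (intro conjI allI impI)
  fix n :: nat assume n: "n \<ge> 1"
  show "minimal_solvable_lie_so3 (d_real n)" by (rule d_real_minimal_solvable[OF n])
  fix i :: nat assume i: "i \<le> 3"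
  obtain F P where "linear P" and iso: "so3_alg_iso F (heis_model (2 * n - 1) P) (hu n (Z n i))"
    using hu_isomorphic_heis_model[OF n Z[OF n i]] by blast
  have "odd (2 * n - 1)" using n by presburger
  then show "minimal_solvable_lie_so3 (hu n (Z n i))"
    by (intro so3_alg_iso.M_minimal_solvable[OF iso] heis_model_minimal_solvable \<open>linear P\<close>)
next
  fix L :: "'a so3_alg" assume L: "minimal_solvable_lie_so3 L"
  then have algL: "lie_so3_algebra L" by (simp add: minimal_solvable_lie_so3_def)
  obtain f B and M :: "real poly so3_alg" where f: "so3_alg_iso f L M" "concrete M" "finite B" "carrier M \<subseteq> span B"
    using concrete_copy_exists[OF algL] by blast
  have LM: "so3_isomorphic L M" by (rule so3_alg_iso.isomorphic[OF f(1)])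
  have M: "minimal_solvable_lie_so3 M" by (rule so3_alg_iso.M_minimal_solvable[OF f(1) L])
  interpret M: concrete_so3_algebra M
    using M f(2) by (simp add: concrete_so3_algebra_def concrete_so3_algebra_axioms_def minimal_solvable_lie_so3_def)
  from M.classification[OF M f(3,4)]
  show "(\<exists>n\<ge>1. so3_isomorphic L (d_real n)) \<or> (\<exists>n\<ge>1. \<exists>i\<le>3. so3_isomorphic L (hu n (Z n i)))"
  proof (elim disjE exE conjE)
    fix n :: nat assume n: "n \<ge> 1" and iso: "so3_isomorphic (d_real n) M"
    have "lie_so3_algebra (d_real n)"
      using d_real_minimal_solvable[OF n] by (simp add: minimal_solvable_lie_so3_def)
    then have "so3_isomorphic M (d_real n)" using iso by (rule so3_isomorphic_sym)
    then show ?thesis using LM n so3_isomorphic_trans by blast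
  next
    fix n :: nat and P
    assume n: "n \<ge> 1" and P: "linear P" "\<forall>z. P (P z) = P z" and iso: "so3_isomorphic (heis_model (2 * n - 1) P) M"
    let ?m = "2 * n - 1"
    have m: "odd ?m" using n by presburger
    have algP: "lie_so3_algebra (heis_model ?m P)"
      using heis_model_minimal_solvable[OF m P(1)] by (simp add: minimal_solvable_lie_so3_def)
    define i where "i = 3 - dim {z. P z = 0}"
    have "dim {z. P z = 0} \<le> DIM(real \<times> complex)" by (rule dim_subset_UNIV)
    then have i: "i \<le> 3" "3 - i = dim {z. P z = 0}" by (simp_all add: i_def)
    obtain F Q where Q: "linear Q" "\<forall>z. Q (Q z) = Q z" "dim {z. Q z = 0} = 3 - i"
      and F: "so3_alg_iso F (heis_model ?m Q) (hu n (Z n i))"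
      using hu_isomorphic_heis_model[OF n Z[OF n i(1)]] by blast
    have MP: "so3_isomorphic M (heis_model ?m P)" using algP iso by (rule so3_isomorphic_sym)
    have PQ: "so3_isomorphic (heis_model ?m P) (heis_model ?m Q)"
      using P Q i by (intro heis_model_isomorphic_if_dim_eq m) auto
    note PQ' = so3_isomorphic_trans[OF PQ so3_alg_iso.isomorphic[OF F]]
    have "so3_isomorphic L (hu n (Z n i))"
      by (rule so3_isomorphic_trans[OF LM so3_isomorphic_trans[OF MP PQ']])
    then show ?thesis using n i(1) by blast
  qed
qed

end
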